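(* Let $X=\mathbb R^n$ and let $\nu:X\to\,]0,\infty[$ be such that $\liminf_{a\to\infty}\nu(a)=0$ and $\sup_{|b-a|\le r}\nu(b)/\nu(a)<\infty$ for each real $r$. If $S\in\mathcal B(L^2(X))$ is of class $C^{\rm u}(Q)$ and if $S\in\mathcal B(L^p(X))$ for some $p<2$, then $S$ is left $\mathscr F_\nu$-decay preserving.
   Context: Here $p\ge1$, and $S\in\mathcal B(L^p(X))$ means that $S$ induces a bounded operator on $L^p(X)$. Let $V_k$, $k\in\mathbb R^n$, be the operator of multiplication by $x\mapsto e^{i\langle x,k\rangle}$ on $L^2(X)$. $S\in\mathcal B(L^2(X))$ is of class $C^{\rm u}(Q)$ if the map $k\mapsto V_k^{-1}SV_k\in\mathcal B(L^2(X))$ is norm continuous. Let $B_a=\{x\in X:|x-a|<1\}$ and let $|\cdot|$ denote the exterior Lebesgue measure of a set. Set $\mathscr N_\nu=\{N\subset X:\limsup_{a\to\infty}\nu(a)^{-1}|N\cap B_a|<\infty\}$ and let $\mathscr F_\nu=\{F\subset X: X\setminus F\in\mathscr N_\nu\}$; this is a filter on $X$ finer than the filter of sets with relatively compact complement. Let $B_{\mathscr F_\nu}(X)$ be the $C^*$-algebra of bounded Borel functions $\varphi:X\to\mathbb C$ with $\lim_{\mathscr F_\nu}\varphi=0$, i.e. $\{x:|\varphi(x)|<\varepsilon\}\in\mathscr F_\nu$ for each $\varepsilon>0$; $\varphi(Q)$ is multiplication by $\varphi$ on $L^2(X)$. $S\in\mathcal B(L^2(X))$ is left $\mathscr F_\nu$-decay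 preserving if for every $\varphi\in B_{\mathscr F_\nu}(X)$ the operator $S\varphi(Q)$ belongs to the norm-closed linear span of the operators $\psi(Q)T$ with $\psi\in B_{\mathscr F_\nu}(X)$, $T\in\mathcal B(L^2(X))$. *)

theory Defs
  imports "HOL-Analysis.Analysis"
begin

text \<open>
  Elements of the complex space L^p are handled through Borel representatives, so the actual
  Banach space is \<^term>\<open>Lp p\<close> modulo equality almost everywhere. Accordingly, operators are maps
  between functions, of which only the values on \<^term>\<open>Lp p\<close>, taken modulo equality
  almost everywhere, are relevant. None of the notions below depends on the values of an operator
  outside the space it acts on. The difference of two operators is the pointwise one
  (type class instance for \<open>(-)\<close> on functions).
\<close>

type_synonym 'a oper = "('a \<Rightarrow> complex) \<Rightarrow> ('a \<Rightarrow> complex)"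

definition Lp :: "real \<Rightarrow> ('a::euclidean_space \<Rightarrow> complex) set" where
  "Lp p = {f \<in> borel_measurable borel. integrable lborel (\<lambda>x. cmod (f x) powr p)}"

definition Lp_norm :: "real \<Rightarrow> ('a::euclidean_space \<Rightarrow> complex) \<Rightarrow> real" where
  "Lp_norm p f = (LINT x|lborel. cmod (f x) powr p) powr (1 / p)"

definition bounded_opers :: "real \<Rightarrow> 'a::euclidean_space oper set" where
  "bounded_opers p = {T.
     (\<forall>f\<in>Lp p. T f \<in> Lp p) \<and>
     (\<forall>f\<in>Lp p. \<forall>g\<in>Lp p. (AE x in lborel. f x = g x) \<longrightarrow> (AE x in lborel. T f x = T g x)) \<and>
     (\<forall>f\<in>Lp p. \<forall>g\<in>Lp p. AE x in lborel. T (\<lambda>y. f y + g y) x = T f x + T g x) \<and>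
     (\<forall>f\<in>Lp p. \<forall>c. AE x in lborel. T (\<lambda>y. c * f y) x = c * T f x) \<and>
     (\<exists>C. \<forall>f\<in>Lp p. Lp_norm p (T f) \<le> C * Lp_norm p f)}"

text \<open>
  As for \<^const>\<open>onorm\<close>, the value is meaningful only for bounded operators; the quotient is 0
  for null functions.
\<close>

definition oper_norm :: "real \<Rightarrow> 'a::euclidean_space oper \<Rightarrow> real" where
  "oper_norm p T = (SUP f\<in>Lp p. Lp_norm p (T f) / Lp_norm p f)"

text \<open>An operator on L^2 induces a bounded operator on L^p if some bounded operator
  on L^p coincides with it on the intersection of both spaces (which is dense in L^p for
  finite p).\<close>

definition induces_bounded :: "real \<Rightarrow> 'a::euclidean_space oper \<Rightarrow> bool" where
  "induces_bounded p S \<longleftrightarrow>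
     (\<exists>T\<in>bounded_opers p. \<forall>f\<in>Lp 2 \<inter> Lp p. AE x in lborel. T f x = S f x)"

definition mult_oper :: "('a \<Rightarrow> complex) \<Rightarrow> 'a oper" where
  "mult_oper \<phi> f = (\<lambda>x. \<phi> x * f x)"

definition V :: "'a::euclidean_space \<Rightarrow> 'a oper" where
  "V k = mult_oper (\<lambda>x. exp (\<i> * complex_of_real (x \<bullet> k)))"

lemma inv_V: "inv (V k) = V (- k)"
  by (rule inv_unique_comp) (auto simp: V_def mult_oper_def fun_eq_iff exp_minus)

definition class_Cu :: "'a::euclidean_space oper \<Rightarrow> bool" where
  "class_Cu S \<longleftrightarrow> S \<in> bounded_opers 2 \<and>
     (\<forall>k. ((\<lambda>h. oper_norm 2 ((inv (V h) \<circ> S \<circ> V h) - (inv (V k) \<circ> S \<circ> V k))) \<longlongrightarrow> 0) (at k))"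

definition N_sets :: "('a::euclidean_space \<Rightarrow> real) \<Rightarrow> 'a set set" where
  "N_sets \<nu> = {N. Limsup at_infinity
     (\<lambda>a. outer_measure_of lebesgue (N \<inter> ball a 1) / ennreal (\<nu> a)) < \<infinity>}"

definition F_sets :: "('a::euclidean_space \<Rightarrow> real) \<Rightarrow> 'a set set" where
  "F_sets \<nu> = {F. - F \<in> N_sets \<nu>}"

definition B_vanishing :: "'a::euclidean_space set set \<Rightarrow> ('a \<Rightarrow> complex) set" where
  "B_vanishing \<F> = {\<phi> \<in> borel_measurable borel.
     bounded (range \<phi>) \<and> (\<forall>\<epsilon>>0. {x. cmod (\<phi> x) < \<epsilon>} \<in> \<F>)}"

definition oper_span :: "'a oper set \<Rightarrow> 'a oper set" where
  "oper_span M = {\<lambda>f x. \<Sum>j<m. c j * A j f x | (m::nat) c A. \<forall>j<m. A j \<in> M}"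

definition closed_oper_span :: "real \<Rightarrow> 'a::euclidean_space oper set \<Rightarrow> 'a oper set" where
  "closed_oper_span p M =
     {A \<in> bounded_opers p. \<forall>\<epsilon>>0. \<exists>B\<in>oper_span M. oper_norm p (A - B) < \<epsilon>}"

definition left_decay_preserving :: "'a::euclidean_space set set \<Rightarrow> 'a oper \<Rightarrow> bool" where
  "left_decay_preserving \<F> S \<longleftrightarrow> S \<in> bounded_opers 2 \<and>
     (\<forall>\<phi>\<in>B_vanishing \<F>. S \<circ> mult_oper \<phi> \<in>
        closed_oper_span 2 {mult_oper \<psi> \<circ> T | \<psi> T. \<psi> \<in> B_vanishing \<F> \<and> T \<in> bounded_opers 2})"

end

theory Submission
  imports Defs
begin

text \<open>
  Regularity of class C^u makes \<open>S\<close> a norm limit of its block averages: average over all cubes of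
  side \<open>R\<close> with integral corners the compressions of \<open>S\<close> to these cubes. On functions supported in
  finitely many unit cells the block average is a finite convex combination, with Fejer weights, of
  conjugates of \<open>S\<close> by characters constant on the cells, and the weights concentrate at the trivial
  character as \<open>R\<close> grows.

  A compression of \<open>S\<close> to a cube, restricted to functions supported in a subset \<open>D\<close>, is handled by
  Maurey's factorisation idea. By Khintchine's inequality and boundedness on L^p, the convex set
  of all square functions \<open>\<Sum>\<^sub>i \<bar>S f\<^sub>i\<bar>\<^sup>2\<close> with \<open>\<Sum>\<^sub>i \<parallel>f\<^sub>i\<parallel>\<^sup>2 \<le> 1\<close> is small in measure, hence one exceptional
  set \<open>G\<close> with \<open>|G| \<le> \<kappa> |D|\<close> serves all of them: outside \<open>G\<close> the operator has small norm. If \<open>\<phi>\<close>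
  vanishes along the filter, take for \<open>D\<close> the part of \<open>{\<bar>\<phi>\<bar> \<ge> t}\<close> in each cube; the union \<open>E\<close> of
  the exceptional sets has complement in the filter, and \<open>S \<phi>(Q)\<close> is norm close to \<open>1\<^sub>E(Q) S \<phi>(Q)\<close>.
\<close>

text \<open>For a single f supported in a set D, boundedness on L^p makes \<open>S f\<close> small
  off a set of small measure, but that set moves with f, while decay preservation asks for one set
  serving all f. It comes from a variational argument: minimising the integral of exp(-g) over a
  convex set yields a limit density Y, and the first-order inequality at the minimum bounds the
  integral of Y h for every competitor h at once. Square functions enter because the functions |S
  f|^2 alone do not form a convex set. Two constraints shape the rest. The minimisation needs finite
  total measure, and \<open>N_sets\<close> is a condition on unit balls, so exceptional sets must be
  controlled locally; hence S is first replaced by an operator of finite range. The constants must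
  also be uniform over all cubes: the L^p bound on D scales like |D|^(1 - p/2), and the truncation
  level is tied to |D| so that the exceptional set is linear in |D| while the L^2 bound does not see
  |D|. Sampling frequencies on a finite grid keeps all averages finite sums.\<close>

section \<open>Exceptional sets of convex sets of functions\<close>

text \<open>Minimise the integral of exp(-g) over K. Along a minimising sequence exp(-g_n)
  converges, on a subsequence, to some Y in [0,1]; the minimiser itself may be infinite where Y = 0.
  Moving from g_n towards any h in K cannot go below the infimum, and to first order this says that
  the integral of Y h is at most b. Now let G be the set where Y < 1/2: it is small by Chebyshev,
  and off it h is at most 2 Y h.\<close>

lemma convex_set_small_exceptional_set:
  fixes M :: "'a measure" and K :: "('a \<Rightarrow> real) set"
  assumes "finite_measure M" and "K \<noteq> {}"
    and meas: "\<And>g. g \<in> K \<Longrightarrow> g \<in> borel_measurable M"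
    and nonneg: "\<And>g x. g \<in> K \<Longrightarrow> 0 \<le> g x"
    and convex: "\<And>g h t. \<lbrakk>g \<in> K; h \<in> K; 0 < t; t < 1\<rbrakk> \<Longrightarrow> (\<lambda>x. (1 - t) * g x + t * h x) \<in> K"
    and bound: "\<And>g. g \<in> K \<Longrightarrow> (LINT x|M. 1 - exp (- g x)) \<le> b"
  obtains G where "G \<in> sets M" "measure M G \<le> 2 * b"
    "\<And>g. g \<in> K \<Longrightarrow> (\<integral>\<^sup>+x. ennreal (g x) * indicator (space M - G) x \<partial>M) \<le> ennreal (2 * b)"
proof -
  interpret finite_measure M by fact
  define I where "I g = (LINT x|M. exp (- g x))" for g :: "'a \<Rightarrow> real"
  define m where "m = (INF g\<in>K. I g)"
  have int_exp: "integrable M (\<lambda>x. exp (- c * g x))" if "g \<in> K" "c \<ge> 0" for g c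
    using that nonneg[OF that(1)] meas[OF that(1)]
    by (intro integrable_const_bound[where B = 1]) auto
  have int_exp1: "integrable M (\<lambda>x. exp (- g x))" if "g \<in> K" for g
    using int_exp[OF that, of 1] by simp
  have I_nonneg: "0 \<le> I g" for g by (simp add: I_def)
  have bdd: "bdd_below (I ` K)" using I_nonneg by (metis bdd_belowI2)
  have m_le: "m \<le> I g" if "g \<in> K" for g
    unfolding m_def using bdd that by (rule cINF_lower)
  have I_ge: "measure M (space M) - b \<le> I g" if "g \<in> K" for g
    using bound[OF that] int_exp1[OF that] by (simp add: I_def)
  have m_ge: "measure M (space M) - b \<le> m"
    unfolding m_def using I_ge assms(2) by (intro cINF_greatest) auto
  have "\<exists>g\<in>K. I g < m + 1 / real (Suc n)" for n
    using cINF_less_iff[OF assms(2) bdd, of "m + 1 / real (Suc n)"] by (auto simp: m_def)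
  then obtain g where gK: "g n \<in> K" and gI: "I (g n) < m + 1 / real (Suc n)" for n
    by metis
  note [measurable] = meas[OF gK]
  define y where "y n x = exp (- g n x)" for n x
  \<comment> \<open>Square roots of the \<open>y n\<close>: the midpoint of \<open>g n\<close> and
    \<open>g k\<close> has exponential \<open>u n * u k\<close>, so near-minimality becomes
    smallness of u n - u k in L^2.\<close>
  define u where "u n x = exp (- (1/2) * g n x)" for n x
  have y_u: "y n x = (u n x)\<^sup>2" for n x
    by (simp add: y_def u_def power2_eq_square flip: exp_add)
  have y01: "0 \<le> y n x" "y n x \<le> 1" and u01: "0 \<le> u n x" "u n x \<le> 1" for n x
    using nonneg[OF gK] by (auto simp: y_def u_def)
  have [measurable]: "y n \<in> borel_measurable M" "u n \<in> borel_measurable M" for n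
    unfolding y_def u_def by measurable
  have yint: "integrable M (y n)" and uint: "integrable M (u n)" for n
    using y01 u01 by (auto intro!: integrable_const_bound[where B = 1])
  have uuint: "integrable M (\<lambda>x. u n x * u k x)" for n k
    using u01 by (intro integrable_const_bound[where B = 1]) (auto simp: abs_mult mult_le_one)
  have sq: "(LINT x|M. (u n x - u k x)\<^sup>2) \<le> 1 / real (Suc n) + 1 / real (Suc k)" for n k
  proof -
    have "(\<lambda>x. (1 - 1/2) * g n x + 1/2 * g k x) \<in> K"
      by (rule convex[OF gK gK]) auto
    from m_le[OF this] have "m \<le> (LINT x|M. u n x * u k x)"
      by (simp add: I_def u_def algebra_simps flip: exp_add)
    moreover have "(LINT x|M. (u n x - u k x)\<^sup>2) = I (g n) + I (g k) - 2 * (LINT x|M. u n x * u k x)"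
    proof -
      have "(LINT x|M. (u n x - u k x)\<^sup>2) = (LINT x|M. y n x + y k x - 2 * (u n x * u k x))"
        by (intro Bochner_Integration.integral_cong) (auto simp: y_u power2_eq_square algebra_simps)
      also have "\<dots> = I (g n) + I (g k) - 2 * (LINT x|M. u n x * u k x)"
        using yint uuint by (simp add: I_def y_def[symmetric])
      finally show ?thesis .
    qed
    ultimately show ?thesis using gI[of n] gI[of k] by linarith
  qed
  have Cauchy: "\<exists>n0. \<forall>i\<ge>n0. \<forall>j\<ge>n0. (LINT x|M. norm (y i x - y j x)) < e" if e: "e > 0" for e
  proof -
    \<comment> \<open>Threshold for |u i - u j|: below it the constant 2 \<tau> is paid, above it
      the square divided by \<tau>. The summand 1 covers a space of measure 0.\<close>
    define \<tau> where "\<tau> = e / (4 * (measure M (space M) + 1))"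
    have pos: "measure M (space M) + 1 > 0" by (simp add: add_nonneg_pos)
    then have \<tau>: "\<tau> > 0" using e by (simp add: \<tau>_def)
    have \<tau>M: "2 * \<tau> * measure M (space M) \<le> e / 2"
    proof -
      have "2 * \<tau> * measure M (space M) = (e / 2) * (measure M (space M) / (measure M (space M) + 1))"
        using pos by (simp add: \<tau>_def divide_simps)
      also have "\<dots> \<le> (e / 2) * 1" using e pos by (intro mult_left_mono) (auto simp: divide_le_eq_1)
      finally show ?thesis by simp
    qed
    obtain n0 :: nat where n0: "real n0 > 16 / (\<tau> * e)" using reals_Archimedean2 by blast
    have "(LINT x|M. norm (y i x - y j x)) < e" if "i \<ge> n0" "j \<ge> n0" for i j
    proof -
      have int2: "integrable M (\<lambda>x. (u i x - u j x)\<^sup>2)"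
      proof (rule integrable_const_bound[where B = 1])
        have "\<bar>u i x - u j x\<bar> \<le> 1" for x
          using u01[of i x] u01[of j x] by (auto simp: abs_le_iff)
        then show "AE x in M. norm ((u i x - u j x)\<^sup>2) \<le> 1"
          by (simp add: abs_square_le_1)
      qed measurable
      have "norm (y i x - y j x) \<le> 2 * \<tau> + 2 / \<tau> * (u i x - u j x)\<^sup>2" for x
      proof -
        have "norm (y i x - y j x) = \<bar>u i x - u j x\<bar> * (u i x + u j x)"
          using u01[of i x] u01[of j x] by (simp add: y_u power2_eq_square square_diff_square_factored abs_mult)
        also have "\<dots> \<le> \<bar>u i x - u j x\<bar> * 2"
          using u01[of i x] u01[of j x] by (intro mult_left_mono) auto
        also have "\<dots> \<le> 2 * \<tau> + 2 / \<tau> * (u i x - u j x)\<^sup>2"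
        proof (cases "\<bar>u i x - u j x\<bar> \<le> \<tau>")
          case True then show ?thesis using \<tau> by (simp add: add_increasing2)
        next
          case False
          then have "\<tau> * \<bar>u i x - u j x\<bar> \<le> \<bar>u i x - u j x\<bar> * \<bar>u i x - u j x\<bar>"
            by (intro mult_right_mono) auto
          then have "\<bar>u i x - u j x\<bar> \<le> (u i x - u j x)\<^sup>2 / \<tau>"
            using \<tau> by (simp add: pos_le_divide_eq power2_eq_square mult.commute)
          then show ?thesis using \<tau> by simp
        qed
        finally show ?thesis .
      qed
      then have "(LINT x|M. norm (y i x - y j x)) \<le> (LINT x|M. 2 * \<tau> + 2 / \<tau> * (u i x - u j x)\<^sup>2)"
        using yint int2 by (intro integral_mono) auto
      also have "\<dots> = 2 * \<tau> * measure M (space M) + 2 / \<tau> * (LINT x|M. (u i x - u j x)\<^sup>2)"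
        using int2 by simp
      also have "\<dots> \<le> 2 * \<tau> * measure M (space M) + 2 / \<tau> * (2 / real (Suc n0))"
      proof -
        have "1 / real (Suc i) + 1 / real (Suc j) \<le> 1 / real (Suc n0) + 1 / real (Suc n0)"
          using that by (intro add_mono divide_left_mono) auto
        then have "(LINT x|M. (u i x - u j x)\<^sup>2) \<le> 2 / real (Suc n0)"
          using sq[of i j] by simp
        then show ?thesis using \<tau> by (intro add_left_mono mult_left_mono) auto
      qed
      also have "2 / \<tau> * (2 / real (Suc n0)) < e / 4"
      proof -
        have "16 < real (Suc n0) * (\<tau> * e)"
          using n0 \<tau> e by (simp add: pos_divide_less_eq algebra_simps) (use mult_pos_pos[OF \<tau> e] in linarith)
        then show ?thesis using \<tau> e mult_nonneg_nonneg[of \<tau> "real n0"] by (simp add: divide_simps algebra_simps not_less)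
      qed
      finally show ?thesis using \<tau>M e by linarith
    qed
    then show ?thesis by blast
  qed
  obtain r where r: "strict_mono r" and AEC: "AE x in M. Cauchy (\<lambda>i. y (r i) x)"
    using cauchy_L1_AE_cauchy_subseq[of M y, OF yint Cauchy] by metis
  define Y where "Y x = lim (\<lambda>i. y (r i) x)" for x
  have [measurable]: "Y \<in> borel_measurable M"
    unfolding Y_def by measurable
  have lim: "AE x in M. (\<lambda>i. y (r i) x) \<longlonglongrightarrow> Y x"
    using AEC by eventually_elim (simp add: Y_def Cauchy_convergent_iff convergent_LIMSEQ_iff)
  have Y01: "AE x in M. 0 \<le> Y x \<and> Y x \<le> 1"
    using lim
  proof eventually_elim
    case (elim x)
    show ?case using LIMSEQ_le_const[OF elim, of 0] LIMSEQ_le_const2[OF elim, of 1] y01 by auto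
  qed
  have eta: "(\<lambda>i. 1 / real (Suc (r i))) \<longlonglongrightarrow> 0"
    using LIMSEQ_subseq_LIMSEQ[OF LIMSEQ_inverse_real_of_nat r] by (simp add: o_def inverse_eq_divide)
  have limY: "(\<lambda>i. LINT x|M. y (r i) x) \<longlonglongrightarrow> (LINT x|M. Y x)" and intY: "integrable M Y"
    using y01 lim by (auto intro!: integral_dominated_convergence[where w = "\<lambda>_. 1"]
        integrable_dominated_convergence[where w = "\<lambda>_. 1" and s = "\<lambda>i. y (r i)"])
  have ge: "measure M (space M) - b \<le> (LINT x|M. Y x)"
    using limY by (rule LIMSEQ_le_const) (use I_ge[OF gK] in \<open>auto simp: I_def y_def\<close>)
  define G where "G = {x \<in> space M. Y x < 1/2}"
  have GM[measurable]: "G \<in> sets M" unfolding G_def by measurable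
  have "measure M G \<le> 2 * b"
  proof -
    have "measure M G = (LINT x|M. indicator G x)" by simp
    also have "(LINT x|M. indicator G x) \<le> (LINT x|M. 2 * (1 - Y x))"
    proof (rule integral_mono_AE)
      show "AE x in M. indicator G x \<le> 2 * (1 - Y x)"
        using Y01 by eventually_elim (auto simp: G_def indicator_def)
      show "integrable M (indicator G :: 'a \<Rightarrow> real)"
        by (intro integrable_real_indicator) (auto simp: less_top[symmetric])
    qed (use intY in auto)
    also have "(LINT x|M. 2 * (1 - Y x)) \<le> 2 * b" using ge intY by simp
    finally show ?thesis .
  qed
  moreover have "(\<integral>\<^sup>+x. ennreal (h x) * indicator (space M - G) x \<partial>M) \<le> ennreal (2 * b)" if h: "h \<in> K" for h
  proof -
    note [measurable] = meas[OF h]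
    have h0: "0 \<le> h x" for x using nonneg[OF h] .
    have step1: "(LINT x|M. y n x * (1 - exp (- t * h x))) \<le> 1 / real (Suc n) + t * b"
      if t: "0 < t" "t < 1" for n t
    proof -
      \<comment> \<open>Convexity of exp between -g_n and 0 puts e below the chord (1 - t) y n + t.
        This bounds how much the integral can rise when g_n shrinks by the factor 1 - t.\<close>
      define e where "e x = exp (- (1 - t) * g n x)" for x
      have "(\<lambda>x. (1 - t) * g n x + t * h x) \<in> K" by (rule convex[OF gK h t])
      from m_le[OF this] have 1: "m \<le> (LINT x|M. e x * exp (- t * h x))"
        by (simp add: I_def e_def algebra_simps flip: exp_add)
      have e01: "y n x \<le> e x" "e x \<le> 1" "e x \<le> (1 - t) * y n x + t" for x
      proof -
        show "y n x \<le> e x" using nonneg[OF gK, of n x] t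
          by (auto simp: y_def e_def algebra_simps)
        show "e x \<le> 1" using nonneg[OF gK, of n x] t by (simp add: e_def mult_nonpos_nonneg)
        show "e x \<le> (1 - t) * y n x + t"
          using convex_onD[OF exp_convex, of t "- g n x" 0] t by (simp add: e_def y_def algebra_simps)
      qed
      have em[measurable]: "e \<in> borel_measurable M" unfolding e_def by measurable
      have i1: "integrable M e" and i2: "integrable M (\<lambda>x. e x * exp (- t * h x))"
        using e01 y01 t h0 order_trans[OF y01(1) e01(1)]
        by (auto intro!: integrable_const_bound[where B = 1] mult_le_one always_eventually simp: abs_mult)
      have i3: "integrable M (\<lambda>x. y n x * (1 - exp (- t * h x)))"
        using y01 t h0
        by (intro integrable_const_bound[where B = 1]) (auto intro!: mult_le_one simp: abs_mult)
      have "(LINT x|M. y n x * (1 - exp (- t * h x))) \<le> (LINT x|M. e x - e x * exp (- t * h x))"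
      proof (intro integral_mono i3 Bochner_Integration.integrable_diff i1 i2)
        fix x
        have "y n x * (1 - exp (- t * h x)) \<le> e x * (1 - exp (- t * h x))"
          using e01(1) t h0 by (intro mult_right_mono) auto
        then show "y n x * (1 - exp (- t * h x)) \<le> e x - e x * exp (- t * h x)"
          by (simp add: algebra_simps)
      qed
      also have "\<dots> \<le> (LINT x|M. e x) - m" using 1 i1 i2 by simp
      also have "(LINT x|M. e x) \<le> (LINT x|M. (1 - t) * y n x + t)"
        using i1 yint e01(3) by (intro integral_mono) auto
      also have "\<dots> = (1 - t) * I (g n) + t * measure M (space M)"
        using yint by (simp add: I_def y_def[symmetric])
      also have "\<dots> - m = (I (g n) - m) + t * (measure M (space M) - I (g n))"
        by (simp add: algebra_simps)
      also have "\<dots> \<le> 1 / real (Suc n) + t * b"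
        using gI[of n] I_ge[OF gK, of n] t by (intro add_mono mult_left_mono) auto
      finally show ?thesis by simp
    qed
    have step2: "(LINT x|M. Y x * (1 - exp (- t * h x))) \<le> t * b" if t: "0 < t" "t < 1" for t
    proof -
      have "(\<lambda>i. LINT x|M. y (r i) x * (1 - exp (- t * h x))) \<longlonglongrightarrow> (LINT x|M. Y x * (1 - exp (- t * h x)))"
        using lim y01 t h0
        by (intro integral_dominated_convergence[where w = "\<lambda>_. 1"])
           (auto intro!: mult_le_one tendsto_mult simp: abs_mult elim: eventually_mono)
      moreover have "(\<lambda>i. 1 / real (Suc (r i)) + t * b) \<longlonglongrightarrow> 0 + t * b"
        by (intro tendsto_add eta tendsto_const)
      ultimately show ?thesis using step1[OF t] by (auto intro: LIMSEQ_le)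
    qed
    \<comment> \<open>The offset 2 keeps T strictly between 0 and 1 already at n = 0, as
      \<open>convex\<close> requires.\<close>
    define T where "T n = 1 / (real n + 2)" for n :: nat
    have T: "0 < T n" "T n < 1" for n by (auto simp: T_def)
    have T0: "T \<longlonglongrightarrow> 0" unfolding T_def using LIMSEQ_ignore_initial_segment[OF LIMSEQ_inverse_real_of_nat, of 1] by (simp add: inverse_eq_divide add.commute)
    have quot: "(\<lambda>n. (1 - exp (- T n * s)) / T n) \<longlonglongrightarrow> s" for s
    proof (cases "s = 0")
      case False
      have "((\<lambda>z. exp (- z * s)) has_real_derivative - s) (at 0)"
        by (auto intro!: derivative_eq_intros)
      then have "((\<lambda>z. (exp (- z * s) - 1) / z) \<longlongrightarrow> - s) (at 0)"
        by (simp add: DERIV_def)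
      moreover have "filterlim T (at 0) sequentially"
        using T0 T(1) by (auto simp: filterlim_at intro!: always_eventually) (metis less_irrefl)
      ultimately have "(\<lambda>n. (exp (- T n * s) - 1) / T n) \<longlonglongrightarrow> - s"
        by (rule filterlim_compose)
      from tendsto_minus[OF this] show ?thesis by (simp add: minus_divide_left)
    qed simp
    \<comment> \<open>Integrability of h is not known, so the difference quotients (1 - exp(-t h)) /
      t, which tend to h, are passed to the limit by Fatou.\<close>
    have "(\<integral>\<^sup>+x. ennreal (Y x * h x) \<partial>M) \<le> ennreal b"
    proof -
      have "(\<integral>\<^sup>+x. ennreal (Y x * h x) \<partial>M)
          = (\<integral>\<^sup>+x. liminf (\<lambda>n. ennreal (Y x * ((1 - exp (- T n * h x)) / T n))) \<partial>M)"
        by (intro nn_integral_cong lim_imp_Liminf[symmetric] tendsto_ennrealI tendsto_mult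
            tendsto_const quot) auto
      also have "\<dots> \<le> liminf (\<lambda>n. \<integral>\<^sup>+x. ennreal (Y x * ((1 - exp (- T n * h x)) / T n)) \<partial>M)"
        by (intro nn_integral_liminf) measurable
      also have "\<dots> \<le> limsup (\<lambda>n. \<integral>\<^sup>+x. ennreal (Y x * ((1 - exp (- T n * h x)) / T n)) \<partial>M)"
        by (intro Liminf_le_Limsup) simp
      also have "\<dots> \<le> ennreal b"
      proof (intro Limsup_bounded always_eventually allI)
        fix n
        have int: "integrable M (\<lambda>x. Y x * (1 - exp (- T n * h x)))"
        proof (rule integrable_const_bound[where B = 1])
          show "AE x in M. norm (Y x * (1 - exp (- T n * h x))) \<le> 1"
            using Y01 by eventually_elim (use T[of n] h0 in \<open>auto intro!: mult_le_one simp: abs_mult less_imp_le\<close>)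
        qed measurable
        have "(\<integral>\<^sup>+x. ennreal (Y x * ((1 - exp (- T n * h x)) / T n)) \<partial>M)
          = ennreal (LINT x|M. Y x * (1 - exp (- T n * h x)) / T n)"
        proof (subst nn_integral_eq_integral[symmetric])
          show "AE x in M. 0 \<le> Y x * (1 - exp (- T n * h x)) / T n"
            using Y01 by eventually_elim (use T[of n] h0 in \<open>auto simp: less_imp_le\<close>)
        qed (use int in auto)
        also have "(LINT x|M. Y x * (1 - exp (- T n * h x)) / T n) \<le> b"
          using step2[OF T, of n] T(1)[of n] by (simp add: pos_divide_le_eq mult.commute)
        finally show "(\<integral>\<^sup>+x. ennreal (Y x * ((1 - exp (- T n * h x)) / T n)) \<partial>M) \<le> ennreal b"
          by (simp add: ennreal_leI)
      qed
      finally show ?thesis .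
    qed
    have "(\<integral>\<^sup>+x. ennreal (h x) * indicator (space M - G) x \<partial>M) \<le> (\<integral>\<^sup>+x. 2 * ennreal (Y x * h x) \<partial>M)"
    proof (intro nn_integral_mono)
      fix x assume "x \<in> space M"
      then show "ennreal (h x) * indicator (space M - G) x \<le> 2 * ennreal (Y x * h x)"
        using h0[of x] mult_right_mono[of 1 "2 * Y x" "h x"]
        by (auto simp: G_def indicator_def not_less ennreal_mult'[symmetric] intro!: ennreal_leI
            simp flip: ennreal_numeral)
    qed
    also have "\<dots> = 2 * (\<integral>\<^sup>+x. ennreal (Y x * h x) \<partial>M)" by (rule nn_integral_cmult) measurable
    also have "\<dots> \<le> 2 * ennreal b" by (rule mult_left_mono) (use \<open>(\<integral>\<^sup>+x. ennreal (Y x * h x) \<partial>M) \<le> ennreal b\<close> in auto)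
    also have "\<dots> = ennreal (2 * b)" by (simp add: ennreal_mult')
    finally show ?thesis .
  qed
  ultimately show thesis by (intro that[OF GM])
qed

section \<open>Khintchine's inequality\<close>

text \<open>A Rademacher sum: A records where the sign is +1, so a sum over \<open>Pow I\<close>
  divided by \<open>2 ^ card I\<close> is an expectation over independent random signs.\<close>

definition sign_sum :: "'i set \<Rightarrow> 'i set \<Rightarrow> ('i \<Rightarrow> complex) \<Rightarrow> complex" where
  "sign_sum I A a = (\<Sum>i\<in>I. (if i \<in> A then 1 else -1) * a i)"

text \<open>Subsets of \<open>insert k I\<close> pair up as A and \<open>insert k A\<close>, which
  amounts to averaging over the sign of the new index first. This drives the induction for both
  moments.\<close>

lemma sum_Pow_insert_sign_sum:
  fixes F :: "complex \<Rightarrow> real"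
  assumes "finite I" "k \<notin> I"
  shows "(\<Sum>A\<in>Pow (insert k I). F (sign_sum (insert k I) A a))
    = (\<Sum>A\<in>Pow I. F (sign_sum I A a + a k) + F (sign_sum I A a - a k))"
proof -
  have inj: "inj_on (insert k) (Pow I)"
    using assms by (auto simp: inj_on_def)
  have plus: "sign_sum (insert k I) (insert k A) a = sign_sum I A a + a k" for A
    using assms
    by (auto simp: sign_sum_def add.commute intro!: sum.cong)
  have minus: "sign_sum (insert k I) A a = sign_sum I A a - a k" if "A \<subseteq> I" for A
    using assms that by (auto simp: sign_sum_def)
  have "(\<Sum>A\<in>Pow (insert k I). F (sign_sum (insert k I) A a))
    = (\<Sum>A\<in>Pow I. F (sign_sum (insert k I) A a))
      + (\<Sum>A\<in>insert k ` Pow I. F (sign_sum (insert k I) A a))"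
    unfolding Pow_insert using assms by (intro sum.union_disjoint) auto
  also have "(\<Sum>A\<in>insert k ` Pow I. F (sign_sum (insert k I) A a)) = (\<Sum>A\<in>Pow I. F (sign_sum I A a + a k))"
    using inj by (simp add: sum.reindex plus)
  also have "(\<Sum>A\<in>Pow I. F (sign_sum (insert k I) A a)) = (\<Sum>A\<in>Pow I. F (sign_sum I A a - a k))"
    by (intro sum.cong) (auto simp: minus)
  finally show ?thesis by (simp add: sum.distrib)
qed

lemma cmod_add_sq: "(cmod (z + w))\<^sup>2 = (cmod z)\<^sup>2 + (cmod w)\<^sup>2 + 2 * Re (z * cnj w)"
  and cmod_diff_sq: "(cmod (z - w))\<^sup>2 = (cmod z)\<^sup>2 + (cmod w)\<^sup>2 - 2 * Re (z * cnj w)"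
  unfolding cmod_power2 by (simp_all add: power2_eq_square algebra_simps)

lemma sign_sum_second_moment:
  assumes "finite I"
  shows "(\<Sum>A\<in>Pow I. (cmod (sign_sum I A a))\<^sup>2) = 2 ^ card I * (\<Sum>i\<in>I. (cmod (a i))\<^sup>2)"
  using assms
proof (induction I)
  case (insert k I)
  have "(\<Sum>A\<in>Pow (insert k I). (cmod (sign_sum (insert k I) A a))\<^sup>2)
    = (\<Sum>A\<in>Pow I. 2 * (cmod (sign_sum I A a))\<^sup>2 + 2 * (cmod (a k))\<^sup>2)"
    by (simp add: sum_Pow_insert_sign_sum[OF insert(1,2), of "\<lambda>z. (cmod z)\<^sup>2"]
        cmod_add_sq cmod_diff_sq)
  also have "\<dots> = 2 * (2 ^ card I * (\<Sum>i\<in>I. (cmod (a i))\<^sup>2)) + 2 ^ card I * 2 * (cmod (a k))\<^sup>2"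
    using insert by (simp add: sum.distrib card_Pow flip: sum_distrib_left)
  finally show ?case using insert by (simp add: algebra_simps)
qed (simp add: sign_sum_def)

text \<open>Adding an index w to a sum z contributes |z+w|^4 + |z-w|^4, whose mixed term is at most
  12 |z|^2 |w|^2 and is averaged exactly by the second moment. Raising the coefficient of |w|^4 from
  2 to 6 completes the square, whence the constant 3.\<close>

lemma sign_sum_fourth_moment:
  assumes "finite I"
  shows "(\<Sum>A\<in>Pow I. (cmod (sign_sum I A a)) ^ 4) \<le> 3 * 2 ^ card I * (\<Sum>i\<in>I. (cmod (a i))\<^sup>2)\<^sup>2"
  using assms
proof (induction I)
  case (insert k I)
  have 1: "(cmod (z + w)) ^ 4 + (cmod (z - w)) ^ 4
      \<le> 2 * (cmod z) ^ 4 + 12 * ((cmod z)\<^sup>2 * (cmod w)\<^sup>2) + 2 * (cmod w) ^ 4" for z w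
  proof -
    have "\<bar>Re (z * cnj w)\<bar> \<le> cmod z * cmod w"
      using abs_Re_le_cmod[of "z * cnj w"] by (simp add: norm_mult)
    then have "(Re (z * cnj w))\<^sup>2 \<le> (cmod z * cmod w)\<^sup>2"
      by (metis abs_ge_zero power2_abs power_mono)
    moreover have "(cmod (z + w)) ^ 4 + (cmod (z - w)) ^ 4
        = 2 * ((cmod z)\<^sup>2 + (cmod w)\<^sup>2)\<^sup>2 + 8 * (Re (z * cnj w))\<^sup>2"
    proof -
      have "(cmod (z + w)) ^ 4 = ((cmod (z + w))\<^sup>2)\<^sup>2" "(cmod (z - w)) ^ 4 = ((cmod (z - w))\<^sup>2)\<^sup>2"
        by simp_all
      then show ?thesis
        unfolding cmod_add_sq cmod_diff_sq by (simp add: power2_eq_square algebra_simps)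
    qed
    moreover have "2 * ((cmod z)\<^sup>2 + (cmod w)\<^sup>2)\<^sup>2 + 8 * (cmod z * cmod w)\<^sup>2
        = 2 * (cmod z) ^ 4 + 12 * ((cmod z)\<^sup>2 * (cmod w)\<^sup>2) + 2 * (cmod w) ^ 4"
      by (simp add: power2_eq_square power4_eq_xxxx algebra_simps)
    ultimately show ?thesis by linarith
  qed
  let ?s = "\<Sum>i\<in>I. (cmod (a i))\<^sup>2"
  have "(\<Sum>A\<in>Pow (insert k I). (cmod (sign_sum (insert k I) A a)) ^ 4)
    \<le> (\<Sum>A\<in>Pow I. 2 * (cmod (sign_sum I A a)) ^ 4
        + 12 * ((cmod (sign_sum I A a))\<^sup>2 * (cmod (a k))\<^sup>2) + 2 * (cmod (a k)) ^ 4)"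
    unfolding sum_Pow_insert_sign_sum[OF insert(1,2), of "\<lambda>z. (cmod z) ^ 4"]
    by (intro sum_mono 1)
  also have "\<dots> = 2 * (\<Sum>A\<in>Pow I. (cmod (sign_sum I A a)) ^ 4)
      + 12 * ((2 ^ card I * ?s) * (cmod (a k))\<^sup>2) + 2 ^ card I * (2 * (cmod (a k)) ^ 4)"
    using insert sign_sum_second_moment[OF insert(1), of a]
    by (simp add: sum.distrib card_Pow flip: sum_distrib_left sum_distrib_right)
  also have "\<dots> \<le> 2 * (3 * 2 ^ card I * ?s\<^sup>2)
      + 12 * ((2 ^ card I * ?s) * (cmod (a k))\<^sup>2) + 2 ^ card I * (6 * (cmod (a k)) ^ 4)"
    by (intro add_mono mult_left_mono insert mult_nonneg_nonneg sum_nonneg) auto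
  also have "\<dots> = 3 * 2 ^ card (insert k I) * (\<Sum>i\<in>insert k I. (cmod (a i))\<^sup>2)\<^sup>2"
    using insert by (simp add: power2_eq_square power4_eq_xxxx algebra_simps)
  finally show ?case .
qed (simp add: sign_sum_def)

text \<open>The inequality \<open>t\<^sup>2 - t\<^sup>4 / 6 \<le> 6 t\<^sup>p\<close> reduces the p-th moment to the second and fourth ones.\<close>

lemma khintchine:
  assumes "finite I" "1 \<le> p" "p < 2"
  shows "(\<Sum>i\<in>I. (cmod (a i))\<^sup>2) powr (p / 2)
    \<le> 12 / 2 ^ card I * (\<Sum>A\<in>Pow I. cmod (sign_sum I A a) powr p)"
proof (cases "(\<Sum>i\<in>I. (cmod (a i))\<^sup>2) = 0")
  case True
  then show ?thesis by (simp add: sum_nonneg)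
next
  case False
  define \<sigma> where "\<sigma> = sqrt (\<Sum>i\<in>I. (cmod (a i))\<^sup>2)"
  have "(\<Sum>i\<in>I. (cmod (a i))\<^sup>2) > 0" using False by (simp add: sum_nonneg order_less_le)
  then have \<sigma>: "\<sigma> > 0" "\<sigma>\<^sup>2 = (\<Sum>i\<in>I. (cmod (a i))\<^sup>2)" by (auto simp: \<sigma>_def)
  have key: "s\<^sup>2 - s ^ 4 / 6 \<le> 6 * s powr p" if s: "s \<ge> 0" for s :: real
  proof (cases "s = 0 \<or> s\<^sup>2 \<ge> 6")
    case True
    then show ?thesis
    proof
      assume "s\<^sup>2 \<ge> 6"
      then have "s\<^sup>2 * 6 \<le> s\<^sup>2 * s\<^sup>2" by (intro mult_left_mono) auto
      then have "s\<^sup>2 - s ^ 4 / 6 \<le> 0" by (simp add: power2_eq_square power4_eq_xxxx)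
      also have "\<dots> \<le> 6 * s powr p" by simp
      finally show ?thesis .
    qed simp
  next
    case False
    then have "s > 0" "s\<^sup>2 < 6" using s by auto
    have "s\<^sup>2 = s powr 2" using \<open>s > 0\<close> by simp
    also have "\<dots> = s powr p * s powr (2 - p)" by (simp flip: powr_add)
    also have "\<dots> \<le> s powr p * 6"
    proof (intro mult_left_mono)
      show "s powr (2 - p) \<le> 6"
    proof (cases "s \<le> 1")
      case True
      then have "s powr (2 - p) \<le> 1" using \<open>s > 0\<close> assms by (intro powr_le1) auto
      then show ?thesis by simp
    next
      case False
      then have "s powr (2 - p) \<le> s powr 2" using assms by (intro powr_mono) auto
      then show ?thesis using \<open>s\<^sup>2 < 6\<close> \<open>s > 0\<close> by simp
      qed
    qed simp
    finally have "s\<^sup>2 \<le> 6 * s powr p" by simp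
    then show ?thesis using s by (smt (verit) zero_le_power divide_nonneg_pos)
  qed
  define c where "c = (2::real) ^ card I"
  have c: "c > 0" by (simp add: c_def)
  \<comment> \<open>For t = |sign sum| / \<sigma> the second moment averages to 1 and the fourth to
    at most 3, so t^2 - t^4 / 6 averages to at least 1/2. Together with the factor 6 of
    \<open>key\<close> this gives 12.\<close>
  have "c / 2 = (c * \<sigma>\<^sup>2) / \<sigma>\<^sup>2 - (3 * c * (\<sigma>\<^sup>2)\<^sup>2) / \<sigma> ^ 4 / 6"
    using \<sigma>(1) by (simp add: flip: power_mult)
  also have "\<dots> \<le> (\<Sum>A\<in>Pow I. (cmod (sign_sum I A a))\<^sup>2) / \<sigma>\<^sup>2
      - (\<Sum>A\<in>Pow I. (cmod (sign_sum I A a)) ^ 4) / \<sigma> ^ 4 / 6"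
    using sign_sum_second_moment[OF assms(1), of a] sign_sum_fourth_moment[OF assms(1), of a] \<sigma>(1)
    by (intro diff_mono divide_right_mono) (auto simp: c_def \<sigma>(2) sum_nonneg)
  also have "\<dots> = (\<Sum>A\<in>Pow I. (cmod (sign_sum I A a) / \<sigma>)\<^sup>2 - (cmod (sign_sum I A a) / \<sigma>) ^ 4 / 6)"
    by (simp add: sum_subtractf sum_divide_distrib power_divide)
  also have "\<dots> \<le> (\<Sum>A\<in>Pow I. 6 * (cmod (sign_sum I A a) / \<sigma>) powr p)"
    using \<sigma> by (intro sum_mono key) auto
  also have "\<dots> = 6 * (\<Sum>A\<in>Pow I. cmod (sign_sum I A a) powr p) / \<sigma> powr p"
    using \<sigma>(1) by (simp add: powr_divide sum_divide_distrib sum_distrib_left)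
  finally have "\<sigma> powr p \<le> 12 / c * (\<Sum>A\<in>Pow I. cmod (sign_sum I A a) powr p)"
    using \<sigma> c by (simp add: field_simps)
  moreover have "\<sigma> powr p = (\<sigma>\<^sup>2) powr (p / 2)"
    using \<sigma>(1) by (simp add: powr_powr flip: powr_numeral)
  ultimately show ?thesis by (simp add: \<sigma>(2) c_def)
qed

section \<open>Bounded operators on L^2\<close>

text \<open>The squared L^2 norm, valued in \<open>ennreal\<close> so that sums, limits and Tonelli
  need no integrability side conditions and membership in L^2 becomes finiteness.\<close>

definition sqn :: "('a::euclidean_space \<Rightarrow> complex) \<Rightarrow> ennreal" where
  "sqn f = (\<integral>\<^sup>+x. ennreal ((cmod (f x))\<^sup>2) \<partial>lborel)"

lemma Lp_iff:
  "f \<in> Lp p \<longleftrightarrow> f \<in> borel_measurable borel \<and> (\<integral>\<^sup>+x. ennreal (cmod (f x) powr p) \<partial>lborel) < \<infinity>"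
  by (auto simp: Lp_def integrable_iff_bounded)

lemma L2_iff: "f \<in> Lp 2 \<longleftrightarrow> f \<in> borel_measurable borel \<and> sqn f < \<infinity>"
  by (simp add: Lp_iff sqn_def)

lemma L2_measurable[measurable_dest]: "f \<in> Lp p \<Longrightarrow> f \<in> borel_measurable borel"
  by (simp add: Lp_iff)

lemma Lp_norm_powr:
  assumes "f \<in> Lp p" "p > 0"
  shows "ennreal (Lp_norm p f powr p) = (\<integral>\<^sup>+x. ennreal (cmod (f x) powr p) \<partial>lborel)"
proof -
  have "(LINT x|lborel. cmod (f x) powr p) \<ge> 0" by simp
  then have "Lp_norm p f powr p = (LINT x|lborel. cmod (f x) powr p)"
    using assms by (simp add: Lp_norm_def powr_powr)
  then show ?thesis
    using assms by (simp add: Lp_def nn_integral_eq_integral)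
qed

lemma Lp_norm_2: "f \<in> Lp 2 \<Longrightarrow> ennreal ((Lp_norm 2 f)\<^sup>2) = sqn f"
  using Lp_norm_powr[of f 2] by (simp add: sqn_def Lp_norm_def)

lemma Lp_norm_nonneg: "0 \<le> Lp_norm p f"
  by (simp add: Lp_norm_def)

lemma bounded_opers_nn_bound:
  assumes "T \<in> bounded_opers p" "p > 0"
  obtains C where "C > 0"
    "\<And>f. f \<in> Lp p \<Longrightarrow> (\<integral>\<^sup>+x. ennreal (cmod (T f x) powr p) \<partial>lborel)
       \<le> ennreal C * (\<integral>\<^sup>+x. ennreal (cmod (f x) powr p) \<partial>lborel)"
proof -
  obtain C where C: "\<forall>f\<in>Lp p. Lp_norm p (T f) \<le> C * Lp_norm p f"
    and T: "\<forall>f\<in>Lp p. T f \<in> Lp p"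
    using assms by (auto simp: bounded_opers_def)
  \<comment> \<open>The given C may be nonpositive; raising it to at least 1 makes the resulting
    constant positive.\<close>
  define D where "D = max C 1"
  have "(\<integral>\<^sup>+x. ennreal (cmod (T f x) powr p) \<partial>lborel)
       \<le> ennreal (D powr p) * (\<integral>\<^sup>+x. ennreal (cmod (f x) powr p) \<partial>lborel)" if f: "f \<in> Lp p" for f
  proof -
    have "Lp_norm p (T f) \<le> C * Lp_norm p f" using C f by blast
    also have "\<dots> \<le> D * Lp_norm p f" by (intro mult_right_mono) (auto simp: D_def Lp_norm_nonneg)
    finally have "Lp_norm p (T f) powr p \<le> (D * Lp_norm p f) powr p"
      using assms by (intro powr_mono2) (auto simp: Lp_norm_nonneg)
    also have "\<dots> = D powr p * Lp_norm p f powr p"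
      by (simp add: powr_mult D_def Lp_norm_nonneg)
    finally have "ennreal (Lp_norm p (T f) powr p) \<le> ennreal (D powr p) * ennreal (Lp_norm p f powr p)"
      by (simp add: ennreal_leI flip: ennreal_mult)
    then show ?thesis using Lp_norm_powr f T assms by metis
  qed
  moreover have "D powr p > 0" by (simp add: D_def)
  ultimately show thesis using that by blast
qed

lemma bounded_opers_sqn_bound:
  assumes "S \<in> bounded_opers 2"
  obtains C where "C > 0" "\<And>f. f \<in> Lp 2 \<Longrightarrow> sqn (S f) \<le> ennreal C * sqn f"
  using bounded_opers_nn_bound[OF assms] by (auto simp: sqn_def)

lemma sqn_mono_AE:
  assumes "AE x in lborel. cmod (f x) \<le> cmod (g x)"
  shows "sqn f \<le> sqn g"
  unfolding sqn_def using assms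
  by (intro nn_integral_mono_AE) (auto elim!: eventually_mono intro!: ennreal_leI power_mono)

lemma sqn_cong_AE:
  assumes "AE x in lborel. f x = g x"
  shows "sqn f = sqn g"
  unfolding sqn_def using assms by (intro nn_integral_cong_AE) (auto elim!: eventually_mono)

lemma sqn_cmult:
  assumes "f \<in> borel_measurable borel"
  shows "sqn (\<lambda>x. c * f x) = ennreal ((cmod c)\<^sup>2) * sqn f"
  unfolding sqn_def using assms
  by (subst nn_integral_cmult[symmetric]) (auto simp: norm_mult power_mult_distrib ennreal_mult)

lemma sqn_mult_le:
  assumes "\<And>x. cmod (u x) \<le> c" "f \<in> borel_measurable borel"
  shows "sqn (\<lambda>x. u x * f x) \<le> ennreal (c\<^sup>2) * sqn f"
proof -
  have "0 \<le> c" using assms(1) norm_ge_zero order_trans by blast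
  then have "sqn (\<lambda>x. u x * f x) \<le> sqn (\<lambda>x. of_real c * f x)"
    using assms by (intro sqn_mono_AE always_eventually) (auto simp: norm_mult intro: mult_right_mono)
  then show ?thesis using assms \<open>0 \<le> c\<close> by (simp add: sqn_cmult)
qed

lemma sqn_mult_le1:
  assumes "\<And>x. cmod (u x) \<le> 1"
  shows "sqn (\<lambda>x. u x * f x) \<le> sqn f"
  using assms by (intro sqn_mono_AE always_eventually) (auto simp: norm_mult mult_left_le_one_le)

lemma cmod_add_sq_le: "(cmod (z + w))\<^sup>2 \<le> 2 * (cmod z)\<^sup>2 + 2 * (cmod w)\<^sup>2"
proof -
  have "(cmod (z + w))\<^sup>2 \<le> (cmod z + cmod w)\<^sup>2"
    by (intro power_mono norm_triangle_ineq) auto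
  also have "\<dots> \<le> 2 * (cmod z)\<^sup>2 + 2 * (cmod w)\<^sup>2"
    using sum_squares_ge_zero[of "cmod z - cmod w" 0] by (simp add: power2_eq_square algebra_simps)
  finally show ?thesis .
qed

text \<open>The crude factor 2 stands in for the triangle inequality and keeps all later estimates
  linear in \<open>sqn\<close>.\<close>

lemma sqn_add_le:
  assumes [measurable]: "f \<in> borel_measurable borel" "g \<in> borel_measurable borel"
  shows "sqn (\<lambda>x. f x + g x) \<le> 2 * sqn f + 2 * sqn g"
proof -
  have "sqn (\<lambda>x. f x + g x) \<le> (\<integral>\<^sup>+x. 2 * ennreal ((cmod (f x))\<^sup>2) + 2 * ennreal ((cmod (g x))\<^sup>2) \<partial>lborel)"
    unfolding sqn_def
    by (intro nn_integral_mono)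
      (simp add: cmod_add_sq_le ennreal_leI flip: ennreal_numeral ennreal_mult ennreal_plus)
  also have "\<dots> = 2 * sqn f + 2 * sqn g"
    unfolding sqn_def by (subst nn_integral_add) (auto simp: nn_integral_cmult)
  finally show ?thesis .
qed

lemma L2_mult:
  assumes "f \<in> Lp 2" "u \<in> borel_measurable borel" "\<And>x. cmod (u x) \<le> c"
  shows "(\<lambda>x. u x * f x) \<in> Lp 2"
  using assms sqn_mult_le[of u c f]
  by (force simp: L2_iff ennreal_mult_less_top intro: le_less_trans)

lemma L2_cmult: "f \<in> Lp 2 \<Longrightarrow> (\<lambda>x. c * f x) \<in> Lp 2"
  by (rule L2_mult[where c = "cmod c"]) auto

lemma L2_indicator:
  assumes "f \<in> Lp 2" "A \<in> sets borel"
  shows "(\<lambda>x. indicator A x * f x) \<in> Lp 2"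
  using assms by (intro L2_mult[where c = 1]) (auto simp: indicator_def)

lemma L2_add: "f \<in> Lp 2 \<Longrightarrow> g \<in> Lp 2 \<Longrightarrow> (\<lambda>x. f x + g x) \<in> Lp 2"
  using sqn_add_le[of f g]
  by (auto simp: L2_iff ennreal_mult_less_top intro: le_less_trans)

lemma L2_zero: "(\<lambda>x. 0) \<in> Lp 2"
  by (simp add: L2_iff sqn_def)

lemma L2_sum:
  assumes "\<And>i. i \<in> I \<Longrightarrow> f i \<in> Lp 2"
  shows "(\<lambda>x. \<Sum>i\<in>I. f i x) \<in> Lp 2"
  using assms by (induction I rule: infinite_finite_induct) (auto intro: L2_add L2_zero)

lemma bounded_opers_zero:
  assumes "S \<in> bounded_opers 2"
  shows "AE x in lborel. S (\<lambda>y. 0) x = 0"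
proof -
  have "\<forall>f\<in>Lp 2. \<forall>c. AE x in lborel. S (\<lambda>y. c * f y) x = c * S f x"
    using assms by (simp add: bounded_opers_def)
  from this[rule_format, OF L2_zero, of 0] show ?thesis by simp
qed

lemma bounded_opers_add:
  assumes "S \<in> bounded_opers 2" "f \<in> Lp 2" "g \<in> Lp 2"
  shows "AE x in lborel. S (\<lambda>y. f y + g y) x = S f x + S g x"
  using assms by (simp add: bounded_opers_def)

lemma bounded_opers_cmult:
  assumes "S \<in> bounded_opers 2" "f \<in> Lp 2"
  shows "AE x in lborel. S (\<lambda>y. c * f y) x = c * S f x"
  using assms by (simp add: bounded_opers_def)

lemma bounded_opers_Lp: "S \<in> bounded_opers p \<Longrightarrow> f \<in> Lp p \<Longrightarrow> S f \<in> Lp p"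
  by (simp add: bounded_opers_def)

lemma bounded_opers_measurable:
  "S \<in> bounded_opers p \<Longrightarrow> f \<in> Lp p \<Longrightarrow> S f \<in> borel_measurable borel"
  by (simp add: bounded_opers_def Lp_iff)

lemma bounded_opers_cong:
  assumes "S \<in> bounded_opers 2" "f \<in> Lp 2" "g \<in> Lp 2" "AE x in lborel. f x = g x"
  shows "AE x in lborel. S f x = S g x"
  using assms by (simp add: bounded_opers_def)

lemma bounded_opers_sum:
  assumes S: "S \<in> bounded_opers 2" and "finite I" "\<And>i. i \<in> I \<Longrightarrow> f i \<in> Lp 2"
  shows "AE x in lborel. S (\<lambda>y. \<Sum>i\<in>I. c i * f i y) x = (\<Sum>i\<in>I. c i * S (f i) x)"
  using assms(2,3)
proof (induction I)
  case empty
  then show ?case using bounded_opers_zero[OF S] by simp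
next
  case (insert k I)
  have "AE x in lborel. S (\<lambda>y. c k * f k y + (\<Sum>i\<in>I. c i * f i y)) x
      = S (\<lambda>y. c k * f k y) x + S (\<lambda>y. \<Sum>i\<in>I. c i * f i y) x"
    using insert by (intro bounded_opers_add[OF S] L2_cmult L2_sum) auto
  moreover have "AE x in lborel. S (\<lambda>y. c k * f k y) x = c k * S (f k) x"
    using insert by (intro bounded_opers_cmult[OF S]) auto
  moreover have "AE x in lborel. S (\<lambda>y. \<Sum>i\<in>I. c i * f i y) x = (\<Sum>i\<in>I. c i * S (f i) x)"
    using insert by auto
  ultimately show ?case
    by eventually_elim (use insert(1,2) in simp)
qed

lemma bounded_opers_diff:
  assumes S: "S \<in> bounded_opers 2" and "f \<in> Lp 2" "g \<in> Lp 2"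
  shows "AE x in lborel. S (\<lambda>y. f y - g y) x = S f x - S g x"
proof -
  have "AE x in lborel. S (\<lambda>y. f y + (- 1) * g y) x = S f x + S (\<lambda>y. (- 1) * g y) x"
    using assms by (intro bounded_opers_add[OF S] L2_cmult)
  moreover have "AE x in lborel. S (\<lambda>y. (- 1) * g y) x = (- 1) * S g x"
    using assms by (intro bounded_opers_cmult[OF S])
  ultimately show ?thesis by eventually_elim simp
qed

section \<open>Compressions to sets of finite measure\<close>

text \<open>On the intersection of both spaces S agrees a.e. with the bounded operator on L^p, so
  that operator's bound carries over to S there.\<close>

lemma induces_bounded_nn_bound:
  assumes "induces_bounded p S" "p > 0"
  obtains C where "C > 0"
    "\<And>f. f \<in> Lp 2 \<Longrightarrow> f \<in> Lp p \<Longrightarrow> (\<integral>\<^sup>+x. ennreal (cmod (S f x) powr p) \<partial>lborel)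
       \<le> ennreal C * (\<integral>\<^sup>+x. ennreal (cmod (f x) powr p) \<partial>lborel)"
proof -
  obtain T where T: "T \<in> bounded_opers p" and TS: "\<forall>f\<in>Lp 2 \<inter> Lp p. AE x in lborel. T f x = S f x"
    using assms by (auto simp: induces_bounded_def)
  obtain C where C: "C > 0"
    "\<And>f. f \<in> Lp p \<Longrightarrow> (\<integral>\<^sup>+x. ennreal (cmod (T f x) powr p) \<partial>lborel)
       \<le> ennreal C * (\<integral>\<^sup>+x. ennreal (cmod (f x) powr p) \<partial>lborel)"
    using bounded_opers_nn_bound[OF T assms(2)] by blast
  have "(\<integral>\<^sup>+x. ennreal (cmod (S f x) powr p) \<partial>lborel)
      = (\<integral>\<^sup>+x. ennreal (cmod (T f x) powr p) \<partial>lborel)" if "f \<in> Lp 2" "f \<in> Lp p" for f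
  proof -
    have "AE x in lborel. T f x = S f x" using TS that by blast
    then show ?thesis by (intro nn_integral_cong_AE) (auto elim!: eventually_mono)
  qed
  then show thesis using that C by simp
qed

text \<open>Rescaled by \<open>\<mu>\<^sup>1\<^sup>/\<^sup>2\<close>, where \<open>\<mu>\<close> is the measure of \<open>D\<close>, the inequality \<open>t\<^sup>p \<le> 1 + t\<^sup>2\<close> does
  the job of Hoelder's inequality on \<open>D\<close>.\<close>

lemma Lp_norm_on_finite_set:
  fixes f :: "'a::euclidean_space \<Rightarrow> complex"
  assumes "f \<in> Lp 2" "D \<in> sets borel" "emeasure lborel D = ennreal \<mu>" "\<mu> > 0" "0 < p" "p < 2"
  shows "(\<integral>\<^sup>+x. ennreal (cmod (indicator D x * f x) powr p) \<partial>lborel) \<le> ennreal (\<mu> powr (1 - p / 2)) * (1 + sqn f)"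
    and "(\<lambda>x. indicator D x * f x) \<in> Lp p"
proof -
  note [measurable] = L2_measurable[OF assms(1)] assms(2)
  \<comment> \<open>The level that balances both terms: \<tau>^p \<mu> and \<tau>^(p - 2) both equal
    \<mu>^(1 - p/2).\<close>
  define \<tau> where "\<tau> = \<mu> powr (- 1 / 2)"
  have \<tau>: "\<tau> > 0" using assms by (simp add: \<tau>_def)
  have 1: "t powr p \<le> \<tau> powr p + \<tau> powr (p - 2) * t\<^sup>2" if "t \<ge> 0" for t
  proof (cases "t \<le> \<tau>")
    case True
    then have "t powr p \<le> \<tau> powr p" using that assms by (intro powr_mono2) auto
    then show ?thesis by (simp add: add_increasing2)
  next
    case False
    then have "t powr p = t powr (p - 2) * t\<^sup>2"
      using \<tau> by (simp flip: powr_numeral powr_add)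
    also have "\<dots> \<le> \<tau> powr (p - 2) * t\<^sup>2"
      using False \<tau> assms by (intro mult_right_mono powr_mono2') auto
    finally show ?thesis by (smt (verit) powr_ge_zero)
  qed
  have "(\<integral>\<^sup>+x. ennreal (cmod (indicator D x * f x) powr p) \<partial>lborel)
     \<le> (\<integral>\<^sup>+x. ennreal (\<tau> powr p) * indicator D x
          + ennreal (\<tau> powr (p - 2)) * ennreal ((cmod (f x))\<^sup>2) \<partial>lborel)"
    using 1 assms by (intro nn_integral_mono)
      (auto simp: indicator_def ennreal_leI simp flip: ennreal_mult ennreal_plus)
  also have "\<dots> = ennreal (\<tau> powr p) * ennreal \<mu> + ennreal (\<tau> powr (p - 2)) * sqn f"
    unfolding sqn_def using assms by (subst nn_integral_add) (auto simp: nn_integral_cmult)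
  also have "\<dots> = ennreal (\<mu> powr (1 - p / 2)) * (1 + sqn f)"
  proof -
    have "\<tau> powr p * \<mu> = \<mu> powr (1 - p / 2)"
      using assms powr_add[of \<mu> "- (p / 2)" 1] by (simp add: \<tau>_def powr_powr)
    moreover have "\<tau> powr (p - 2) = \<mu> powr (1 - p / 2)"
      by (simp add: \<tau>_def powr_powr diff_divide_distrib)
    ultimately show ?thesis using assms by (simp add: algebra_simps flip: ennreal_mult)
  qed
  finally show "(\<integral>\<^sup>+x. ennreal (cmod (indicator D x * f x) powr p) \<partial>lborel)
      \<le> ennreal (\<mu> powr (1 - p / 2)) * (1 + sqn f)" .
  also have "\<dots> < \<infinity>" using assms by (auto simp: L2_iff ennreal_mult_less_top)
  finally show "(\<lambda>x. indicator D x * f x) \<in> Lp p" by (simp add: Lp_iff)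
qed

lemma sum_lessThan_add: "(\<Sum>i<m + n. h i) = (\<Sum>i<m. h i) + (\<Sum>i<n. h (m + i))"
  for h :: "nat \<Rightarrow> 'b::comm_monoid_add" and m n :: nat
  by (induction n) (auto simp: add.assoc)

text \<open>The type 2 inequality for Hilbert space, in the truncated form fed to
  \<open>convex_set_small_exceptional_set\<close>.\<close>

lemma truncated_square_function_bound:
  fixes S :: "'a::euclidean_space oper" and f :: "nat \<Rightarrow> 'a \<Rightarrow> complex"
  assumes S: "S \<in> bounded_opers 2" and p: "1 \<le> p" "p < 2"
    and Cp: "Cp > 0" "\<And>f. f \<in> Lp 2 \<Longrightarrow> f \<in> Lp p \<Longrightarrow> (\<integral>\<^sup>+x. ennreal (cmod (S f x) powr p) \<partial>lborel)
       \<le> ennreal Cp * (\<integral>\<^sup>+x. ennreal (cmod (f x) powr p) \<partial>lborel)"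
    and D: "D \<in> sets borel" "emeasure lborel D = ennreal \<mu>" "\<mu> > 0"
    and f: "\<And>i. i < n \<Longrightarrow> f i \<in> Lp 2" "(\<Sum>i<n. sqn (f i)) \<le> 1"
    and \<rho>: "\<rho> > 0"
  shows "(\<integral>\<^sup>+x. ennreal (1 - exp (- ((\<Sum>i<n. (cmod (S (\<lambda>y. indicator D y * f i y) x))\<^sup>2) / \<rho>))) \<partial>lborel)
    \<le> ennreal (24 * Cp * \<mu> powr (1 - p / 2) * \<rho> powr (- p / 2))"
proof -
  \<comment> \<open>Random sign combinations of the \<open>f i\<close>. By linearity S maps them,
    cut to D, to sign sums of the \<open>h i\<close>, off a null set that depends on A.\<close>
  define F where "F A y = sign_sum {..<n} A (\<lambda>i. f i y)" for A y
  define h where "h i = S (\<lambda>y. indicator D y * f i y)" for i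
  have Df: "(\<lambda>y. indicator D y * f i y) \<in> Lp 2" if "i < n" for i
    using f(1)[OF that] D(1) by (rule L2_indicator)
  have hL2: "h i \<in> Lp 2" if "i < n" for i
    unfolding h_def by (intro bounded_opers_Lp[OF S] Df that)
  have F_L2: "F A \<in> Lp 2" for A
    unfolding F_def sign_sum_def by (intro L2_sum L2_cmult f) auto
  have SF: "AE x in lborel. S (\<lambda>y. indicator D y * F A y) x = sign_sum {..<n} A (\<lambda>i. h i x)" for A
  proof -
    have "AE x in lborel. S (\<lambda>y. \<Sum>i<n. (if i \<in> A then 1 else -1) * (indicator D y * f i y)) x
        = (\<Sum>i<n. (if i \<in> A then 1 else -1) * S (\<lambda>y. indicator D y * f i y) x)"
      by (intro bounded_opers_sum[OF S] Df) auto
    moreover have "(\<lambda>y. \<Sum>i<n. (if i \<in> A then 1 else -1) * (indicator D y * f i y)) = (\<lambda>y. indicator D y * F A y)"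
      by (auto simp: F_def sign_sum_def sum_distrib_left mult_ac intro!: sum.cong)
    ultimately show ?thesis by (simp add: sign_sum_def h_def)
  qed
  define \<alpha> where "\<alpha> = Cp * \<mu> powr (1 - p / 2)"
  have \<alpha>: "\<alpha> > 0" using Cp D by (simp add: \<alpha>_def)
  have SFb: "(\<integral>\<^sup>+x. ennreal (cmod (sign_sum {..<n} A (\<lambda>i. h i x)) powr p) \<partial>lborel)
      \<le> ennreal \<alpha> * (1 + sqn (F A))" for A
  proof -
    have "(\<integral>\<^sup>+x. ennreal (cmod (sign_sum {..<n} A (\<lambda>i. h i x)) powr p) \<partial>lborel)
       = (\<integral>\<^sup>+x. ennreal (cmod (S (\<lambda>y. indicator D y * F A y) x) powr p) \<partial>lborel)"
      using SF[of A] by (intro nn_integral_cong_AE) (auto elim!: eventually_mono)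
    also have "\<dots> \<le> ennreal Cp * (\<integral>\<^sup>+x. ennreal (cmod (indicator D x * F A x) powr p) \<partial>lborel)"
      using D p by (intro Cp L2_indicator F_L2 Lp_norm_on_finite_set(2)) auto
    also have "\<dots> \<le> ennreal Cp * (ennreal (\<mu> powr (1 - p / 2)) * (1 + sqn (F A)))"
      using D p by (intro mult_left_mono Lp_norm_on_finite_set F_L2) auto
    finally show ?thesis using Cp by (simp add: \<alpha>_def ennreal_mult mult.assoc)
  qed
  \<comment> \<open>The second moment is an identity, so the squared norm of \<open>F A\<close>,
    averaged over signs, is the sum of the \<open>sqn (f i)\<close>, whatever the number n of
    functions.\<close>
  have sumF: "(\<Sum>A\<in>Pow {..<n}. sqn (F A)) = ennreal (2 ^ n) * (\<Sum>i<n. sqn (f i))"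
  proof -
    have "(\<Sum>A\<in>Pow {..<n}. sqn (F A))
        = (\<integral>\<^sup>+x. (\<Sum>A\<in>Pow {..<n}. ennreal ((cmod (F A x))\<^sup>2)) \<partial>lborel)"
      unfolding sqn_def using L2_measurable[OF F_L2] by (intro nn_integral_sum[symmetric]) auto
    also have "\<dots> = (\<integral>\<^sup>+x. ennreal (2 ^ n) * (\<Sum>i<n. ennreal ((cmod (f i x))\<^sup>2)) \<partial>lborel)"
      unfolding F_def using sign_sum_second_moment[of "{..<n}"]
      by (intro nn_integral_cong) (simp add: sum_nonneg flip: ennreal_mult)
    also have "\<dots> = ennreal (2 ^ n) * (\<Sum>i<n. sqn (f i))"
      unfolding sqn_def using L2_measurable[OF f(1)]
      by (subst nn_integral_cmult, measurable) (subst nn_integral_sum, auto)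
    finally show ?thesis .
  qed
  define \<beta> where "\<beta> = \<rho> powr (- p / 2) * (12 / 2 ^ n)"
  have \<beta>: "\<beta> > 0" using \<rho> by (simp add: \<beta>_def)
  \<comment> \<open>1 - exp(-s) is at most min s 1, hence at most s^(p/2) since p/2 \<le> 1;
    Khintchine then trades the square function for p-th powers of sign sums.\<close>
  have ptw: "1 - exp (- ((\<Sum>i<n. (cmod (h i x))\<^sup>2) / \<rho>))
      \<le> \<beta> * (\<Sum>A\<in>Pow {..<n}. cmod (sign_sum {..<n} A (\<lambda>i. h i x)) powr p)" for x
  proof -
    define q where "q = (\<Sum>i<n. (cmod (h i x))\<^sup>2)"
    have q: "q \<ge> 0" by (simp add: q_def sum_nonneg)
    have "1 - exp (- (q / \<rho>)) \<le> (q / \<rho>) powr (p / 2)"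
    proof (cases "q / \<rho> \<le> 1")
      case True
      have "1 - exp (- (q / \<rho>)) \<le> q / \<rho>" using exp_ge_add_one_self[of "- (q / \<rho>)"] by linarith
      also have "\<dots> = (q / \<rho>) powr 1" using q \<rho> by simp
      also have "\<dots> \<le> (q / \<rho>) powr (p / 2)" using True q \<rho> p by (intro powr_mono') auto
      finally show ?thesis .
    next
      case False
      then have "1 \<le> (q / \<rho>) powr (p / 2)" using p by (intro ge_one_powr_ge_zero) auto
      then show ?thesis by (smt (verit) exp_gt_zero)
    qed
    also have "\<dots> = \<rho> powr (- p / 2) * q powr (p / 2)"
      using q \<rho> by (simp add: powr_divide powr_minus_divide)
    also have "\<dots> \<le> \<rho> powr (- p / 2) * (12 / 2 ^ n * (\<Sum>A\<in>Pow {..<n}. cmod (sign_sum {..<n} A (\<lambda>i. h i x)) powr p))"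
      using khintchine[of "{..<n}" p "\<lambda>i. h i x"] p by (intro mult_left_mono) (auto simp: q_def)
    finally show ?thesis by (simp add: q_def \<beta>_def mult.assoc)
  qed
  note [measurable] = L2_measurable[OF hL2]
  have "(\<integral>\<^sup>+x. ennreal (1 - exp (- ((\<Sum>i<n. (cmod (h i x))\<^sup>2) / \<rho>))) \<partial>lborel)
    \<le> (\<integral>\<^sup>+x. ennreal \<beta> * (\<Sum>A\<in>Pow {..<n}. ennreal (cmod (sign_sum {..<n} A (\<lambda>i. h i x)) powr p)) \<partial>lborel)"
    using ptw \<beta> by (intro nn_integral_mono) (simp add: ennreal_leI sum_nonneg flip: ennreal_mult)
  also have "\<dots> = ennreal \<beta> * (\<Sum>A\<in>Pow {..<n}. \<integral>\<^sup>+x. ennreal (cmod (sign_sum {..<n} A (\<lambda>i. h i x)) powr p) \<partial>lborel)"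
    unfolding sign_sum_def by (subst nn_integral_cmult) (auto simp: nn_integral_sum simp del: sum_ennreal)
  also have "\<dots> \<le> ennreal \<beta> * (\<Sum>A\<in>Pow {..<n}. ennreal \<alpha> * (1 + sqn (F A)))"
    by (intro mult_left_mono sum_mono SFb) auto
  also have "\<dots> = ennreal \<beta> * (ennreal \<alpha> * (ennreal (2 ^ n) * (1 + (\<Sum>i<n. sqn (f i)))))"
    by (simp add: sum.distrib card_Pow sumF algebra_simps flip: sum_distrib_left ennreal_power)
  also have "\<dots> \<le> ennreal \<beta> * (ennreal \<alpha> * (ennreal (2 ^ n) * (1 + 1)))"
    by (intro mult_left_mono add_left_mono f) auto
  also have "\<dots> = ennreal (\<beta> * (\<alpha> * (2 ^ n * 2)))"
    using \<alpha> \<beta> by (simp add: ennreal_mult flip: ennreal_power)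
  also have "\<beta> * (\<alpha> * (2 ^ n * 2)) = 24 * Cp * \<mu> powr (1 - p / 2) * \<rho> powr (- p / 2)"
    by (simp add: \<alpha>_def \<beta>_def)
  finally show ?thesis by (simp add: h_def)
qed

text \<open>The convex set lemma is applied on C to square functions divided by a level \<rho>
  proportional to 1 / |D|. Then b is proportional to |D| while b \<rho> is independent of D, so one
  \<kappa> serves all C and D. The set C supplies the finite measure space and does not enter the
  constants.\<close>

lemma local_exceptional_set:
  fixes S :: "'a::euclidean_space oper"
  assumes S: "S \<in> bounded_opers 2" and ind: "induces_bounded p S" and p: "1 \<le> p" "p < 2"
    and \<epsilon>: "\<epsilon> > 0"
  obtains \<kappa> where "\<kappa> > 0"
    "\<And>C D. \<lbrakk>C \<in> sets borel; emeasure lborel C < \<infinity>; D \<in> sets borel; emeasure lborel D < \<infinity>\<rbrakk> \<Longrightarrow>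
      \<exists>G\<in>sets borel. G \<subseteq> C \<and> emeasure lborel G \<le> ennreal \<kappa> * emeasure lborel D \<and>
        (\<forall>f\<in>Lp 2. sqn (\<lambda>x. indicator (C - G) x * S (\<lambda>y. indicator D y * f y) x) \<le> ennreal \<epsilon> * sqn f)"
proof -
  obtain Cp where Cp: "Cp > 0"
    "\<And>f. f \<in> Lp 2 \<Longrightarrow> f \<in> Lp p \<Longrightarrow> (\<integral>\<^sup>+x. ennreal (cmod (S f x) powr p) \<partial>lborel)
       \<le> ennreal Cp * (\<integral>\<^sup>+x. ennreal (cmod (f x) powr p) \<partial>lborel)"
    using induces_bounded_nn_bound[OF ind] p by auto
  obtain C2 where C2: "C2 > 0" "\<And>f. f \<in> Lp 2 \<Longrightarrow> sqn (S f) \<le> ennreal C2 * sqn f"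
    using bounded_opers_sqn_bound[OF S] by blast
  \<comment> \<open>Solves 2 b \<rho> = \<epsilon>, that is 48 Cp m^(p/2 - 1) = \<epsilon>. Here p <
    2 is decisive: at p = 2 the exponent vanishes and \<epsilon> could not be prescribed.\<close>
  define m where "m = (\<epsilon> / (48 * Cp)) powr (1 / (p / 2 - 1))"
  have m: "m > 0" "48 * Cp * m powr (p / 2 - 1) = \<epsilon>"
    using \<epsilon> Cp p by (auto simp: m_def powr_powr)
  define \<kappa> where "\<kappa> = 48 * Cp * m powr (p / 2)"
  have \<kappa>: "\<kappa> > 0" using Cp m by (simp add: \<kappa>_def)
  have "\<exists>G\<in>sets borel. G \<subseteq> C \<and> emeasure lborel G \<le> ennreal \<kappa> * emeasure lborel D \<and>
        (\<forall>f\<in>Lp 2. sqn (\<lambda>x. indicator (C - G) x * S (\<lambda>y. indicator D y * f y) x) \<le> ennreal \<epsilon> * sqn f)"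
    if C: "C \<in> sets borel" "emeasure lborel C < \<infinity>"
      and D: "D \<in> sets borel" "emeasure lborel D < \<infinity>" for C D
  proof -
    define \<mu> where "\<mu> = measure lborel D"
    have \<mu>: "emeasure lborel D = ennreal \<mu>" "\<mu> \<ge> 0"
      using D by (auto simp: \<mu>_def emeasure_eq_ennreal_measure)
    have DL2: "(\<lambda>y. indicator D y * f y) \<in> Lp 2" if "f \<in> Lp 2" for f
      using that D(1) by (rule L2_indicator)
    have zero: "sqn (\<lambda>x. indicator A x * S (\<lambda>y. indicator D y * f y) x) = 0"
      if "f \<in> Lp 2" "sqn (\<lambda>y. indicator D y * f y) = 0" for f A
    proof -
      have "sqn (\<lambda>x. indicator A x * S (\<lambda>y. indicator D y * f y) x) \<le> sqn (S (\<lambda>y. indicator D y * f y))"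
        by (intro sqn_mult_le1) (simp add: indicator_def)
      also have "\<dots> \<le> 0" using C2(2)[OF DL2[OF that(1)]] that(2) by simp
      finally show ?thesis by simp
    qed
    show ?thesis
    proof (cases "\<mu> = 0")
      case True
      have "AE x in lborel. x \<notin> D"
        using D(1) \<mu>(1) True by (intro AE_not_in) (simp add: null_sets_def)
      then have "sqn (\<lambda>y. indicator D y * f y) = sqn (\<lambda>y :: 'a. 0)" for f
        by (intro sqn_cong_AE) (auto elim!: eventually_mono)
      then have "sqn (\<lambda>y. indicator D y * f y) = 0" for f
        by (simp add: sqn_def)
      then show ?thesis using zero by (intro bexI[of _ "{}"]) auto
    next
      case False
      then have \<mu>0: "\<mu> > 0" using \<mu> by simp
      define \<rho> where "\<rho> = 1 / (m * \<mu>)"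
      have \<rho>: "\<rho> > 0" using m \<mu>0 by (simp add: \<rho>_def)
      define b where "b = 24 * Cp * \<mu> powr (1 - p / 2) * \<rho> powr (- p / 2)"
      have b_eq: "b = 24 * Cp * m powr (p / 2) * \<mu>"
      proof -
        have "\<rho> powr (- p / 2) = m powr (p / 2) * \<mu> powr (p / 2)"
          using m \<mu>0 by (simp add: \<rho>_def powr_minus_divide powr_divide powr_mult)
        moreover have "\<mu> powr (1 - p / 2) * \<mu> powr (p / 2) = \<mu>"
          using \<mu>0 by (simp flip: powr_add)
        ultimately show ?thesis by (simp add: b_def algebra_simps)
      qed
      have b: "b > 0" using Cp m \<mu>0 by (simp add: b_eq)
      have b\<rho>: "2 * b * \<rho> = \<epsilon>"
      proof -
        have "m powr (p / 2) = m powr (p / 2 - 1) * m"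
          using m by (simp add: powr_diff)
        then show ?thesis using m \<mu>0 by (simp add: b_eq \<rho>_def flip: m(2))
      qed
      define sq where "sq n f x = (\<Sum>i<n. (cmod (S (\<lambda>y. indicator D y * f i y) x))\<^sup>2)" for n :: nat and f x
      \<comment> \<open>S is linear only up to null sets, so square functions form a convex family
        only a.e. Admitting every nonnegative Borel function that agrees a.e. with a scaled square
        function makes K convex.\<close>
      define K where "K = {g \<in> borel_measurable borel. (\<forall>x. 0 \<le> g x) \<and> (\<exists>n f. (\<forall>i<n. f i \<in> Lp 2)
        \<and> (\<Sum>i<n. sqn (f i)) \<le> 1 \<and> (AE x in lborel. g x = sq n f x / \<rho>))}"
      define M where "M = restrict_space lborel C"
      interpret M: finite_measure M
        using C by (intro finite_measureI) (auto simp: M_def emeasure_restrict_space space_restrict_space)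
      have Kmeas[measurable_dest]: "g \<in> borel_measurable borel" if "g \<in> K" for g using that by (simp add: K_def)
      obtain G where G: "G \<in> sets M" "measure M G \<le> 2 * b"
        "\<And>g. g \<in> K \<Longrightarrow> (\<integral>\<^sup>+x. ennreal (g x) * indicator (space M - G) x \<partial>M) \<le> ennreal (2 * b)"
      proof (rule convex_set_small_exceptional_set[of M K b])
        show "finite_measure M" by unfold_locales
        have "(\<lambda>x. 0) \<in> K" by (auto simp: K_def sq_def intro!: exI[of _ "0::nat"])
        then show "K \<noteq> {}" by blast
        show "g \<in> borel_measurable M" if "g \<in> K" for g
          using Kmeas[OF that] unfolding M_def by (intro measurable_restrict_space1) simp
        show "0 \<le> g x" if "g \<in> K" for g x using that by (simp add: K_def)
        show "(\<lambda>x. (1 - t) * g x + t * h x) \<in> K" if g: "g \<in> K" and h: "h \<in> K" and t: "0 < t" "t < 1" for g h t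
        proof -
          obtain n f where f: "\<forall>i<n. f i \<in> Lp 2" "(\<Sum>i<n. sqn (f i)) \<le> 1" "AE x in lborel. g x = sq n f x / \<rho>"
            using g by (auto simp: K_def)
          obtain n' f' where f': "\<forall>i<n'. f' i \<in> Lp 2" "(\<Sum>i<n'. sqn (f' i)) \<le> 1" "AE x in lborel. h x = sq n' f' x / \<rho>"
            using h by (auto simp: K_def)
          \<comment> \<open>The two families are concatenated with factors sqrt (1 - t) and sqrt t;
            squaring restores the weights 1 - t and t, both in the square function and in the norm
            constraint.\<close>
          define F where "F i = (if i < n then (\<lambda>x. complex_of_real (sqrt (1 - t)) * f i x)
             else (\<lambda>x. complex_of_real (sqrt t) * f' (i - n) x))" for i
          have F_L2: "\<forall>i<n + n'. F i \<in> Lp 2" using f f' by (auto simp: F_def intro!: L2_cmult)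
          have scale: "sqn (\<lambda>x. complex_of_real (sqrt s) * k x) = ennreal s * sqn k" if "s > 0" "k \<in> Lp 2"
            for s k using that by (simp add: sqn_cmult L2_measurable)
          have "(\<Sum>i<n + n'. sqn (F i)) = ennreal (1 - t) * (\<Sum>i<n. sqn (f i)) + ennreal t * (\<Sum>i<n'. sqn (f' i))"
            using f f' t unfolding sum_lessThan_add by (simp add: F_def scale sum_distrib_left)
          also have "\<dots> \<le> ennreal (1 - t) * 1 + ennreal t * 1"
            using f f' by (intro add_mono mult_left_mono) auto
          also have "\<dots> = 1" using t by (simp flip: ennreal_plus)
          finally have 1: "(\<Sum>i<n + n'. sqn (F i)) \<le> 1" .
          have 2: "AE x in lborel. (cmod (S (\<lambda>y. indicator D y * (complex_of_real (sqrt s) * k y)) x))\<^sup>2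
              = s * (cmod (S (\<lambda>y. indicator D y * k y) x))\<^sup>2" if "s > 0" "k \<in> Lp 2" for s k
            using bounded_opers_cmult[OF S DL2[OF that(2)], of "complex_of_real (sqrt s)"]
            by eventually_elim (use that in \<open>simp add: mult_ac norm_mult power_mult_distrib\<close>)
          have "AE x in lborel. \<forall>i\<in>{..<n}. (cmod (S (\<lambda>y. indicator D y * F i y) x))\<^sup>2
              = (1 - t) * (cmod (S (\<lambda>y. indicator D y * f i y) x))\<^sup>2"
            using f t 2 by (intro AE_finite_allI) (auto simp: F_def)
          moreover have "AE x in lborel. \<forall>i\<in>{..<n'}. (cmod (S (\<lambda>y. indicator D y * F (n + i) y) x))\<^sup>2
              = t * (cmod (S (\<lambda>y. indicator D y * f' i y) x))\<^sup>2"
            using f' t 2 by (intro AE_finite_allI) (auto simp: F_def)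
          ultimately have 3: "AE x in lborel. (1 - t) * g x + t * h x = sq (n + n') F x / \<rho>"
            using f(3) f'(3)
          proof eventually_elim
            case (elim x)
            have "sq (n + n') F x = (1 - t) * sq n f x + t * sq n' f' x"
              unfolding sq_def sum_lessThan_add using elim by (simp add: sum_distrib_left)
            then show ?case using elim by (simp add: add_divide_distrib)
          qed
          from g h t have "(\<lambda>x. (1 - t) * g x + t * h x) \<in> borel_measurable borel"
            "\<forall>x. 0 \<le> (1 - t) * g x + t * h x"
            using Kmeas[OF g] Kmeas[OF h] by (auto simp: K_def)
          then show ?thesis unfolding K_def using F_L2 1 3 by blast
        qed
        show "(LINT x|M. 1 - exp (- g x)) \<le> b" if g: "g \<in> K" for g
        proof -
          obtain n f where f: "\<forall>i<n. f i \<in> Lp 2" "(\<Sum>i<n. sqn (f i)) \<le> 1" "AE x in lborel. g x = sq n f x / \<rho>"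
            using g by (auto simp: K_def)
          have g0: "0 \<le> g x" for x using g by (simp add: K_def)
          note [measurable] = Kmeas[OF g]
          have gM: "g \<in> borel_measurable M"
            unfolding M_def by (intro measurable_restrict_space1) simp
          have "integrable M (\<lambda>x. 1 - exp (- g x))"
            using gM g0 by (intro M.integrable_const_bound[where B = 1]) auto
          then have "ennreal (LINT x|M. 1 - exp (- g x)) = (\<integral>\<^sup>+x. ennreal (1 - exp (- g x)) \<partial>M)"
            using g0 by (intro nn_integral_eq_integral[symmetric]) auto
          also have "\<dots> = (\<integral>\<^sup>+x. ennreal (1 - exp (- g x)) * indicator C x \<partial>lborel)"
            unfolding M_def using C by (intro nn_integral_restrict_space) auto
          also have "\<dots> \<le> (\<integral>\<^sup>+x. ennreal (1 - exp (- (sq n f x / \<rho>))) \<partial>lborel)"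
            using f(3) by (intro nn_integral_mono_AE) (auto elim!: eventually_mono simp: indicator_def)
          also have "\<dots> \<le> ennreal b"
            unfolding sq_def b_def using f \<mu>0 \<mu> D \<rho> Cp p by (intro truncated_square_function_bound[OF S]) auto
          finally show ?thesis using b by simp
        qed
      qed blast
      have GC: "G \<subseteq> C" "G \<in> sets borel"
        using G(1) C by (auto simp: M_def sets_restrict_space)
      have "emeasure lborel G = emeasure M G"
        using GC C unfolding M_def by (subst emeasure_restrict_space) auto
      also have "\<dots> \<le> ennreal (2 * b)"
        using G(2) by (simp add: M.emeasure_eq_measure ennreal_leI)
      also have "\<dots> = ennreal \<kappa> * emeasure lborel D"
        using \<mu> \<kappa> by (simp add: b_eq \<kappa>_def mult.assoc flip: ennreal_mult)
      finally have "emeasure lborel G \<le> ennreal \<kappa> * emeasure lborel D" .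
      moreover have "sqn (\<lambda>x. indicator (C - G) x * S (\<lambda>y. indicator D y * f y) x) \<le> ennreal \<epsilon> * sqn f"
        if f: "f \<in> Lp 2" for f
      proof (cases "sqn f = 0")
        case True
        have "sqn (\<lambda>y. indicator D y * f y) \<le> sqn f"
          by (intro sqn_mult_le1) (simp add: indicator_def)
        then have "sqn (\<lambda>y. indicator D y * f y) = 0" using True by simp
        then show ?thesis using zero[OF f] by simp
      next
        case False
        obtain q where q: "sqn f = ennreal q" "q > 0"
          using f False by (cases "sqn f") (auto simp: L2_iff order_less_le)
        \<comment> \<open>Normalises f, so that the one-element family puts its scaled square
          function into K. Undoing this multiplies the bound 2 b by q \<rho>, which gives \<epsilon>
          q.\<close>
        define c where "c = complex_of_real (1 / sqrt q)"
        define f' where "f' x = c * f x" for x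
        have f': "f' \<in> Lp 2" unfolding f'_def by (intro L2_cmult f)
        have "sqn f' = 1"
        proof -
          have "sqn f' = ennreal ((cmod c)\<^sup>2) * sqn f"
            unfolding f'_def by (intro sqn_cmult L2_measurable[OF f])
          also have "(cmod c)\<^sup>2 = 1 / q" using q by (simp add: c_def norm_divide power_divide)
          finally show ?thesis using q by (simp flip: ennreal_mult)
        qed
        define k where "k = S (\<lambda>y. indicator D y * f y)"
        define g where "g x = (cmod (S (\<lambda>y. indicator D y * f' y) x))\<^sup>2 / \<rho>" for x
        have [measurable]: "S (\<lambda>y. indicator D y * f' y) \<in> borel_measurable borel"
          by (intro bounded_opers_measurable[OF S] DL2 f')
        have gK: "g \<in> K"
          unfolding K_def using f' \<rho> \<open>sqn f' = 1\<close>
          by (auto simp: g_def[abs_def] sq_def intro!: exI[of _ "1::nat"] exI[of _ "\<lambda>_. f'"])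
        have [measurable]: "C \<in> sets borel" "G \<in> sets borel" using C GC by auto
        have "AE x in lborel. S (\<lambda>y. c * (indicator D y * f y)) x = c * k x"
          unfolding k_def by (intro bounded_opers_cmult[OF S] DL2 f)
        then have kg: "AE x in lborel. (cmod (k x))\<^sup>2 = (q * \<rho>) * g x"
          by eventually_elim
            (use q \<rho> in \<open>simp add: g_def f'_def mult.left_commute norm_mult c_def norm_divide power_mult_distrib power_divide\<close>)
        have "sqn (\<lambda>x. indicator (C - G) x * k x)
            = (\<integral>\<^sup>+x. ennreal (q * \<rho>) * (ennreal (g x) * indicator (C - G) x * indicator C x) \<partial>lborel)"
          unfolding sqn_def using kg
          by (intro nn_integral_cong_AE)
            (auto elim!: eventually_mono simp: indicator_def ennreal_mult'[symmetric] q(2) \<rho> less_imp_le)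
        also have "\<dots> = ennreal (q * \<rho>) * (\<integral>\<^sup>+x. ennreal (g x) * indicator (C - G) x * indicator C x \<partial>lborel)"
          using Kmeas[OF gK] by (intro nn_integral_cmult) auto
        also have "(\<integral>\<^sup>+x. ennreal (g x) * indicator (C - G) x * indicator C x \<partial>lborel)
            = (\<integral>\<^sup>+x. ennreal (g x) * indicator (C - G) x \<partial>M)"
          unfolding M_def using C by (intro nn_integral_restrict_space[symmetric]) auto
        also have "\<dots> = (\<integral>\<^sup>+x. ennreal (g x) * indicator (space M - G) x \<partial>M)"
          by (simp add: M_def space_restrict_space)
        also have "ennreal (q * \<rho>) * \<dots> \<le> ennreal (q * \<rho>) * ennreal (2 * b)"
          by (intro mult_left_mono G gK) auto
        also have "\<dots> = ennreal \<epsilon> * sqn f"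
          using q \<rho> b \<epsilon> by (simp add: mult_ac flip: ennreal_mult b\<rho>)
        finally show ?thesis by (simp add: k_def)
      qed
      ultimately show ?thesis using GC by blast
    qed
  qed
  then show thesis using that \<kappa> by blast
qed

section \<open>Fejer weights\<close>

text \<open>Orthogonality of characters modulo 2 M + 1: multiplication by z shifts the index, the
  sum returns to itself, and z differs from 1. The symmetric range of l keeps all frequencies in
  [-pi, pi], where the cosine is monotone in the absolute value.\<close>

lemma sum_cis_symmetric:
  fixes M :: nat and d :: int
  assumes "\<bar>d\<bar> < 2 * int M + 1"
  shows "(\<Sum>l\<in>{- int M..int M}. cis (2 * pi * of_int l / (2 * real M + 1) * of_int d))
    = (if d = 0 then 2 * of_nat M + 1 else 0)"
proof (cases "d = 0")
  case False
  define N where "N = 2 * real M + 1"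
  have N: "N > 0" by (simp add: N_def)
  define e where "e l = cis (2 * pi * of_int l / N * of_int d)" for l :: int
  define z where "z = cis (2 * pi * (of_int d / N))"
  have shift: "z * e l = e (l + 1)" for l
    by (simp add: z_def e_def cis_mult algebra_simps add_divide_distrib)
  have "z \<noteq> 1"
  proof
    assume "z = 1"
    then have "cos (2 * pi * (of_int d / N)) = 1"
      by (auto simp: z_def complex_eq_iff)
    then obtain n :: int where "2 * pi * (of_int d / N) = of_int n * 2 * pi"
      by (auto simp: cos_one_2pi_int)
    then have "of_int d = of_int n * N" using N by (simp add: field_simps)
    then have "of_int d = (of_int (n * (2 * int M + 1)) :: real)" by (simp add: N_def)
    then have "d = n * (2 * int M + 1)" by linarith
    moreover have "n \<noteq> 0" using \<open>d \<noteq> 0\<close> calculation by auto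
    ultimately have "\<bar>d\<bar> \<ge> 2 * int M + 1"
      by (simp add: abs_mult mult_le_cancel_right1)
    then show False using assms by simp
  qed
  have ends: "e (int M + 1) = e (- int M)"
  proof -
    have *: "2 * pi * of_int (int M + 1) / N * of_int d
        = 2 * pi * of_int (- int M) / N * of_int d + 2 * pi * of_int d"
      using N by (simp add: N_def field_simps)
    have "e (int M + 1) = e (- int M) * cis (2 * pi * of_int d)"
      unfolding e_def * by (simp only: cis_mult)
    also have "cis (2 * pi * of_int d) = 1" by (simp add: complex_eq_iff)
    finally show ?thesis by simp
  qed
  have "z * (\<Sum>l\<in>{- int M..int M}. e l) = (\<Sum>l\<in>{- int M..int M}. e (l + 1))"
    by (simp add: sum_distrib_left shift)
  also have "\<dots> = (\<Sum>l\<in>{- int M + 1..int M + 1}. e l)"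
    by (rule sum.reindex_bij_witness[of _ "\<lambda>l. l - 1" "\<lambda>l. l + 1"]) auto
  also have "{- int M + 1..int M + 1} = insert (int M + 1) {- int M + 1..int M}" by auto
  also have "(\<Sum>l\<in>\<dots>. e l) = e (- int M) + (\<Sum>l\<in>{- int M + 1..int M}. e l)"
    using ends by simp
  also have "\<dots> = (\<Sum>l\<in>insert (- int M) {- int M + 1..int M}. e l)" by simp
  also have "insert (- int M) {- int M + 1..int M} = {- int M..int M}" by auto
  finally have "(z - 1) * (\<Sum>l\<in>{- int M..int M}. e l) = 0" by (simp add: algebra_simps)
  then show ?thesis using \<open>z \<noteq> 1\<close> False by (simp add: e_def N_def)
qed simp

definition dot :: "('n::finite \<Rightarrow> real) \<Rightarrow> ('n \<Rightarrow> int) \<Rightarrow> real" where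
  "dot k d = (\<Sum>i\<in>UNIV. k i * of_int (d i))"

definition freqs :: "nat \<Rightarrow> ('n::finite \<Rightarrow> int) set" where
  "freqs M = PiE UNIV (\<lambda>_. {- int M..int M})"

definition freq :: "nat \<Rightarrow> ('n \<Rightarrow> int) \<Rightarrow> 'n \<Rightarrow> real" where
  "freq M l i = 2 * pi * of_int (l i) / (2 * real M + 1)"

definition cube :: "nat \<Rightarrow> ('n::finite \<Rightarrow> int) set" where
  "cube R = PiE UNIV (\<lambda>_. {0..<int R})"

lemma finite_freqs[simp]: "finite (freqs M)" and finite_cube[simp]: "finite (cube R)"
  by (auto simp: freqs_def cube_def intro!: finite_PiE)

lemma mem_cube: "j \<in> cube R \<longleftrightarrow> (\<forall>i. 0 \<le> j i \<and> j i < int R)"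
  by (auto simp: cube_def PiE_def Pi_def)

lemma card_cube: "card (cube R :: ('n::finite \<Rightarrow> int) set) = R ^ CARD('n)"
  by (simp add: cube_def card_PiE)

lemma cis_sum: "cis (sum f A) = (\<Prod>i\<in>A. cis (f i))"
  by (induction A rule: infinite_finite_induct) (auto simp flip: cis_mult)

lemma cis_dot_orthogonal:
  fixes d :: "'n::finite \<Rightarrow> int"
  assumes "\<And>i. \<bar>d i\<bar> < 2 * int M + 1"
  shows "(\<Sum>l\<in>freqs M. cis (dot (freq M l) d)) = (if d = (\<lambda>_. 0) then (2 * of_nat M + 1) ^ CARD('n) else 0)"
proof -
  have "(\<Sum>l\<in>freqs M. cis (dot (freq M l) d))
      = (\<Prod>i\<in>UNIV. \<Sum>m\<in>{- int M..int M}. cis (2 * pi * of_int m / (2 * real M + 1) * of_int (d i)))"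
    unfolding freqs_def dot_def freq_def cis_sum by (rule prod_sum_PiE[symmetric]) auto
  also have "\<dots> = (\<Prod>i\<in>(UNIV :: 'n set). if d i = 0 then 2 * of_nat M + 1 else 0)"
    using assms by (intro prod.cong sum_cis_symmetric) auto
  also have "\<dots> = (if d = (\<lambda>_. 0) then (2 * of_nat M + 1) ^ CARD('n) else 0)"
    by (auto simp: fun_eq_iff intro: prod_zero)
  finally show ?thesis .
qed

text \<open>The Fejer kernel, a normalised squared Dirichlet kernel, sampled on the frequency grid.
  The grid size enters the normalisation so that the weights sum to 1 once 0 < R \<le> 2 M +
  1.\<close>

definition fejer_weight :: "nat \<Rightarrow> nat \<Rightarrow> ('n::finite \<Rightarrow> int) \<Rightarrow> real" where
  "fejer_weight M R l = (cmod (\<Sum>j\<in>cube R. cis (dot (freq M l) j)))\<^sup>2 / ((2 * real M + 1) * real R) ^ CARD('n)"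

lemma fejer_weight_nonneg: "0 \<le> fejer_weight M R l"
  by (simp add: fejer_weight_def)

text \<open>Expanding the square gives characters at j - j' + d, and summing over frequencies keeps
  only j' = j + d. The coefficient is thus the fraction of the cube that stays inside it under
  translation by d. The bound on d excludes aliasing modulo 2 M + 1.\<close>

lemma fejer_weight_fourier:
  fixes d :: "'n::finite \<Rightarrow> int"
  assumes "\<And>i. \<bar>d i\<bar> + int R \<le> 2 * int M + 1" "R > 0"
  shows "(\<Sum>l\<in>freqs M. of_real (fejer_weight M R l) * cis (dot (freq M l) d))
    = of_nat (card {j \<in> cube R. (\<lambda>i. j i + d i) \<in> cube R}) / of_nat (R ^ CARD('n))"
proof -
  define c where "c = ((2 * complex_of_nat M + 1) ^ CARD('n) * of_nat (R ^ CARD('n)))"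
  have N0: "2 * complex_of_nat M + 1 \<noteq> 0"
    using of_nat_neq_0[of "2 * M", where 'a = complex] by (simp add: add.commute)
  have ne: "c \<noteq> 0" using assms N0 by (simp add: c_def)
  have sq: "of_real ((cmod (\<Sum>j\<in>cube R. cis (dot k j)))\<^sup>2) * cis (dot k d)
      = (\<Sum>j\<in>cube R. \<Sum>j'\<in>cube R. cis (dot k (\<lambda>i. j i - j' i + d i)))" for k :: "'n \<Rightarrow> real"
  proof -
    have "complex_of_real ((cmod (\<Sum>j\<in>cube R. cis (dot k j)))\<^sup>2)
        = (\<Sum>j\<in>cube R. \<Sum>j'\<in>cube R. cis (dot k j) * cis (- dot k j'))"
      by (simp add: complex_norm_square cnj_sum cis_cnj del: of_real_power flip: sum_product)
    moreover have "cis (dot k j) * cis (- dot k j') * cis (dot k d) = cis (dot k (\<lambda>i. j i - j' i + d i))" for j j'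
      by (simp add: cis_mult dot_def algebra_simps sum.distrib sum_subtractf)
    ultimately show ?thesis
      by (simp only: sum_distrib_right)
  qed
  have inner: "(\<Sum>l\<in>freqs M. cis (dot (freq M l) (\<lambda>i. j i - j' i + d i)))
      = (if j' = (\<lambda>i. j i + d i) then (2 * of_nat M + 1) ^ CARD('n) else 0)"
    if "j \<in> cube R" "j' \<in> cube R" for j j' :: "'n \<Rightarrow> int"
  proof -
    have "\<bar>j i - j' i + d i\<bar> < 2 * int M + 1" for i
    proof -
      have "\<bar>j i - j' i\<bar> < int R" using that[unfolded mem_cube, THEN spec, of i] by linarith
      then show ?thesis using assms(1)[of i] by linarith
    qed
    then have "(\<Sum>l\<in>freqs M. cis (dot (freq M l) (\<lambda>i. j i - j' i + d i)))
      = (if (\<lambda>i. j i - j' i + d i) = (\<lambda>_. 0) then (2 * of_nat M + 1) ^ CARD('n) else 0)"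
      by (rule cis_dot_orthogonal)
    moreover have "(\<lambda>i. j i - j' i + d i) = (\<lambda>_. 0) \<longleftrightarrow> j' = (\<lambda>i. j i + d i)"
      unfolding fun_eq_iff by (intro all_cong1) auto
    ultimately show ?thesis by simp
  qed
  have "(\<Sum>l\<in>freqs M. of_real (fejer_weight M R l) * cis (dot (freq M l) d))
      = (\<Sum>l\<in>freqs M. (\<Sum>j\<in>cube R. \<Sum>j'\<in>cube R. cis (dot (freq M l) (\<lambda>i. j i - j' i + d i))) / c)"
    by (intro sum.cong refl, subst sq[symmetric])
      (simp add: fejer_weight_def c_def power_mult_distrib)
  also have "\<dots> = (\<Sum>j\<in>cube R. \<Sum>j'\<in>cube R. \<Sum>l\<in>freqs M. cis (dot (freq M l) (\<lambda>i. j i - j' i + d i))) / c"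
    unfolding sum_divide_distrib[symmetric]
    by (subst sum.swap, subst (2) sum.swap) simp
  also have "\<dots> = (\<Sum>j\<in>cube R. \<Sum>j'\<in>cube R. if j' = (\<lambda>i. j i + d i) then (2 * of_nat M + 1) ^ CARD('n) else 0) / c"
    by (intro arg_cong2[of _ _ _ _ "(/)"] sum.cong inner refl)
  also have "\<dots> = (\<Sum>j\<in>cube R. if (\<lambda>i. j i + d i) \<in> cube R then (2 * of_nat M + 1) ^ CARD('n) else 0) / c"
    by (simp add: sum.delta')
  also have "\<dots> = of_nat (card {j \<in> cube R. (\<lambda>i. j i + d i) \<in> cube R}) * (2 * of_nat M + 1) ^ CARD('n) / c"
    by (simp add: sum.If_cases Int_def)
  also have "\<dots> = of_nat (card {j \<in> cube R. (\<lambda>i. j i + d i) \<in> cube R}) / of_nat (R ^ CARD('n))"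
    using N0 by (simp add: c_def)
  finally show ?thesis .
qed

lemma fejer_weight_sum:
  assumes "R \<le> 2 * M + 1" "R > 0"
  shows "(\<Sum>l\<in>freqs M. fejer_weight M R (l :: 'n::finite \<Rightarrow> int)) = 1"
proof -
  have "complex_of_real (\<Sum>l\<in>freqs M. fejer_weight M R (l :: 'n \<Rightarrow> int)) = 1"
    using fejer_weight_fourier[of "\<lambda>_ :: 'n. 0" R M] assms by (simp add: dot_def card_cube)
  then show ?thesis by (simp only: of_real_eq_1_iff)
qed

text \<open>This is the Fourier coefficient at a unit vector: translation by it pushes out only the
  layer j i = R - 1, a fraction 1 / R of the cube. The bound is uniform in the grid size M.\<close>

lemma fejer_weight_concentration:
  fixes i :: "'n::finite"
  assumes "R \<le> 2 * M" "R > 0"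
  shows "(\<Sum>l\<in>freqs M. fejer_weight M R l * (1 - cos (freq M l i))) \<le> 1 / real R"
proof -
  define d where "d = (\<lambda>i'. if i' = i then 1 else 0 :: int)"
  define B where "B = {j \<in> cube R. (\<lambda>i. j i + d i) \<in> cube R}"
  have dot_d: "dot k d = k i" for k
    by (simp add: dot_def d_def if_distrib[of of_int] if_distrib[of "\<lambda>x. _ * x"] cong: if_cong)
  have "(\<Sum>l\<in>freqs M. fejer_weight M R l * cos (freq M l i))
     = Re (\<Sum>l\<in>freqs M. of_real (fejer_weight M R l) * cis (dot (freq M l) d))"
    by (simp add: dot_d)
  also have "(\<Sum>l\<in>freqs M. of_real (fejer_weight M R l) * cis (dot (freq M l) d))
      = of_nat (card B) / of_nat (R ^ CARD('n))"
    unfolding B_def using assms by (intro fejer_weight_fourier) (auto simp: d_def)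
  also have "\<dots> = complex_of_real (real (card B) / real (R ^ CARD('n)))"
    by simp
  finally have cosB: "(\<Sum>l\<in>freqs M. fejer_weight M R l * cos (freq M l i)) = real (card B) / real (R ^ CARD('n))"
    by (simp only: Re_complex_of_real)
  have "card (cube R - B :: ('n \<Rightarrow> int) set) \<le> card (PiE UNIV (\<lambda>i'. if i' = i then {int R - 1} else {0..<int R}))"
  proof (intro card_mono finite_PiE)
    show "cube R - B \<subseteq> (\<Pi>\<^sub>E i'\<in>UNIV. if i' = i then {int R - 1} else {0..<int R})"
    proof
      fix j assume "j \<in> cube R - B"
      then have j: "0 \<le> j i'" "j i' < int R" for i' by (auto simp: mem_cube)
      from \<open>j \<in> cube R - B\<close> obtain i' where "\<not> (0 \<le> j i' + d i' \<and> j i' + d i' < int R)"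
        by (auto simp: B_def mem_cube)
      with j[of i'] have "i' = i" "j i = int R - 1" by (auto simp: d_def split: if_splits)
      then show "j \<in> (\<Pi>\<^sub>E i'\<in>UNIV. if i' = i then {int R - 1} else {0..<int R})" using j by auto
    qed
  qed auto
  also have "\<dots> = (\<Prod>i'\<in>UNIV. if i' = i then 1 else R)"
    by (subst card_PiE) (auto intro!: prod.cong)
  also have "\<dots> = R ^ (CARD('n) - 1)"
  proof -
    have "- {i} = UNIV - {i}" by auto
    then show ?thesis by (simp add: prod.If_cases card_Diff_singleton)
  qed
  finally have "card (cube R - B :: ('n \<Rightarrow> int) set) \<le> R ^ (CARD('n) - 1)" .
  moreover have "card (cube R - B :: ('n \<Rightarrow> int) set) = R ^ CARD('n) - card B"
    by (subst card_Diff_subset) (auto simp: B_def card_cube)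
  moreover have RP: "R ^ CARD('n) = R ^ (CARD('n) - 1) * R"
    by (rule power_minus_mult[symmetric]) simp
  ultimately have "R ^ (CARD('n) - 1) * R \<le> R ^ (CARD('n) - 1) + card B"
    by linarith
  then have "real (R ^ (CARD('n) - 1) * R) \<le> real (R ^ (CARD('n) - 1) + card B)"
    by (rule of_nat_mono)
  then have cardB: "real (R ^ (CARD('n) - 1)) * real R - real (card B) \<le> real (R ^ (CARD('n) - 1))"
    by simp
  define P where "P = real (R ^ (CARD('n) - 1))"
  have P: "P > 0" using assms by (simp add: P_def)
  have "(\<Sum>l\<in>freqs M. fejer_weight M R l * (1 - cos (freq M l i))) = 1 - real (card B) / (P * real R)"
    using fejer_weight_sum[of R M, where 'n = 'n] assms cosB
    by (simp only: right_diff_distrib sum_subtractf RP P_def of_nat_mult) simp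
  also have "\<dots> \<le> 1 / real R"
  proof -
    have "P * real R - real (card B) \<le> P" using cardB by (simp add: P_def)
    then have "(P * real R - real (card B)) / (P * real R) \<le> P / (P * real R)"
      using P assms by (intro divide_right_mono) auto
    then show ?thesis using P assms by (simp add: diff_divide_distrib)
  qed
  finally show ?thesis .
qed

section \<open>Block averages\<close>

definition cell :: "real ^ 'n \<Rightarrow> 'n \<Rightarrow> int" where
  "cell x = (\<lambda>i. \<lfloor>x $ i\<rfloor>)"

definition block :: "nat \<Rightarrow> ('n::finite \<Rightarrow> int) \<Rightarrow> (real ^ 'n) set" where
  "block R s = {x. (\<lambda>i. cell x i - s i) \<in> cube R}"

definition big_box :: "nat \<Rightarrow> (real ^ 'n::finite) set" where
  "big_box L = {x. \<forall>i. \<bar>cell x i\<bar> \<le> int L}"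

lemma cell_measurable[measurable]: "cell \<in> borel \<rightarrow>\<^sub>M count_space (UNIV :: ('n::finite \<Rightarrow> int) set)"
proof (subst measurable_count_space_eq2_countable, intro conjI ballI)
  fix s :: "'n \<Rightarrow> int"
  have "cell -` {s} \<inter> space borel = {x :: real ^ 'n. \<forall>i\<in>UNIV. \<lfloor>x $ i\<rfloor> = s i}"
    by (auto simp: cell_def fun_eq_iff)
  also have "\<dots> \<in> sets borel" by measurable
  finally show "cell -` {s} \<inter> space borel \<in> sets (borel :: (real ^ 'n) measure)" .
qed auto

lemma cell_vimage_sets[measurable]: "cell -` A \<in> sets (borel :: (real ^ 'n::finite) measure)"
  using measurable_sets[OF cell_measurable, of A] by simp

lemma block_sets[measurable]: "block R s \<in> sets borel"
proof -
  have "block R s = cell -` {m. (\<lambda>i. m i - s i) \<in> cube R}" by (auto simp: block_def)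
  then show ?thesis by (simp only: cell_vimage_sets)
qed

lemma big_box_sets[measurable]: "big_box L \<in> sets (borel :: (real ^ 'n::finite) measure)"
proof -
  have "(big_box L :: (real ^ 'n) set) = cell -` {m. \<forall>i. \<bar>m i\<bar> \<le> int L}" by (auto simp: big_box_def)
  then show ?thesis by (simp only: cell_vimage_sets)
qed

section \<open>Characters constant on unit cells\<close>

definition modulation :: "('n::finite \<Rightarrow> real) \<Rightarrow> real ^ 'n \<Rightarrow> complex" where
  "modulation k x = cis (dot k (cell x))"

lemma cmod_modulation[simp]: "cmod (modulation k x) = 1"
  by (simp add: modulation_def)

lemma modulation_measurable[measurable]: "modulation k \<in> borel_measurable borel"
  using measurable_compose[OF cell_measurable, of "\<lambda>m. cis (dot k m)" borel]
  by (simp add: modulation_def[abs_def])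

lemma cmod_cis_diff_le: "cmod (cis a - cis b) \<le> \<bar>a - b\<bar>"
proof -
  have "(cmod (cis a - cis b))\<^sup>2 = (cos a)\<^sup>2 + (sin a)\<^sup>2 + ((cos b)\<^sup>2 + (sin b)\<^sup>2) - 2 * (cos a * cos b + sin a * sin b)"
    by (simp only: cmod_power2 power2_diff minus_complex.sel cis.sel) (simp add: algebra_simps)
  also have "\<dots> = 2 - 2 * cos (a - b)" by (simp add: cos_diff)
  also have "cos (a - b) = 1 - 2 * (sin ((a - b) / 2))\<^sup>2"
    using cos_double_sin[of "(a - b) / 2"] by (simp only: nonzero_mult_div_cancel_left times_divide_eq_right)
  also have "2 - 2 * (1 - 2 * (sin ((a - b) / 2))\<^sup>2) = 4 * (sin ((a - b) / 2))\<^sup>2" by simp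
  also have "\<dots> \<le> 4 * ((a - b) / 2)\<^sup>2"
    using abs_sin_x_le_abs_x[of "(a - b) / 2"] by (simp only: abs_le_square_iff)
  also have "\<dots> = \<bar>a - b\<bar>\<^sup>2" by (simp add: power_divide)
  finally show ?thesis by (rule power2_le_imp_le) simp
qed

lemma cnj_measurable[measurable (raw)]:
  "f \<in> borel_measurable M \<Longrightarrow> (\<lambda>x. cnj (f x)) \<in> borel_measurable M"
  by (rule measurable_compose[OF _ borel_measurable_continuous_onI[OF continuous_on_cnj[OF continuous_on_id]]])

section \<open>Passing between bounds on \<open>sqn\<close> and \<open>oper_norm\<close>\<close>

lemma Lp_norm_2_le:
  assumes "f \<in> Lp 2" "g \<in> Lp 2" "sqn f \<le> ennreal (B\<^sup>2) * sqn g" "B \<ge> 0"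
  shows "Lp_norm 2 f \<le> B * Lp_norm 2 g"
proof (rule power2_le_imp_le)
  have "ennreal ((Lp_norm 2 f)\<^sup>2) \<le> ennreal (B\<^sup>2 * (Lp_norm 2 g)\<^sup>2)"
    using assms by (simp add: Lp_norm_2 ennreal_mult)
  then show "(Lp_norm 2 f)\<^sup>2 \<le> (B * Lp_norm 2 g)\<^sup>2"
    by (simp add: power_mult_distrib)
qed (use assms in \<open>simp add: Lp_norm_nonneg\<close>)

text \<open>\<open>oper_norm\<close> is a supremum of reals, so some bound B must be known before it
  dominates the quotients. On functions of norm 0 the quotient is 0 by the division convention, and
  the estimate comes from B instead.\<close>

lemma sqn_le_oper_norm:
  assumes D: "\<And>f. f \<in> Lp 2 \<Longrightarrow> D f \<in> Lp 2" "\<And>f. f \<in> Lp 2 \<Longrightarrow> sqn (D f) \<le> ennreal B * sqn f" "B \<ge> 0"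
  shows "0 \<le> oper_norm 2 D"
    and "f \<in> Lp 2 \<Longrightarrow> sqn (D f) \<le> ennreal ((oper_norm 2 D)\<^sup>2) * sqn f"
proof -
  have norm: "Lp_norm 2 (D g) \<le> sqrt B * Lp_norm 2 g" if g: "g \<in> Lp 2" for g
    using D g by (intro Lp_norm_2_le) auto
  have bdd: "bdd_above ((\<lambda>g. Lp_norm 2 (D g) / Lp_norm 2 g) ` Lp 2)"
  proof (rule bdd_aboveI2)
    fix g :: "'a \<Rightarrow> complex" assume "g \<in> Lp 2"
    then show "Lp_norm 2 (D g) / Lp_norm 2 g \<le> sqrt B"
      using norm[of g] Lp_norm_nonneg[of 2 g] D(3) by (auto simp: divide_le_eq order_less_le)
  qed
  have le: "Lp_norm 2 (D g) / Lp_norm 2 g \<le> oper_norm 2 D" if "g \<in> Lp 2" for g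
    unfolding oper_norm_def using that bdd by (rule cSUP_upper)
  show "0 \<le> oper_norm 2 D"
    using le[OF L2_zero] by (rule order_trans[rotated]) (simp add: Lp_norm_nonneg)
  assume f: "f \<in> Lp 2"
  have "Lp_norm 2 (D f) \<le> oper_norm 2 D * Lp_norm 2 f"
  proof (cases "Lp_norm 2 f = 0")
    case True
    then show ?thesis using norm[OF f] by simp
  next
    case False
    then show ?thesis using le[OF f] Lp_norm_nonneg[of 2 f] by (simp add: divide_le_eq)
  qed
  then have "(Lp_norm 2 (D f))\<^sup>2 \<le> (oper_norm 2 D * Lp_norm 2 f)\<^sup>2"
    by (intro power_mono Lp_norm_nonneg)
  then have "ennreal ((Lp_norm 2 (D f))\<^sup>2) \<le> ennreal ((oper_norm 2 D)\<^sup>2) * ennreal ((Lp_norm 2 f)\<^sup>2)"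
    by (simp add: power_mult_distrib ennreal_leI flip: ennreal_mult)
  then show "sqn (D f) \<le> ennreal ((oper_norm 2 D)\<^sup>2) * sqn f" using D f by (simp add: Lp_norm_2)
qed

lemma oper_norm_le:
  fixes D :: "'a::euclidean_space oper"
  assumes D: "\<And>f. f \<in> Lp 2 \<Longrightarrow> D f \<in> Lp 2" "\<And>f. f \<in> Lp 2 \<Longrightarrow> sqn (D f) \<le> ennreal (B\<^sup>2) * sqn f"
    and B: "B \<ge> 0"
  shows "oper_norm 2 D \<le> B"
  unfolding oper_norm_def
proof (rule cSUP_least)
  show "Lp 2 \<noteq> ({} :: ('a \<Rightarrow> complex) set)" using L2_zero by blast
  fix f :: "'a \<Rightarrow> complex" assume f: "f \<in> Lp 2"
  have "Lp_norm 2 (D f) \<le> B * Lp_norm 2 f"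
    using D f B by (intro Lp_norm_2_le) auto
  then show "Lp_norm 2 (D f) / Lp_norm 2 f \<le> B"
    using Lp_norm_nonneg[of 2 f] B by (auto simp: divide_le_eq order_less_le)
qed

lemma bounded_opers_comp_mult_oper:
  assumes S: "S \<in> bounded_opers 2" and \<phi>: "\<phi> \<in> borel_measurable borel" "\<And>x. cmod (\<phi> x) \<le> c"
  shows "S \<circ> mult_oper \<phi> \<in> bounded_opers 2"
proof -
  have c: "0 \<le> c" using \<phi>(2) norm_ge_zero order_trans by blast
  have \<phi>L2: "(\<lambda>y. \<phi> y * f y) \<in> Lp 2" if "f \<in> Lp 2" for f
    using that \<phi> by (rule L2_mult)
  obtain C where C: "C > 0" "\<And>f. f \<in> Lp 2 \<Longrightarrow> sqn (S f) \<le> ennreal C * sqn f"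
    using bounded_opers_sqn_bound[OF S] by blast
  define A where "A f = S (\<lambda>y. \<phi> y * f y)" for f
  have A_L2: "A f \<in> Lp 2" if "f \<in> Lp 2" for f
    unfolding A_def by (intro bounded_opers_Lp[OF S] \<phi>L2 that)
  have add: "AE x in lborel. A (\<lambda>y. f y + g y) x = A f x + A g x" if "f \<in> Lp 2" "g \<in> Lp 2" for f g
    using bounded_opers_add[OF S \<phi>L2 \<phi>L2, OF that] by (simp add: A_def distrib_left)
  have cmult: "AE x in lborel. A (\<lambda>y. z * f y) x = z * A f x" if "f \<in> Lp 2" for f z
    using bounded_opers_cmult[OF S \<phi>L2, OF that, of z] by (simp add: A_def mult.left_commute)
  have cong: "AE x in lborel. A f x = A g x"
    if "f \<in> Lp 2" "g \<in> Lp 2" "AE x in lborel. f x = g x" for f g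
  proof -
    have "AE x in lborel. \<phi> x * f x = \<phi> x * g x" using that(3) by eventually_elim simp
    then show ?thesis unfolding A_def by (rule bounded_opers_cong[OF S \<phi>L2 \<phi>L2, OF that(1,2)])
  qed
  have bound: "Lp_norm 2 (A f) \<le> sqrt (C * c\<^sup>2) * Lp_norm 2 f" if f: "f \<in> Lp 2" for f
  proof (rule Lp_norm_2_le)
    have "sqn (A f) \<le> ennreal C * sqn (\<lambda>y. \<phi> y * f y)"
      unfolding A_def by (intro C \<phi>L2 f)
    also have "\<dots> \<le> ennreal C * (ennreal (c\<^sup>2) * sqn f)"
      by (intro mult_left_mono sqn_mult_le \<phi> L2_measurable[OF f]) simp
    also have "\<dots> = ennreal ((sqrt (C * c\<^sup>2))\<^sup>2) * sqn f"
      using C(1) by (simp add: ennreal_mult mult.assoc)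
    finally show "sqn (A f) \<le> ennreal ((sqrt (C * c\<^sup>2))\<^sup>2) * sqn f" .
  qed (use f A_L2 C(1) in auto)
  have "A \<in> bounded_opers 2"
    unfolding bounded_opers_def using A_L2 add cmult cong bound by blast
  moreover have "A = S \<circ> mult_oper \<phi>" by (simp add: A_def mult_oper_def fun_eq_iff)
  ultimately show ?thesis by simp
qed

text \<open>A crude estimate for frequencies far from 0, where continuity at the trivial character
  says nothing; 4 C is 2 C + 2 C from \<open>sqn_add_le\<close>.\<close>

lemma sqn_conj_unimodular_le:
  assumes S: "S \<in> bounded_opers 2" and C: "\<And>f. f \<in> Lp 2 \<Longrightarrow> sqn (S f) \<le> ennreal C * sqn f" "C > 0"
    and f: "f \<in> Lp 2" and u: "u \<in> borel_measurable borel" "\<And>x. cmod (u x) = 1"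
  shows "sqn (\<lambda>x. S f x - cnj (u x) * S (\<lambda>y. u y * f y) x) \<le> ennreal (4 * C) * sqn f"
proof -
  have uf: "(\<lambda>y. u y * f y) \<in> Lp 2" using f u by (intro L2_mult[where c = 1]) auto
  note [measurable] = u(1) bounded_opers_measurable[OF S f] bounded_opers_measurable[OF S uf]
  have "sqn (\<lambda>x. S f x + (- cnj (u x)) * S (\<lambda>y. u y * f y) x)
    \<le> 2 * sqn (S f) + 2 * sqn (\<lambda>x. (- cnj (u x)) * S (\<lambda>y. u y * f y) x)"
    by (intro sqn_add_le) measurable
  also have "sqn (\<lambda>x. (- cnj (u x)) * S (\<lambda>y. u y * f y) x) \<le> sqn (S (\<lambda>y. u y * f y))"
    using u by (intro sqn_mult_le1) auto
  also have "\<dots> \<le> ennreal C * sqn (\<lambda>y. u y * f y)" by (intro C uf)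
  also have "sqn (\<lambda>y. u y * f y) \<le> sqn f" using u by (intro sqn_mult_le1) auto
  also have "sqn (S f) \<le> ennreal C * sqn f" by (intro C f)
  also have "2 * (ennreal C * sqn f) + 2 * (ennreal C * sqn f) = ennreal (4 * C) * sqn f"
    using C(2) by (simp add: ennreal_mult mult.assoc flip: distrib_right)
  finally show ?thesis by (simp add: mult_left_mono add_mono)
qed

text \<open>Norm continuity at k = 0 treats the true characters. Freezing them on unit cells changes
  the phase by at most the sum of the |k i|, since a coordinate differs from its floor by at most 1,
  and boundedness of S turns this into a small operator error.\<close>

lemma class_Cu_small_modulation:
  fixes S :: "(real ^ 'n) oper"
  assumes Cu: "class_Cu S" and \<eta>: "\<eta> > 0"
  obtains \<delta> where "\<delta> > 0" "\<delta> < pi"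
    "\<And>k f. \<lbrakk>\<And>i. \<bar>k i\<bar> < \<delta>; f \<in> Lp 2\<rbrakk> \<Longrightarrow>
      sqn (\<lambda>x. S f x - cnj (modulation k x) * S (\<lambda>y. modulation k y * f y) x) \<le> ennreal \<eta> * sqn f"
proof -
  have S: "S \<in> bounded_opers 2" using Cu by (simp add: class_Cu_def)
  obtain C where C: "\<And>f. f \<in> Lp 2 \<Longrightarrow> sqn (S f) \<le> ennreal C * sqn f" "C > 0"
    using bounded_opers_sqn_bound[OF S] by metis
  define N where "N = real CARD('n)"
  have N: "N > 0" by (simp add: N_def)
  define v where "v h x = exp (\<i> * complex_of_real (x \<bullet> h))" for h x :: "real ^ 'n"
  have v_cis: "v h x = cis (x \<bullet> h)" for h x by (simp add: v_def cis_conv_exp)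
  have [measurable]: "v h \<in> borel_measurable borel" for h unfolding v_def by measurable
  have [simp]: "cmod (v h x) = 1" for h x by (simp add: v_cis)
  define D where "D h = (inv (V h) \<circ> S \<circ> V h) - (inv (V 0) \<circ> S \<circ> V 0)" for h :: "real ^ 'n"
  have D_eq: "D h f = (\<lambda>x. cnj (v h x) * S (\<lambda>y. v h y * f y) x - S f x)" for h f
    by (simp add: D_def inv_V fun_eq_iff, simp add: V_def mult_oper_def v_def exp_cnj)
  have "((\<lambda>h. oper_norm 2 (D h)) \<longlongrightarrow> 0) (at 0)"
    using Cu unfolding class_Cu_def D_def by blast
  then have "eventually (\<lambda>h. oper_norm 2 (D h) < sqrt (\<eta> / 4)) (at 0)"
    using \<eta> by (intro order_tendstoD) auto
  then obtain \<delta>1 where \<delta>1: "\<delta>1 > 0" "\<And>h. h \<noteq> 0 \<Longrightarrow> norm h < \<delta>1 \<Longrightarrow> oper_norm 2 (D h) < sqrt (\<eta> / 4)"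
    by (auto simp: eventually_at dist_norm)
  have vf: "(\<lambda>y. v h y * f y) \<in> Lp 2" if "f \<in> Lp 2" for h f
    using that by (intro L2_mult[where c = 1]) auto
  have D_L2: "D h f \<in> Lp 2" if f: "f \<in> Lp 2" for h f
  proof -
    have 1: "(\<lambda>x. cnj (v h x) * S (\<lambda>y. v h y * f y) x) \<in> Lp 2"
      by (intro L2_mult[where c = 1] bounded_opers_Lp[OF S] vf f) auto
    have 2: "(\<lambda>x. (- 1) * S f x) \<in> Lp 2" by (intro L2_cmult bounded_opers_Lp[OF S] f)
    show ?thesis using L2_add[OF 1 2] by (simp add: D_eq)
  qed
  have D_sqn: "sqn (D h f) = sqn (\<lambda>x. S f x - cnj (v h x) * S (\<lambda>y. v h y * f y) x)" for h f
    by (simp add: D_eq sqn_def norm_minus_commute)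
  \<comment> \<open>The limit \<open>at 0\<close> does not reach h = 0 itself, where the difference
    vanishes.\<close>
  have small_v: "sqn (\<lambda>x. S f x - cnj (v h x) * S (\<lambda>y. v h y * f y) x) \<le> ennreal (\<eta> / 4) * sqn f"
    if "norm h < \<delta>1" "f \<in> Lp 2" for h f
  proof (cases "h = 0")
    case True
    then show ?thesis by (simp add: v_def sqn_def)
  next
    case False
    have bound: "sqn (D h g) \<le> ennreal (4 * C) * sqn g" if "g \<in> Lp 2" for g
      unfolding D_sqn by (intro sqn_conj_unimodular_le[OF S C that]) auto
    have on: "sqn (D h f) \<le> ennreal ((oper_norm 2 (D h))\<^sup>2) * sqn f" and "oper_norm 2 (D h) \<ge> 0"
      using C(2) by (intro sqn_le_oper_norm[where B = "4 * C"] D_L2 bound that; simp)+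
    then have "(oper_norm 2 (D h))\<^sup>2 \<le> \<eta> / 4"
      using \<delta>1(2)[OF False that(1)] \<eta> by (metis less_imp_le power_mono real_sqrt_pow2 divide_nonneg_pos zero_less_numeral)
    with on show ?thesis unfolding D_sqn by (meson ennreal_leI mult_right_mono order_trans zero_le)
  qed
  \<comment> \<open>The three bounds secure norm h < \<delta>1, a multiplier error of at most sqrt
    (\<eta> / (16 C)), and \<delta> < pi. In total 2 (\<eta> / 4) + 8 C \<eta> / (16 C) =
    \<eta>.\<close>
  define \<delta> where "\<delta> = min (min (\<delta>1 / N) (sqrt (\<eta> / (16 * C)) / N)) 1"
  have \<delta>: "\<delta> > 0" using \<delta>1 N \<eta> C by (simp add: \<delta>_def)
  have \<delta>N: "\<delta> * N \<le> \<delta>1" "\<delta> * N \<le> sqrt (\<eta> / (16 * C))"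
    using N by (auto simp: \<delta>_def min_def field_simps)
  have "sqn (\<lambda>x. S f x - cnj (modulation k x) * S (\<lambda>y. modulation k y * f y) x) \<le> ennreal \<eta> * sqn f"
    if k: "\<And>i. \<bar>k i\<bar> < \<delta>" and f: "f \<in> Lp 2" for k f
  proof -
    define h where "h = (\<chi> i. k i)"
    define a where "a = (\<eta> / (16 * C))"
    have a: "a > 0" using \<eta> C by (simp add: a_def)
    have sumk: "(\<Sum>i\<in>UNIV. \<bar>k i\<bar>) < \<delta> * N"
      using sum_strict_mono[of UNIV "\<lambda>i. \<bar>k i\<bar>" "\<lambda>_. \<delta>"] k by (simp add: N_def mult.commute)
    have "norm h \<le> (\<Sum>i\<in>UNIV. \<bar>h $ i\<bar>)" by (rule norm_le_l1_cart)
    then have h: "norm h < \<delta>1" using sumk \<delta>N by (simp add: h_def)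
    define w where "w x = v h x - modulation k x" for x
    have w: "cmod (w x) \<le> sqrt a" for x
    proof -
      have "cmod (w x) \<le> \<bar>x \<bullet> h - dot k (cell x)\<bar>"
        unfolding w_def v_cis modulation_def by (rule cmod_cis_diff_le)
      also have "x \<bullet> h - dot k (cell x) = (\<Sum>i\<in>UNIV. k i * (x $ i - of_int \<lfloor>x $ i\<rfloor>))"
        by (simp add: inner_vec_def h_def dot_def cell_def algebra_simps sum_subtractf)
      also have "\<bar>\<dots>\<bar> \<le> (\<Sum>i\<in>UNIV. \<bar>k i * (x $ i - of_int \<lfloor>x $ i\<rfloor>)\<bar>)" by (rule sum_abs)
      also have "\<dots> \<le> (\<Sum>i\<in>UNIV. \<bar>k i\<bar>)"
      proof (rule sum_mono)
        fix i
        have "\<bar>x $ i - of_int \<lfloor>x $ i\<rfloor>\<bar> \<le> 1" by linarith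
        then show "\<bar>k i * (x $ i - of_int \<lfloor>x $ i\<rfloor>)\<bar> \<le> \<bar>k i\<bar>"
          by (simp add: abs_mult mult_left_le)
      qed
      finally show ?thesis using sumk \<delta>N(2) unfolding a_def by linarith
    qed
    let ?m = "modulation k"
    have [measurable]: "w \<in> borel_measurable borel" unfolding w_def by measurable
    have mf: "(\<lambda>y. ?m y * f y) \<in> Lp 2" using f by (intro L2_mult[where c = 1]) auto
    have wf: "(\<lambda>y. w y * f y) \<in> Lp 2" using f w by (intro L2_mult[where c = "sqrt a"]) auto
    note [measurable] = bounded_opers_measurable[OF S f] bounded_opers_measurable[OF S mf]
      bounded_opers_measurable[OF S wf] bounded_opers_measurable[OF S vf[OF f]]
    let ?A = "\<lambda>x. S f x - cnj (v h x) * S (\<lambda>y. v h y * f y) x"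
    let ?B = "\<lambda>x. cnj (w x) * S (\<lambda>y. v h y * f y) x"
    let ?C = "\<lambda>x. cnj (?m x) * S (\<lambda>y. w y * f y) x"
    have "AE x in lborel. S (\<lambda>y. v h y * f y - ?m y * f y) x = S (\<lambda>y. v h y * f y) x - S (\<lambda>y. ?m y * f y) x"
      by (intro bounded_opers_diff[OF S] vf f mf)
    then have AEw: "AE x in lborel. S (\<lambda>y. w y * f y) x = S (\<lambda>y. v h y * f y) x - S (\<lambda>y. ?m y * f y) x"
      by (simp add: w_def left_diff_distrib)
    have cw: "cnj (w x) = cnj (v h x) - cnj (?m x)" for x by (simp add: w_def)
    have "sqn (\<lambda>x. S f x - cnj (?m x) * S (\<lambda>y. ?m y * f y) x) = sqn (\<lambda>x. ?A x + (?B x + ?C x))"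
      using AEw by (intro sqn_cong_AE, eventually_elim) (simp only: cw, simp add: algebra_simps)
    also have "\<dots> \<le> 2 * sqn ?A + 2 * sqn (\<lambda>x. ?B x + ?C x)" by (intro sqn_add_le) measurable
    also have "\<dots> \<le> 2 * sqn ?A + 2 * (2 * sqn ?B + 2 * sqn ?C)"
    proof (intro add_left_mono mult_left_mono)
      show "sqn (\<lambda>x. ?B x + ?C x) \<le> 2 * sqn ?B + 2 * sqn ?C" by (intro sqn_add_le) measurable
    qed simp
    also have "\<dots> \<le> 2 * (ennreal (\<eta> / 4) * sqn f) + 2 * (2 * (ennreal (a * C) * sqn f) + 2 * (ennreal (a * C) * sqn f))"
    proof (intro add_mono mult_left_mono)
      show "sqn ?A \<le> ennreal (\<eta> / 4) * sqn f" by (intro small_v h f)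
      have "sqn ?B \<le> ennreal ((sqrt a)\<^sup>2) * sqn (S (\<lambda>y. v h y * f y))"
        using w by (intro sqn_mult_le) auto
      also have "\<dots> \<le> ennreal ((sqrt a)\<^sup>2) * (ennreal C * sqn f)"
      proof (intro mult_left_mono)
        have "sqn (S (\<lambda>y. v h y * f y)) \<le> ennreal C * sqn (\<lambda>y. v h y * f y)" by (intro C vf f)
        also have "\<dots> \<le> ennreal C * sqn f" by (intro mult_left_mono sqn_mult_le1) auto
        finally show "sqn (S (\<lambda>y. v h y * f y)) \<le> ennreal C * sqn f" .
      qed simp
      finally show "sqn ?B \<le> ennreal (a * C) * sqn f"
        using a C by (simp add: ennreal_mult mult.assoc)
      have "sqn ?C \<le> sqn (S (\<lambda>y. w y * f y))" by (intro sqn_mult_le1) simp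
      also have "\<dots> \<le> ennreal C * sqn (\<lambda>y. w y * f y)" by (intro C wf)
      also have "\<dots> \<le> ennreal C * (ennreal ((sqrt a)\<^sup>2) * sqn f)"
        using w L2_measurable[OF f] by (intro mult_left_mono sqn_mult_le) auto
      finally show "sqn ?C \<le> ennreal (a * C) * sqn f"
        using a C by (simp add: ennreal_mult mult_ac)
    qed auto
    also have "\<dots> = ennreal (2 * (\<eta> / 4) + 8 * (a * C)) * sqn f"
    proof -
      have "ennreal (2 * p + 8 * q) = 2 * ennreal p + 8 * ennreal q" if "p \<ge> 0" "q \<ge> 0" for p q
        using that by (simp add: ennreal_mult)
      from this[of "\<eta> / 4" "a * C"] have "ennreal (2 * (\<eta> / 4) + 8 * (a * C)) = 2 * ennreal (\<eta> / 4) + 8 * ennreal (a * C)"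
        using \<eta> a C by simp
      then show ?thesis by (simp only: distrib_right) (simp add: mult.assoc flip: distrib_right)
    qed
    also have "2 * (\<eta> / 4) + 8 * (a * C) = \<eta>" using C by (simp add: a_def)
    finally show ?thesis .
  qed
  moreover have "\<delta> < pi" using pi_gt3 by (simp add: \<delta>_def)
  ultimately show thesis using that \<delta> by blast
qed

text \<open>The sum of the compressions of S to all blocks, divided by the overlap number. At x only
  the blocks with corner cell x - j, j in the cube, contribute, so it can be written pointwise as a
  finite sum.\<close>

definition block_average :: "nat \<Rightarrow> (real ^ 'n::finite) oper \<Rightarrow> (real ^ 'n) oper" where
  "block_average R S f x =
    (\<Sum>j\<in>cube R. S (\<lambda>y. indicator (block R (\<lambda>i. cell x i - j i)) y * f y) x) / of_nat (R ^ CARD('n))"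

text \<open>Jensen's inequality for the square, from nonnegativity of a variance.\<close>

lemma weighted_cmod_sq_le:
  assumes "\<And>l. l \<in> I \<Longrightarrow> 0 \<le> w l" "(\<Sum>l\<in>I. w l) = 1"
  shows "(cmod (\<Sum>l\<in>I. of_real (w l) * z l))\<^sup>2 \<le> (\<Sum>l\<in>I. w l * (cmod (z l))\<^sup>2)"
proof -
  define a where "a = (\<Sum>l\<in>I. w l * cmod (z l))"
  have "cmod (\<Sum>l\<in>I. of_real (w l) * z l) \<le> a"
    unfolding a_def using assms(1) by (intro order_trans[OF norm_sum] sum_mono) (simp add: norm_mult)
  then have "(cmod (\<Sum>l\<in>I. of_real (w l) * z l))\<^sup>2 \<le> a\<^sup>2" by (intro power_mono) auto
  also have "a\<^sup>2 \<le> (\<Sum>l\<in>I. w l * (cmod (z l))\<^sup>2)"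
  proof -
    have "0 \<le> (\<Sum>l\<in>I. w l * (cmod (z l) - a)\<^sup>2)" using assms(1) by (intro sum_nonneg) auto
    also have "\<dots> = (\<Sum>l\<in>I. w l * (cmod (z l))\<^sup>2) - 2 * a * a + a\<^sup>2 * (\<Sum>l\<in>I. w l)"
      by (simp add: power2_diff algebra_simps sum.distrib sum_subtractf sum_distrib_left a_def flip: sum_distrib_right)
    finally show ?thesis using assms(2) by (simp add: power2_eq_square)
  qed
  finally show ?thesis .
qed

text \<open>R must not depend on L, because the exceptional set is fixed before L tends to infinity.
  Only the frequency grid grows with L, so that the Fourier identity stays exact on the box.\<close>

lemma block_average_approx:
  fixes S :: "(real ^ 'n) oper"
  assumes Cu: "class_Cu S" and \<eta>: "\<eta> > 0"
  obtains R where "R > 0"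
    "\<And>L f. \<lbrakk>f \<in> Lp 2; \<And>x. x \<notin> big_box L \<Longrightarrow> f x = 0\<rbrakk> \<Longrightarrow>
      sqn (\<lambda>x. indicator (big_box L) x * (S f x - block_average R S f x)) \<le> ennreal \<eta> * sqn f"
proof -
  have S: "S \<in> bounded_opers 2" using Cu by (simp add: class_Cu_def)
  obtain C where C: "\<And>f. f \<in> Lp 2 \<Longrightarrow> sqn (S f) \<le> ennreal C * sqn f" "C > 0"
    using bounded_opers_sqn_bound[OF S] by metis
  obtain \<delta> where \<delta>: "\<delta> > 0" "\<delta> < pi"
    "\<And>k f. \<lbrakk>\<And>i. \<bar>k i\<bar> < \<delta>; f \<in> Lp 2\<rbrakk> \<Longrightarrow>
      sqn (\<lambda>x. S f x - cnj (modulation k x) * S (\<lambda>y. modulation k y * f y) x) \<le> ennreal (\<eta> / 2) * sqn f"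
    using class_Cu_small_modulation[OF Cu, of "\<eta> / 2"] \<eta> by auto
  define c where "c = 1 - cos \<delta>"
  have c: "c > 0" using cos_monotone_0_pi[of 0 \<delta>] \<delta> by (simp add: c_def)
  define n where "n = real CARD('n)"
  \<comment> \<open>Makes the share of far frequencies, 4 C n / (c R), at most \<eta> / 2.\<close>
  obtain R :: nat where R: "real R > 4 * C * n / c / (\<eta> / 2)" using reals_Archimedean2 by blast
  have "4 * C * n / c / (\<eta> / 2) \<ge> 0" using C c \<eta> by (simp add: n_def)
  then have R0: "R > 0" using R by (cases R) auto
  have R\<eta>: "4 * C * n / c / real R \<le> \<eta> / 2"
  proof -
    have "4 * C * n / c < real R * (\<eta> / 2)" using R \<eta> by (simp only: pos_divide_less_eq half_gt_zero)
    then show ?thesis using R0 by (simp only: pos_divide_le_eq of_nat_0_less_iff) (simp add: mult.commute)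
  qed
  have "sqn (\<lambda>x. indicator (big_box L) x * (S f x - block_average R S f x)) \<le> ennreal \<eta> * sqn f"
    if f: "f \<in> Lp 2" and supp: "\<And>x. x \<notin> big_box L \<Longrightarrow> f x = 0" for L f
  proof -
    \<comment> \<open>Two cells of the box differ by at most 2 L in each coordinate, so L + R meets
      the no-aliasing condition of \<open>fejer_weight_fourier\<close>.\<close>
    define M where "M = L + R"
    define Z where "Z = PiE UNIV (\<lambda>_::'n. {- int L..int L})"
    have Z: "finite Z" by (auto simp: Z_def intro!: finite_PiE)
    have mem_Z: "m \<in> Z \<longleftrightarrow> (\<forall>i. \<bar>m i\<bar> \<le> int L)" for m
      by (auto simp: Z_def PiE_def Pi_def abs_le_iff minus_le_iff)
    \<comment> \<open>Pieces of f on single cells. Multiplying f by any function of the cell and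
      applying S then gives a combination of the finitely many \<open>S (F m)\<close>.\<close>
    define F where "F m y = indicator (cell -` {m}) y * f y" for m y
    have F_L2: "F m \<in> Lp 2" for m unfolding F_def by (intro L2_indicator f) simp
    have decomp: "(\<Sum>m\<in>Z. g m * F m y) = g (cell y) * f y" for g y
    proof (cases "y \<in> big_box L")
      case True
      then have "cell y \<in> Z" by (simp add: mem_Z big_box_def)
      then show ?thesis using Z
        by (subst sum.remove[of _ "cell y"]) (auto simp: F_def indicator_def intro!: sum.neutral)
    qed (simp add: F_def supp)
    have S_decomp: "AE x in lborel. S (\<lambda>y. g (cell y) * f y) x = (\<Sum>m\<in>Z. g m * S (F m) x)" for g
      using bounded_opers_sum[OF S Z, where c = g and f = F, OF F_L2] by (simp add: decomp)
    let ?u = "\<lambda>l. modulation (freq M l)"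
    let ?W = "fejer_weight M R :: ('n \<Rightarrow> int) \<Rightarrow> real"
    define h where "h l x = S f x - cnj (?u l x) * S (\<lambda>y. ?u l y * f y) x" for l x
    have uf: "(\<lambda>y. ?u l y * f y) \<in> Lp 2" for l using f by (intro L2_mult[where c = 1]) auto
    have [measurable]: "h l \<in> borel_measurable borel" for l
      unfolding h_def using bounded_opers_measurable[OF S f] bounded_opers_measurable[OF S uf] by measurable
    have Wsum: "(\<Sum>l\<in>freqs M. ?W l) = 1" using R0 by (intro fejer_weight_sum) (auto simp: M_def)
    \<comment> \<open>All corners at once, since the corners used by the block average vary with x;
      there are only countably many.\<close>
    have "AE x in lborel. \<forall>s. S (\<lambda>y. (if (\<lambda>i. cell y i - s i) \<in> cube R then 1 else 0) * f y) x
        = (\<Sum>m\<in>Z. (if (\<lambda>i. m i - s i) \<in> cube R then 1 else 0) * S (F m) x)"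
      unfolding AE_all_countable by (intro allI S_decomp)
    moreover have "AE x in lborel. \<forall>l\<in>freqs M. S (\<lambda>y. ?u l y * f y) x = (\<Sum>m\<in>Z. cis (dot (freq M l) m) * S (F m) x)"
      unfolding modulation_def by (intro AE_finite_allI S_decomp) simp
    ultimately have key: "AE x in lborel. x \<in> big_box L \<longrightarrow>
        S f x - block_average R S f x = (\<Sum>l\<in>freqs M. of_real (?W l) * h l x)"
    proof eventually_elim
      case (elim x)
      show ?case
      proof
        assume x: "x \<in> big_box L"
        define q where "q m = card {j \<in> cube R. (\<lambda>i. j i + (m i - cell x i)) \<in> cube R}" for m
        have ind: "indicator (block R s) y = (if (\<lambda>i. cell y i - s i) \<in> cube R then 1 else 0 :: complex)" for s y
          by (simp add: block_def indicator_def)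
        have "block_average R S f x = (\<Sum>j\<in>cube R. \<Sum>m\<in>Z.
            (if (\<lambda>i. m i - (cell x i - j i)) \<in> cube R then 1 else 0) * S (F m) x) / of_nat (R ^ CARD('n))"
          unfolding block_average_def ind using elim(1) by simp
        also have "\<dots> = (\<Sum>m\<in>Z. of_nat (q m) * S (F m) x) / of_nat (R ^ CARD('n))"
        proof -
          have "(\<Sum>j\<in>cube R. if (\<lambda>i. m i - (cell x i - j i)) \<in> cube R then 1 else 0) = complex_of_nat (q m)" for m
            by (simp add: sum.If_cases q_def Int_def algebra_simps)
          then show ?thesis by (subst sum.swap) (simp flip: sum_distrib_right)
        qed
        also have "\<dots> = (\<Sum>m\<in>Z. (of_nat (q m) / of_nat (R ^ CARD('n))) * S (F m) x)"
          by (simp add: sum_divide_distrib)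
        \<comment> \<open>The overlap fraction depends on m and x only through the difference of
          cells. Its Fourier expansion separates them, which produces conjugates of S by
          characters.\<close>
        also have "\<dots> = (\<Sum>m\<in>Z. (\<Sum>l\<in>freqs M. of_real (?W l) * cis (dot (freq M l) (\<lambda>i. m i - cell x i))) * S (F m) x)"
        proof (intro sum.cong refl arg_cong2[of _ _ _ _ "(*)"])
          fix m assume m: "m \<in> Z"
          have "\<bar>m i - cell x i\<bar> + int R \<le> 2 * int M + 1" for i
          proof -
            have "\<bar>m i\<bar> \<le> int L" "\<bar>cell x i\<bar> \<le> int L" using m x by (auto simp: mem_Z big_box_def)
            then show ?thesis by (simp add: M_def)
          qed
          then show "of_nat (q m) / of_nat (R ^ CARD('n))
            = (\<Sum>l\<in>freqs M. of_real (?W l) * cis (dot (freq M l) (\<lambda>i. m i - cell x i)))"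
            unfolding q_def using R0 by (intro fejer_weight_fourier[symmetric]) auto
        qed
        also have "\<dots> = (\<Sum>l\<in>freqs M. of_real (?W l) * (cnj (?u l x) * (\<Sum>m\<in>Z. cis (dot (freq M l) m) * S (F m) x)))"
        proof -
          have "cis (dot k (\<lambda>i. m i - cell x i)) = cnj (modulation k x) * cis (dot k m)" for k m
            by (simp add: modulation_def cis_cnj cis_mult dot_def sum_subtractf algebra_simps)
          then show ?thesis
            by (simp only: sum_distrib_right, subst sum.swap) (simp add: sum_distrib_left mult.assoc)
        qed
        also have "\<dots> = (\<Sum>l\<in>freqs M. of_real (?W l) * (S f x - h l x))"
          using elim(2) by (intro sum.cong refl) (simp add: h_def)
        also have "\<dots> = of_real (\<Sum>l\<in>freqs M. ?W l) * S f x - (\<Sum>l\<in>freqs M. of_real (?W l) * h l x)"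
          by (simp add: right_diff_distrib sum_subtractf sum_distrib_right)
        finally show "S f x - block_average R S f x = (\<Sum>l\<in>freqs M. of_real (?W l) * h l x)"
          by (simp add: Wsum)
      qed
    qed
    \<comment> \<open>An additive Chebyshev bound: if all frequencies are below \<delta> the first
      term suffices, otherwise one cosine gap is at least c and the second term exceeds 4 C. Being
      linear in the gaps, it can be averaged against the weights directly.\<close>
    define \<omega> where "\<omega> l = \<eta> / 2 + 4 * C / c * (\<Sum>i\<in>UNIV. 1 - cos (freq M l i))" for l :: "'n \<Rightarrow> int"
    have \<omega>0: "0 \<le> \<omega> l" for l using \<eta> C c by (simp add: \<omega>_def sum_nonneg)
    have h\<omega>: "sqn (h l) \<le> ennreal (\<omega> l) * sqn f" if l: "l \<in> freqs M" for l
    proof (cases "\<forall>i. \<bar>freq M l i\<bar> < \<delta>")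
      case True
      then have "sqn (h l) \<le> ennreal (\<eta> / 2) * sqn f" unfolding h_def by (intro \<delta>(3) f) auto
      also have "\<dots> \<le> ennreal (\<omega> l) * sqn f"
        using C c by (intro mult_right_mono ennreal_leI) (auto simp: \<omega>_def sum_nonneg)
      finally show ?thesis .
    next
      case False
      then obtain i where i: "\<delta> \<le> \<bar>freq M l i\<bar>" by (auto simp: not_less)
      have "\<bar>l i\<bar> \<le> int M" using l by (auto simp: freqs_def PiE_def Pi_def abs_le_iff minus_le_iff)
      then have "real_of_int \<bar>l i\<bar> \<le> real M" by linarith
      then have "2 * \<bar>real_of_int (l i)\<bar> \<le> 2 * real M + 1" by simp
      then have "pi * (2 * \<bar>real_of_int (l i)\<bar>) \<le> pi * (2 * real M + 1)" by (intro mult_left_mono) auto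
      then have "\<bar>freq M l i\<bar> \<le> pi"
        by (simp add: freq_def abs_mult pos_divide_le_eq algebra_simps)
      then have "cos \<bar>freq M l i\<bar> \<le> cos \<delta>" using i \<delta> by (intro cos_monotone_0_pi_le) auto
      then have "c \<le> 1 - cos (freq M l i)" by (simp add: c_def abs_if split: if_splits)
      also have "\<dots> \<le> (\<Sum>i\<in>UNIV. 1 - cos (freq M l i))" by (rule member_le_sum) auto
      finally have "4 * C / c * c \<le> 4 * C / c * (\<Sum>i\<in>UNIV. 1 - cos (freq M l i))"
        using C c by (intro mult_left_mono) auto
      then have le: "4 * C \<le> \<omega> l" using c \<eta> by (simp add: \<omega>_def)
      have "sqn (h l) \<le> ennreal (4 * C) * sqn f"
        unfolding h_def by (intro sqn_conj_unimodular_le[OF S C f]) auto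
      also have "\<dots> \<le> ennreal (\<omega> l) * sqn f" using le by (intro mult_right_mono ennreal_leI) auto
      finally show ?thesis .
    qed
    have W\<omega>: "(\<Sum>l\<in>freqs M. ?W l * \<omega> l) \<le> \<eta>"
    proof -
      have "(\<Sum>l\<in>freqs M. ?W l * \<omega> l)
          = \<eta> / 2 * (\<Sum>l\<in>freqs M. ?W l) + 4 * C / c * (\<Sum>i\<in>UNIV. \<Sum>l\<in>freqs M. ?W l * (1 - cos (freq M l i)))"
      proof -
        have sw: "(\<Sum>i\<in>(UNIV :: 'n set). \<Sum>l\<in>freqs M. ?W l * (1 - cos (freq M l i)))
            = (\<Sum>l\<in>freqs M. ?W l * (\<Sum>i\<in>UNIV. 1 - cos (freq M l i)))"
          by (subst sum.swap) (simp add: sum_distrib_left)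
        show ?thesis unfolding sw by (simp add: \<omega>_def distrib_left sum.distrib sum_distrib_left mult_ac)
      qed
      also have "\<dots> \<le> \<eta> / 2 * 1 + 4 * C / c * (\<Sum>i\<in>(UNIV :: 'n set). 1 / real R)"
        unfolding Wsum using C c R0
        by (intro add_left_mono mult_left_mono sum_mono fejer_weight_concentration) (auto simp: M_def)
      also have "\<dots> \<le> \<eta>" using R\<eta> by (simp add: n_def)
      finally show ?thesis .
    qed
    have "sqn (\<lambda>x. indicator (big_box L) x * (S f x - block_average R S f x))
        \<le> (\<integral>\<^sup>+x. (\<Sum>l\<in>freqs M. ennreal (?W l) * ennreal ((cmod (h l x))\<^sup>2)) \<partial>lborel)"
      unfolding sqn_def
    proof (intro nn_integral_mono_AE, use key in eventually_elim)
      fix x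
      assume x: "x \<in> big_box L \<longrightarrow> S f x - block_average R S f x = (\<Sum>l\<in>freqs M. of_real (?W l) * h l x)"
      have "(cmod (indicator (big_box L) x * (S f x - block_average R S f x)))\<^sup>2
          \<le> (\<Sum>l\<in>freqs M. ?W l * (cmod (h l x))\<^sup>2)"
        using x weighted_cmod_sq_le[of "freqs M" ?W "\<lambda>l. h l x"] Wsum
        by (auto simp: indicator_def fejer_weight_nonneg intro!: sum_nonneg)
      then show "ennreal ((cmod (indicator (big_box L) x * (S f x - block_average R S f x)))\<^sup>2)
          \<le> (\<Sum>l\<in>freqs M. ennreal (?W l) * ennreal ((cmod (h l x))\<^sup>2))"
        by (simp add: ennreal_leI fejer_weight_nonneg flip: ennreal_mult)
    qed
    also have "\<dots> = (\<Sum>l\<in>freqs M. ennreal (?W l) * sqn (h l))"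
      unfolding sqn_def by (subst nn_integral_sum, measurable) (simp add: nn_integral_cmult)
    also have "\<dots> \<le> (\<Sum>l\<in>freqs M. ennreal (?W l) * (ennreal (\<omega> l) * sqn f))"
      by (intro sum_mono mult_left_mono h\<omega>) auto
    also have "\<dots> = ennreal (\<Sum>l\<in>freqs M. ?W l * \<omega> l) * sqn f"
      by (simp add: sum_distrib_right mult.assoc fejer_weight_nonneg \<omega>0 ennreal_mult flip: sum_ennreal)
    also have "\<dots> \<le> ennreal \<eta> * sqn f" using W\<omega> by (intro mult_right_mono ennreal_leI) auto
    finally show ?thesis .
  qed
  then show thesis using that R0 by blast
qed

section \<open>Exceptional sets and the filter\<close>

text \<open>Sums over all corners are written as integrals over \<open>count_space\<close>, so that
  Tonelli can exchange them with Lebesgue integrals.\<close>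

lemma nn_integral_blocks:
  fixes x :: "real ^ 'n" and F :: "('n \<Rightarrow> int) \<Rightarrow> ennreal"
  shows "(\<integral>\<^sup>+s. indicator (block R s) x * F s \<partial>count_space UNIV) = (\<Sum>j\<in>cube R. F (\<lambda>i. cell x i - j i))"
proof -
  let ?A = "(\<lambda>j i. cell x i - j i) ` cube R"
  have "(\<integral>\<^sup>+s. indicator (block R s) x * F s \<partial>count_space UNIV) = (\<Sum>s\<in>?A. indicator (block R s) x * F s)"
  proof (rule nn_integral_count_space')
    fix s assume "s \<notin> ?A"
    have "(\<lambda>i. cell x i - s i) \<notin> cube R"
    proof
      assume "(\<lambda>i. cell x i - s i) \<in> cube R"
      then have "s \<in> ?A" by (intro image_eqI[of _ _ "\<lambda>i. cell x i - s i"]) auto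
      then show False using \<open>s \<notin> ?A\<close> by blast
    qed
    then show "indicator (block R s) x * F s = 0" by (simp add: block_def)
  qed auto
  also have "\<dots> = (\<Sum>j\<in>cube R. F (\<lambda>i. cell x i - j i))"
    by (rule sum.reindex_cong[of "\<lambda>j i. cell x i - j i"])
      (auto simp: inj_on_def fun_eq_iff block_def)
  finally show ?thesis .
qed

lemma nn_integral_block_overlap:
  "(\<integral>\<^sup>+s. indicator (block R s) x \<partial>count_space UNIV) = of_nat (R ^ CARD('n))"
  for x :: "real ^ 'n"
  using nn_integral_blocks[of R x "\<lambda>_. 1"] by (simp add: card_cube)

lemma block_diameter:
  fixes x y :: "real ^ 'n"
  assumes "x \<in> block R s" "y \<in> block R s"
  shows "dist x y \<le> real CARD('n) * (real R + 1)"
proof -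
  have "\<bar>(x - y) $ i\<bar> \<le> real R + 1" for i
  proof -
    have "0 \<le> cell x i - s i" "cell x i - s i < int R" "0 \<le> cell y i - s i" "cell y i - s i < int R"
      using assms by (auto simp: block_def mem_cube)
    then have "\<bar>cell x i - cell y i\<bar> \<le> int R" by linarith
    then have "real_of_int \<bar>cell x i - cell y i\<bar> \<le> real R" by linarith
    then show ?thesis unfolding cell_def by simp linarith
  qed
  then have "(\<Sum>i\<in>UNIV. \<bar>(x - y) $ i\<bar>) \<le> real CARD('n) * (real R + 1)"
    using sum_bounded_above[of UNIV "\<lambda>i. \<bar>(x - y) $ i\<bar>" "real R + 1"] by simp
  then show ?thesis using norm_le_l1_cart[of "x - y"] by (simp add: dist_norm)
qed

lemma emeasure_block_finite: "emeasure lborel (block R s) < \<infinity>"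
proof (cases "block R s = {}")
  case False
  then obtain x where "x \<in> block R s" by blast
  then have "bounded (block R s)"
    using block_diameter[of x R s] unfolding bounded_def by blast
  then show ?thesis by (rule emeasure_bounded_finite)
qed simp

text \<open>G is the union of the exceptional sets of the single blocks for D = block \<inter> N.
  Each point lies in R ^ n blocks, n the dimension: this factor enters K, but in the L^2 bound it
  cancels against the averaging factor, so nothing is lost in \<epsilon>.\<close>

lemma block_average_exceptional_set:
  fixes S :: "(real ^ 'n) oper"
  assumes S: "S \<in> bounded_opers 2" and ind: "induces_bounded p S" and p: "1 \<le> p" "p < 2"
    and \<epsilon>: "\<epsilon> > 0" and R: "R > 0"
  obtains K r where "K > 0"
    "\<And>N. N \<in> sets borel \<Longrightarrow> \<exists>G\<in>sets borel.
       (\<forall>a. emeasure lborel (G \<inter> ball a 1) \<le> ennreal K * emeasure lborel (N \<inter> ball a r)) \<and>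
       (\<forall>g\<in>Lp 2. (\<forall>x. x \<notin> N \<longrightarrow> g x = 0) \<longrightarrow>
         sqn (\<lambda>x. indicator (- G) x * block_average R S g x) \<le> ennreal \<epsilon> * sqn g)"
proof -
  obtain \<kappa> where \<kappa>: "\<kappa> > 0"
    "\<And>C D. \<lbrakk>C \<in> sets borel; emeasure lborel C < \<infinity>; D \<in> sets borel; emeasure lborel D < \<infinity>\<rbrakk> \<Longrightarrow>
      \<exists>G\<in>sets borel. G \<subseteq> C \<and> emeasure lborel G \<le> ennreal \<kappa> * emeasure lborel D \<and>
        (\<forall>f\<in>Lp 2. sqn (\<lambda>x. indicator (C - G) x * S (\<lambda>y. indicator D y * f y) x) \<le> ennreal \<epsilon> * sqn f)"
    by (rule local_exceptional_set[OF S ind p \<epsilon>]) blast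
  define P where "P = R ^ CARD('n)"
  have P: "P > 0" using R by (simp add: P_def)
  \<comment> \<open>Block diameter plus 1: a block meeting \<open>ball a 1\<close> lies in
    \<open>ball a r\<close>.\<close>
  define r where "r = real CARD('n) * (real R + 1) + 1"
  have "\<exists>G\<in>sets borel.
       (\<forall>a. emeasure lborel (G \<inter> ball a 1) \<le> ennreal (\<kappa> * P) * emeasure lborel (N \<inter> ball a r)) \<and>
       (\<forall>g\<in>Lp 2. (\<forall>x. x \<notin> N \<longrightarrow> g x = 0) \<longrightarrow>
         sqn (\<lambda>x. indicator (- G) x * block_average R S g x) \<le> ennreal \<epsilon> * sqn g)"
    if N[measurable]: "N \<in> sets borel" for N
  proof -
    define Q where "Q s G \<longleftrightarrow> G \<subseteq> block R s \<and> emeasure lborel G \<le> ennreal \<kappa> * emeasure lborel (block R s \<inter> N) \<and>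
        (\<forall>f\<in>Lp 2. sqn (\<lambda>x. indicator (block R s - G) x * S (\<lambda>y. indicator (block R s \<inter> N) y * f y) x) \<le> ennreal \<epsilon> * sqn f)" for s G
    have "\<exists>G\<in>sets borel. Q s G" for s
      unfolding Q_def
    proof (rule \<kappa>(2))
      show "emeasure lborel (block R s \<inter> N) < \<infinity>"
        by (rule le_less_trans[OF emeasure_mono emeasure_block_finite[of R s]]) auto
    qed (rule block_sets emeasure_block_finite sets.Int N)+
    then obtain G where G[measurable]: "\<And>s. G s \<in> sets borel" and "\<And>s. Q s (G s)"
      by metis
    then have Gsub: "\<And>s. G s \<subseteq> block R s"
      and Gm: "\<And>s. emeasure lborel (G s) \<le> ennreal \<kappa> * emeasure lborel (block R s \<inter> N)"
      and Gf: "\<And>s f. f \<in> Lp 2 \<Longrightarrow> sqn (\<lambda>x. indicator (block R s - G s) x * S (\<lambda>y. indicator (block R s \<inter> N) y * f y) x) \<le> ennreal \<epsilon> * sqn f"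
      unfolding Q_def by blast+
    define E where "E = (\<Union>s. G s)"
    have E[measurable]: "E \<in> sets borel" unfolding E_def by (intro sets.countable_UN'') auto
    have m1: "emeasure lborel (E \<inter> ball a 1) \<le> ennreal (\<kappa> * P) * emeasure lborel (N \<inter> ball a r)" for a
    proof -
      have "emeasure lborel (E \<inter> ball a 1) = (\<integral>\<^sup>+x. indicator (E \<inter> ball a 1) x \<partial>lborel)" by simp
      also have "\<dots> \<le> (\<integral>\<^sup>+x. (\<integral>\<^sup>+s. indicator (G s \<inter> ball a 1) x \<partial>count_space UNIV) \<partial>lborel)"
      proof (intro nn_integral_mono)
        fix x
        show "indicator (E \<inter> ball a 1) x \<le> (\<integral>\<^sup>+s. indicator (G s \<inter> ball a 1) x \<partial>count_space UNIV)"
        proof (cases "x \<in> E \<inter> ball a 1")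
          case True
          then obtain s0 where "x \<in> G s0 \<inter> ball a 1" by (auto simp: E_def)
          then have "(\<integral>\<^sup>+s. indicator {s0} s \<partial>count_space UNIV) \<le> (\<integral>\<^sup>+s. indicator (G s \<inter> ball a 1) x \<partial>count_space UNIV)"
            by (intro nn_integral_mono) (auto simp: indicator_def)
          then show ?thesis using True by simp
        qed simp
      qed
      also have "\<dots> = (\<integral>\<^sup>+s. (\<integral>\<^sup>+x. indicator (G s \<inter> ball a 1) x \<partial>lborel) \<partial>count_space UNIV)"
        by (intro nn_integral_count_space_nn_integral borel_measurable_indicator) simp_all
      also have "\<dots> = (\<integral>\<^sup>+s. emeasure lborel (G s \<inter> ball a 1) \<partial>count_space UNIV)"
        by (intro nn_integral_cong nn_integral_indicator) simp
      also have "\<dots> \<le> (\<integral>\<^sup>+s. ennreal \<kappa> * (\<integral>\<^sup>+x. indicator (block R s) x * indicator (N \<inter> ball a r) x \<partial>lborel) \<partial>count_space UNIV)"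
      proof (intro nn_integral_mono)
        fix s
        show "emeasure lborel (G s \<inter> ball a 1) \<le> ennreal \<kappa> * (\<integral>\<^sup>+x. indicator (block R s) x * indicator (N \<inter> ball a r) x \<partial>lborel)"
        proof (cases "G s \<inter> ball a 1 = {}")
          case False
          then obtain z where "z \<in> G s" and z2: "dist a z < 1" by auto
          then have z: "z \<in> block R s" using Gsub by blast
          have "x \<in> ball a r" if "x \<in> block R s" for x
            using block_diameter[OF z that] z2 dist_triangle[of a x z] by (simp add: r_def)
          then have sub: "block R s \<inter> N \<subseteq> block R s \<inter> (N \<inter> ball a r)" by auto
          have "emeasure lborel (G s \<inter> ball a 1) \<le> emeasure lborel (G s)" by (intro emeasure_mono) auto
          also have "\<dots> \<le> ennreal \<kappa> * emeasure lborel (block R s \<inter> N)" by (rule Gm)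
          also have "\<dots> \<le> ennreal \<kappa> * emeasure lborel (block R s \<inter> (N \<inter> ball a r))"
            using sub by (intro mult_left_mono emeasure_mono) auto
          also have "emeasure lborel (block R s \<inter> (N \<inter> ball a r)) = (\<integral>\<^sup>+x. indicator (block R s \<inter> (N \<inter> ball a r)) x \<partial>lborel)"
            by simp
          finally show ?thesis by (simp only: indicator_inter_arith)
        qed simp
      qed
      also have "\<dots> = ennreal \<kappa> * (\<integral>\<^sup>+s. (\<integral>\<^sup>+x. indicator (block R s) x * indicator (N \<inter> ball a r) x \<partial>lborel) \<partial>count_space UNIV)"
        by (rule nn_integral_cmult) simp
      also have "(\<integral>\<^sup>+s. (\<integral>\<^sup>+x. indicator (block R s) x * indicator (N \<inter> ball a r) x \<partial>lborel) \<partial>count_space UNIV)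
          = (\<integral>\<^sup>+x. (\<integral>\<^sup>+s. indicator (block R s) x * indicator (N \<inter> ball a r) x \<partial>count_space UNIV) \<partial>lborel)"
        by (intro nn_integral_count_space_nn_integral[symmetric] borel_measurable_times_ennreal borel_measurable_indicator) simp_all
      also have "\<dots> = (\<integral>\<^sup>+x. of_nat P * indicator (N \<inter> ball a r) x \<partial>lborel)"
        by (simp add: nn_integral_multc nn_integral_block_overlap P_def)
      also have "\<dots> = of_nat P * emeasure lborel (N \<inter> ball a r)"
        by (rule nn_integral_cmult_indicator) simp
      finally show ?thesis using \<kappa>(1) by (simp add: ennreal_mult mult.assoc ennreal_of_nat_eq_real_of_nat)
    qed
    have m2: "sqn (\<lambda>x. indicator (- E) x * block_average R S g x) \<le> ennreal \<epsilon> * sqn g"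
      if g: "g \<in> Lp 2" and supp: "\<forall>x. x \<notin> N \<longrightarrow> g x = 0" for g
    proof -
      define gb where "gb s y = indicator (block R s) y * g y" for s y
      have gb: "gb s \<in> Lp 2" for s unfolding gb_def by (intro L2_indicator g) simp
      define H where "H s = S (gb s)" for s
      have [measurable]: "H s \<in> borel_measurable borel" for s
        unfolding H_def by (intro bounded_opers_measurable[OF S] gb)
      note [measurable] = L2_measurable[OF g]
      have gbN: "(\<lambda>y. indicator (block R s \<inter> N) y * gb s y) = gb s" for s
        using supp by (auto simp: gb_def indicator_def fun_eq_iff)
      define c where "c = 1 / real P"
      have c: "c > 0" using P by (simp add: c_def)
      have avg: "block_average R S g x = (\<Sum>j\<in>cube R. of_real c * H (\<lambda>i. cell x i - j i) x)" for x
        by (simp add: block_average_def H_def gb_def[abs_def] c_def P_def sum_divide_distrib)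
      have "sqn (\<lambda>x. indicator (- E) x * block_average R S g x)
        \<le> (\<integral>\<^sup>+x. (\<integral>\<^sup>+s. indicator (block R s) x * (ennreal c * (indicator (- E) x * ennreal ((cmod (H s x))\<^sup>2))) \<partial>count_space UNIV) \<partial>lborel)"
        unfolding sqn_def
      proof (intro nn_integral_mono)
        fix x
        \<comment> \<open>Jensen with equal weights c on the blocks containing x, so that each block
          can be estimated separately off its own exceptional set.\<close>
        have "(cmod (block_average R S g x))\<^sup>2 \<le> (\<Sum>j\<in>cube R. c * (cmod (H (\<lambda>i. cell x i - j i) x))\<^sup>2)"
          unfolding avg using R by (intro weighted_cmod_sq_le) (auto simp: c_def card_cube P_def)
        then have "ennreal ((cmod (block_average R S g x))\<^sup>2)
            \<le> ennreal c * (\<Sum>j\<in>cube R. ennreal ((cmod (H (\<lambda>i. cell x i - j i) x))\<^sup>2))"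
          using c by (simp add: ennreal_leI sum_nonneg sum_distrib_left flip: ennreal_mult)
        then show "ennreal ((cmod (indicator (- E) x * block_average R S g x))\<^sup>2)
          \<le> (\<integral>\<^sup>+s. indicator (block R s) x * (ennreal c * (indicator (- E) x * ennreal ((cmod (H s x))\<^sup>2))) \<partial>count_space UNIV)"
          unfolding nn_integral_blocks by (simp add: indicator_def flip: sum_distrib_left)
      qed
      also have "\<dots> = (\<integral>\<^sup>+s. (\<integral>\<^sup>+x. indicator (block R s) x * (ennreal c * (indicator (- E) x * ennreal ((cmod (H s x))\<^sup>2))) \<partial>lborel) \<partial>count_space UNIV)"
        by (intro nn_integral_count_space_nn_integral) (simp, measurable)
      also have "\<dots> \<le> (\<integral>\<^sup>+s. (ennreal c * ennreal \<epsilon>) * (\<integral>\<^sup>+x. indicator (block R s) x * ennreal ((cmod (g x))\<^sup>2) \<partial>lborel) \<partial>count_space UNIV)"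
      proof (intro nn_integral_mono)
        fix s
        have "(\<integral>\<^sup>+x. indicator (block R s) x * (ennreal c * (indicator (- E) x * ennreal ((cmod (H s x))\<^sup>2))) \<partial>lborel)
          \<le> (\<integral>\<^sup>+x. ennreal c * ennreal ((cmod (indicator (block R s - G s) x * H s x))\<^sup>2) \<partial>lborel)"
          by (intro nn_integral_mono) (auto simp: indicator_def E_def)
        also have "\<dots> = ennreal c * sqn (\<lambda>x. indicator (block R s - G s) x * H s x)"
          unfolding sqn_def by (rule nn_integral_cmult) measurable
        also have "\<dots> \<le> ennreal c * (ennreal \<epsilon> * sqn (gb s))"
          using Gf[OF gb, of s s] by (intro mult_left_mono) (simp_all add: gbN H_def)
        also have "sqn (gb s) = (\<integral>\<^sup>+x. indicator (block R s) x * ennreal ((cmod (g x))\<^sup>2) \<partial>lborel)"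
          unfolding sqn_def gb_def by (intro nn_integral_cong) (auto simp: indicator_def)
        finally show "(\<integral>\<^sup>+x. indicator (block R s) x * (ennreal c * (indicator (- E) x * ennreal ((cmod (H s x))\<^sup>2))) \<partial>lborel)
          \<le> (ennreal c * ennreal \<epsilon>) * (\<integral>\<^sup>+x. indicator (block R s) x * ennreal ((cmod (g x))\<^sup>2) \<partial>lborel)"
          by (simp add: mult.assoc)
      qed
      also have "\<dots> = (ennreal c * ennreal \<epsilon>) * (\<integral>\<^sup>+s. (\<integral>\<^sup>+x. indicator (block R s) x * ennreal ((cmod (g x))\<^sup>2) \<partial>lborel) \<partial>count_space UNIV)"
        by (rule nn_integral_cmult) simp
      also have "(\<integral>\<^sup>+s. (\<integral>\<^sup>+x. indicator (block R s) x * ennreal ((cmod (g x))\<^sup>2) \<partial>lborel) \<partial>count_space UNIV)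
          = (\<integral>\<^sup>+x. (\<integral>\<^sup>+s. indicator (block R s) x * ennreal ((cmod (g x))\<^sup>2) \<partial>count_space UNIV) \<partial>lborel)"
        by (intro nn_integral_count_space_nn_integral[symmetric]) (simp, measurable)
      also have "\<dots> = (\<integral>\<^sup>+x. of_nat P * ennreal ((cmod (g x))\<^sup>2) \<partial>lborel)"
        by (simp add: nn_integral_multc nn_integral_block_overlap P_def)
      also have "\<dots> = of_nat P * sqn g"
        unfolding sqn_def by (rule nn_integral_cmult) measurable
      also have "ennreal c * ennreal \<epsilon> * (of_nat P * sqn g) = ennreal (c * real P) * (ennreal \<epsilon> * sqn g)"
        using c by (simp add: ennreal_mult mult_ac ennreal_of_nat_eq_real_of_nat)
      also have "c * real P = 1" using P by (simp add: c_def)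
      finally show ?thesis by simp
    qed
    show ?thesis by (intro bexI[OF _ E] conjI allI[OF m1] ballI impI m2)
  qed
  then show thesis using \<kappa>(1) P by (intro that[of "\<kappa> * P" r]) (simp, blast)
qed

section \<open>Membership in \<open>N_sets\<close>\<close>

lemma N_sets_iff:
  fixes N :: "'a::euclidean_space set"
  assumes N: "N \<in> sets borel" and \<nu>: "\<And>a. 0 < \<nu> a"
  shows "N \<in> N_sets \<nu> \<longleftrightarrow>
    (\<exists>K. eventually (\<lambda>a. emeasure lborel (N \<inter> ball a 1) \<le> ennreal (K * \<nu> a)) at_infinity)"
proof -
  have om: "outer_measure_of lebesgue (N \<inter> ball a 1) = emeasure lborel (N \<inter> ball a 1)" for a
    using N by (subst outer_measure_of_eq) auto
  have div: "A / ennreal (\<nu> a) \<le> ennreal K \<longleftrightarrow> A \<le> ennreal (K * \<nu> a)" if "K \<ge> 0" for A K a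
  proof -
    have v: "ennreal (\<nu> a) \<noteq> 0" "ennreal (\<nu> a) \<noteq> top" using \<nu>[of a] by (auto simp: ennreal_eq_0_iff)
    have 1: "A / ennreal (\<nu> a) * ennreal (\<nu> a) = A"
      using v by (simp add: ennreal_divide_times)
    have 2: "ennreal K * ennreal (\<nu> a) / ennreal (\<nu> a) = ennreal K"
      using v by (simp add: ennreal_mult_divide_eq)
    have 3: "ennreal (K * \<nu> a) = ennreal K * ennreal (\<nu> a)"
      using \<nu>[of a] that by (simp add: ennreal_mult)
    show ?thesis
    proof
      assume "A / ennreal (\<nu> a) \<le> ennreal K"
      then have "A / ennreal (\<nu> a) * ennreal (\<nu> a) \<le> ennreal K * ennreal (\<nu> a)"
        by (rule mult_right_mono) simp
      then show "A \<le> ennreal (K * \<nu> a)" by (simp only: 1 3)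
    next
      assume "A \<le> ennreal (K * \<nu> a)"
      then have "A / ennreal (\<nu> a) \<le> ennreal K * ennreal (\<nu> a) / ennreal (\<nu> a)"
        unfolding 3 by (rule divide_right_mono_ennreal)
      then show "A / ennreal (\<nu> a) \<le> ennreal K" by (simp only: 2)
    qed
  qed
  show ?thesis
  proof
    assume "N \<in> N_sets \<nu>"
    then have lim: "Limsup at_infinity (\<lambda>a. emeasure lborel (N \<inter> ball a 1) / ennreal (\<nu> a)) < \<infinity>"
      by (simp add: N_sets_def om)
    then obtain c where c: "Limsup at_infinity (\<lambda>a. emeasure lborel (N \<inter> ball a 1) / ennreal (\<nu> a)) < c" "c < \<infinity>"
      using dense by blast
    then obtain K where K: "c = ennreal K" "K \<ge> 0" by (cases c) auto
    have "eventually (\<lambda>a. emeasure lborel (N \<inter> ball a 1) / ennreal (\<nu> a) < c) at_infinity"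
      using c(1) by (rule Limsup_lessD)
    then have "eventually (\<lambda>a. emeasure lborel (N \<inter> ball a 1) \<le> ennreal (K * \<nu> a)) at_infinity"
      by eventually_elim (use div[OF K(2)] K(1) in \<open>auto intro: less_imp_le\<close>)
    then show "\<exists>K. eventually (\<lambda>a. emeasure lborel (N \<inter> ball a 1) \<le> ennreal (K * \<nu> a)) at_infinity" by blast
  next
    assume "\<exists>K. eventually (\<lambda>a. emeasure lborel (N \<inter> ball a 1) \<le> ennreal (K * \<nu> a)) at_infinity"
    then obtain K where K: "eventually (\<lambda>a. emeasure lborel (N \<inter> ball a 1) \<le> ennreal (K * \<nu> a)) at_infinity"
      by blast
    have "eventually (\<lambda>a. emeasure lborel (N \<inter> ball a 1) / ennreal (\<nu> a) \<le> ennreal (max K 0)) at_infinity"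
      using K
    proof eventually_elim
      case (elim a)
      have "ennreal (K * \<nu> a) \<le> ennreal (max K 0 * \<nu> a)"
        using \<nu>[of a] by (intro ennreal_leI mult_right_mono) auto
      with elim show ?case by (subst div) (auto intro: order_trans)
    qed
    then have "Limsup at_infinity (\<lambda>a. emeasure lborel (N \<inter> ball a 1) / ennreal (\<nu> a)) \<le> ennreal (max K 0)"
      by (rule Limsup_bounded)
    also have "\<dots> < \<infinity>" by simp
    finally show "N \<in> N_sets \<nu>" by (simp add: N_sets_def om)
  qed
qed

lemma N_sets_mono: "A \<subseteq> B \<Longrightarrow> B \<in> N_sets \<nu> \<Longrightarrow> A \<in> N_sets \<nu>"
  unfolding N_sets_def mem_Collect_eq
  by (rule le_less_trans[OF Limsup_mono])
    (auto intro!: always_eventually divide_right_mono_ennreal outer_measure_of_mono)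

text \<open>Finitely many translates of the unit ball cover a ball of radius r, and the bounded
  ratios of \<nu> express the bound at each shifted centre a + z through \<nu> a.\<close>

lemma N_sets_large_ball:
  fixes N :: "'a::euclidean_space set"
  assumes N: "N \<in> sets borel" "N \<in> N_sets \<nu>" and \<nu>: "\<And>a. 0 < \<nu> a"
    and ratio: "\<And>r::real. bdd_above {\<nu> b / \<nu> a | a b. norm (b - a) \<le> r}"
  shows "\<exists>K. eventually (\<lambda>a. emeasure lborel (N \<inter> ball a r) \<le> ennreal (K * \<nu> a)) at_infinity"
proof -
  obtain K where K: "eventually (\<lambda>a. emeasure lborel (N \<inter> ball a 1) \<le> ennreal (K * \<nu> a)) at_infinity"
    using N N_sets_iff[OF N(1), of \<nu>, OF \<nu>] by blast
  define K' where "K' = max K 0"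
  obtain Z where Z: "finite Z" "cball (0::'a) r \<subseteq> (\<Union>z\<in>Z. ball z 1)"
    using compact_cball[of "0::'a" r, unfolded compact_eq_totally_bounded, THEN conjunct2, rule_format, of 1]
    by auto
  have "\<exists>c. \<forall>a. \<nu> (a + z) \<le> c * \<nu> a" for z
  proof -
    obtain c where c: "\<And>x. x \<in> {\<nu> b / \<nu> a | a b. norm (b - a) \<le> norm z} \<Longrightarrow> x \<le> c"
      using ratio[of "norm z"] by (auto simp: bdd_above_def)
    have "\<nu> (a + z) / \<nu> a \<le> c" for a by (rule c) force
    then show ?thesis using \<nu> by (intro exI[of _ c]) (simp add: pos_divide_le_eq)
  qed
  then obtain c where c: "\<And>z a. \<nu> (a + z) \<le> c z * \<nu> a" by metis
  have "eventually (\<lambda>a. emeasure lborel (N \<inter> ball (a + z) 1) \<le> ennreal (K' * c z * \<nu> a)) at_infinity" for z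
  proof -
    obtain b where b: "\<And>a. norm a \<ge> b \<Longrightarrow> emeasure lborel (N \<inter> ball a 1) \<le> ennreal (K * \<nu> a)"
      using K by (auto simp: eventually_at_infinity)
    have "emeasure lborel (N \<inter> ball (a + z) 1) \<le> ennreal (K' * c z * \<nu> a)" if "norm a \<ge> b + norm z" for a
    proof -
      have "norm (a + z) \<ge> b" using that norm_triangle_ineq[of "a + z" "- z"] by simp
      then have "emeasure lborel (N \<inter> ball (a + z) 1) \<le> ennreal (K * \<nu> (a + z))" by (rule b)
      also have "K * \<nu> (a + z) \<le> K' * \<nu> (a + z)"
        using \<nu>[of "a + z"] by (intro mult_right_mono) (auto simp: K'_def)
      also have "\<dots> \<le> K' * (c z * \<nu> a)" using c by (intro mult_left_mono) (auto simp: K'_def)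
      finally show ?thesis by (simp add: ennreal_leI mult.assoc)
    qed
    then show ?thesis unfolding eventually_at_infinity by blast
  qed
  then have "eventually (\<lambda>a. \<forall>z\<in>Z. emeasure lborel (N \<inter> ball (a + z) 1) \<le> ennreal (K' * c z * \<nu> a)) at_infinity"
    using Z(1) by (intro eventually_ball_finite) auto
  then have "eventually (\<lambda>a. emeasure lborel (N \<inter> ball a r) \<le> ennreal ((\<Sum>z\<in>Z. K' * c z) * \<nu> a)) at_infinity"
  proof eventually_elim
    case (elim a)
    have cpos: "0 \<le> c z" for z
    proof -
      have "0 < c z * \<nu> a" using c[of a z] \<nu>[of "a + z"] by linarith
      then show ?thesis using \<nu>[of a] by (simp add: zero_less_mult_iff)
    qed
    have "N \<inter> ball a r \<subseteq> (\<Union>z\<in>Z. N \<inter> ball (a + z) 1)"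
    proof
      fix x assume x: "x \<in> N \<inter> ball a r"
      then have "x - a \<in> cball 0 r" by (simp add: dist_norm norm_minus_commute)
      then obtain z where "z \<in> Z" "dist z (x - a) < 1" using Z(2) by auto
      moreover have "dist (a + z) x = dist z (x - a)" by (simp add: dist_norm algebra_simps)
      ultimately have "x \<in> ball (a + z) 1" by simp
      then show "x \<in> (\<Union>z\<in>Z. N \<inter> ball (a + z) 1)" using x \<open>z \<in> Z\<close> by blast
    qed
    then have "emeasure lborel (N \<inter> ball a r) \<le> emeasure lborel (\<Union>z\<in>Z. N \<inter> ball (a + z) 1)"
    proof (rule emeasure_mono)
      have "(\<Union>z\<in>Z. N \<inter> ball (a + z) 1) \<in> sets borel"
        using N Z by (intro sets.finite_UN) auto
      then show "(\<Union>z\<in>Z. N \<inter> ball (a + z) 1) \<in> sets lborel" by simp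
    qed
    also have "\<dots> \<le> (\<Sum>z\<in>Z. emeasure lborel (N \<inter> ball (a + z) 1))"
      using N Z by (intro emeasure_subadditive_finite) auto
    also have "\<dots> \<le> (\<Sum>z\<in>Z. ennreal (K' * c z * \<nu> a))" using elim by (intro sum_mono) auto
    also have "\<dots> = ennreal ((\<Sum>z\<in>Z. K' * c z) * \<nu> a)"
      using \<nu>[of a] cpos by (simp add: sum_distrib_right K'_def)
    finally show ?case .
  qed
  then show ?thesis by blast
qed

lemma sqn_big_box_tendsto:
  fixes f :: "real ^ 'n \<Rightarrow> complex"
  assumes [measurable]: "f \<in> borel_measurable borel"
  shows "(\<lambda>L. sqn (\<lambda>x. indicator (big_box L) x * f x)) \<longlonglongrightarrow> sqn f"
    and "sqn f < \<infinity> \<Longrightarrow> (\<lambda>L. sqn (\<lambda>x. indicator (- big_box L) x * f x)) \<longlonglongrightarrow> 0"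
proof -
  have ev: "eventually (\<lambda>L. x \<in> big_box L) sequentially" for x :: "real ^ 'n"
  proof -
    define m where "m = nat (\<Sum>i\<in>UNIV. \<bar>cell x i\<bar>)"
    have "\<bar>cell x i\<bar> \<le> int m" for i
      using member_le_sum[of i UNIV "\<lambda>i. \<bar>cell x i\<bar>"] by (simp add: m_def sum_nonneg)
    then have "x \<in> big_box L" if "L \<ge> m" for L
    proof -
      have "int m \<le> int L" using that by simp
      then show ?thesis unfolding big_box_def using \<open>\<And>i. \<bar>cell x i\<bar> \<le> int m\<close> order_trans by blast
    qed
    then show ?thesis unfolding eventually_sequentially by blast
  qed
  have mono: "incseq (\<lambda>L x. ennreal ((cmod (indicator (big_box L) x * f x))\<^sup>2))"
  proof (intro incseq_SucI le_funI)
    fix L x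
    have "big_box L \<subseteq> (big_box (Suc L) :: (real ^ 'n) set)"
      unfolding big_box_def by (auto intro: order_trans)
    then show "ennreal ((cmod (indicator (big_box L) x * f x))\<^sup>2) \<le> ennreal ((cmod (indicator (big_box (Suc L)) x * f x))\<^sup>2)"
      by (auto simp: indicator_def)
  qed
  have "(\<lambda>L. ennreal ((cmod (indicator (big_box L) x * f x))\<^sup>2)) \<longlonglongrightarrow> ennreal ((cmod (f x))\<^sup>2)" for x
    using ev[of x] by (intro tendsto_eventually) (auto elim!: eventually_mono)
  then show "(\<lambda>L. sqn (\<lambda>x. indicator (big_box L) x * f x)) \<longlonglongrightarrow> sqn f"
    unfolding sqn_def using mono by (intro nn_integral_LIMSEQ) auto
  assume fin: "sqn f < \<infinity>"
  have "(\<lambda>L. sqn (\<lambda>x. indicator (- big_box L) x * f x)) \<longlonglongrightarrow> (\<integral>\<^sup>+x. 0 \<partial>(lborel :: (real ^ 'n) measure))"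
    unfolding sqn_def
  proof (rule nn_integral_dominated_convergence[where w = "\<lambda>x. ennreal ((cmod (f x))\<^sup>2)"])
    show "(\<integral>\<^sup>+x. ennreal ((cmod (f x))\<^sup>2) \<partial>lborel) < \<infinity>" using fin by (simp add: sqn_def)
    show "AE x in lborel. (\<lambda>L. ennreal ((cmod (indicator (- big_box L) x * f x))\<^sup>2)) \<longlonglongrightarrow> 0"
    proof (rule AE_I2, rule tendsto_eventually)
      fix x
      show "\<forall>\<^sub>F L in sequentially. ennreal ((cmod (indicator (- big_box L) x * f x))\<^sup>2) = 0"
        using ev[of x] by eventually_elim (simp add: indicator_def)
    qed
    show "AE x in lborel. ennreal ((cmod (indicator (- big_box L) x * f x))\<^sup>2) \<le> ennreal ((cmod (f x))\<^sup>2)" for L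
      by (rule AE_I2) (simp add: indicator_def)
  qed measurable
  then show "(\<lambda>L. sqn (\<lambda>x. indicator (- big_box L) x * f x)) \<longlonglongrightarrow> 0" by simp
qed

text \<open>The block average is close to S only on boxes and for functions supported there. As the
  exceptional set does not depend on the box, g can be cut to \<open>big_box L\<close>, the tail
  left to boundedness of S, and L sent to infinity.\<close>

lemma exceptional_set_for_small_set:
  fixes S :: "(real ^ 'n) oper" and \<nu> :: "real ^ 'n \<Rightarrow> real"
  assumes \<nu>: "\<And>a. 0 < \<nu> a"
    and ratio: "\<And>r::real. bdd_above {\<nu> b / \<nu> a | a b. norm (b - a) \<le> r}"
    and Cu: "class_Cu S" and ind: "induces_bounded p S" and p: "1 \<le> p" "p < 2"
    and N: "N \<in> sets borel" "N \<in> N_sets \<nu>" and \<epsilon>: "\<epsilon> > 0"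
  shows "\<exists>G\<in>sets borel. G \<in> N_sets \<nu> \<and> (\<forall>g\<in>Lp 2. (\<forall>x. x \<notin> N \<longrightarrow> g x = 0) \<longrightarrow>
      sqn (\<lambda>x. indicator (- G) x * S g x) \<le> ennreal \<epsilon> * sqn g)"
proof -
  have S: "S \<in> bounded_opers 2" using Cu by (simp add: class_Cu_def)
  obtain C where C: "\<And>f. f \<in> Lp 2 \<Longrightarrow> sqn (S f) \<le> ennreal C * sqn f" "C > 0"
    using bounded_opers_sqn_bound[OF S] by metis
  \<comment> \<open>\<open>sqn_add_le\<close> is used twice on the main part, at the cost 2 (2 e + 2
    e) = 8 e.\<close>
  define e where "e = \<epsilon> / 8"
  have e: "e > 0" using \<epsilon> by (simp add: e_def)
  obtain R where R: "R > 0"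
    "\<And>L f. \<lbrakk>f \<in> Lp 2; \<And>x. x \<notin> big_box L \<Longrightarrow> f x = 0\<rbrakk> \<Longrightarrow>
      sqn (\<lambda>x. indicator (big_box L) x * (S f x - block_average R S f x)) \<le> ennreal e * sqn f"
    by (rule block_average_approx[OF Cu e]) blast
  obtain K r where K: "K > 0"
    "\<And>N. N \<in> sets borel \<Longrightarrow> \<exists>G\<in>sets borel.
       (\<forall>a. emeasure lborel (G \<inter> ball a 1) \<le> ennreal K * emeasure lborel (N \<inter> ball a r)) \<and>
       (\<forall>g\<in>Lp 2. (\<forall>x. x \<notin> N \<longrightarrow> g x = 0) \<longrightarrow>
         sqn (\<lambda>x. indicator (- G) x * block_average R S g x) \<le> ennreal e * sqn g)"
    by (rule block_average_exceptional_set[OF S ind p e R(1)]) blast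
  obtain G where G[measurable]: "G \<in> sets borel"
    and Gm: "\<And>a. emeasure lborel (G \<inter> ball a 1) \<le> ennreal K * emeasure lborel (N \<inter> ball a r)"
    and Gs: "\<And>g. \<lbrakk>g \<in> Lp 2; \<And>x. x \<notin> N \<Longrightarrow> g x = 0\<rbrakk> \<Longrightarrow>
         sqn (\<lambda>x. indicator (- G) x * block_average R S g x) \<le> ennreal e * sqn g"
    using K(2)[OF N(1)] by blast
  have GN: "G \<in> N_sets \<nu>"
  proof -
    obtain K' where "eventually (\<lambda>a. emeasure lborel (N \<inter> ball a r) \<le> ennreal (K' * \<nu> a)) at_infinity"
      using N_sets_large_ball[OF N, of r] \<nu> ratio by blast
    then have "eventually (\<lambda>a. emeasure lborel (G \<inter> ball a 1) \<le> ennreal (K * K' * \<nu> a)) at_infinity"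
    proof eventually_elim
      case (elim a)
      have "emeasure lborel (G \<inter> ball a 1) \<le> ennreal K * ennreal (K' * \<nu> a)"
        using Gm elim by (meson mult_left_mono order_trans zero_le)
      also have "\<dots> = ennreal (K * K' * \<nu> a)"
        using K(1) by (simp add: ennreal_mult' mult.assoc)
      finally show ?case .
    qed
    then show ?thesis using N_sets_iff[OF G, of \<nu>] \<nu> by blast
  qed
  have "sqn (\<lambda>x. indicator (- G) x * S g x) \<le> ennreal \<epsilon> * sqn g"
    if g: "g \<in> Lp 2" and supp: "\<And>x. x \<notin> N \<Longrightarrow> g x = 0" for g
  proof -
    define h where "h x = indicator (- G) x * S g x" for x
    note [measurable] = L2_measurable[OF g] bounded_opers_measurable[OF S g]
    have [measurable]: "h \<in> borel_measurable borel" unfolding h_def by measurable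
    have bound: "sqn (\<lambda>x. indicator (big_box L) x * h x)
      \<le> ennreal \<epsilon> * sqn g + ennreal (2 * C) * sqn (\<lambda>x. indicator (- big_box L) x * g x)" for L
    proof -
      define gL where "gL x = indicator (big_box L) x * g x" for x
      define gL' where "gL' x = indicator (- big_box L) x * g x" for x
      have gL: "gL \<in> Lp 2" unfolding gL_def by (intro L2_indicator g) simp
      have gL': "gL' \<in> Lp 2" unfolding gL'_def by (intro L2_indicator g) simp
      have split: "g = (\<lambda>x. gL x + gL' x)" by (auto simp: gL_def gL'_def indicator_def fun_eq_iff)
      note [measurable] = bounded_opers_measurable[OF S gL] bounded_opers_measurable[OF S gL']
      \<comment> \<open>The corner depends on x only through the countably valued
        \<open>cell x\<close>, so measurability is checked for each fixed cell.\<close>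
      have [measurable]: "(\<lambda>x. S (\<lambda>y. indicator (block R (\<lambda>i. cell x i - j i)) y * gL y) x) \<in> borel_measurable borel" for j
      proof (rule measurable_compose_countable[where f = "\<lambda>m. S (\<lambda>y. indicator (block R (\<lambda>i. m i - j i)) y * gL y)" and g = cell])
        fix m
        show "S (\<lambda>y. indicator (block R (\<lambda>i. m i - j i)) y * gL y) \<in> borel_measurable borel"
          by (intro bounded_opers_measurable[OF S] L2_indicator gL) simp
      qed simp
      have [measurable]: "block_average R S gL \<in> borel_measurable borel"
        unfolding block_average_def[abs_def] by measurable
      let ?W = "\<lambda>x. indicator (big_box L) x :: complex"
      let ?G = "\<lambda>x. indicator (- G) x :: complex"
      define A where "A x = ?W x * (S gL x - block_average R S gL x)" for x
      define B where "B x = ?G x * block_average R S gL x" for x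
      have [measurable]: "A \<in> borel_measurable borel" "B \<in> borel_measurable borel"
        unfolding A_def B_def by measurable
      have gLg: "sqn gL \<le> sqn g" unfolding gL_def by (intro sqn_mult_le1) (simp add: indicator_def)
      have "sqn A \<le> ennreal e * sqn gL" unfolding A_def by (intro R gL) (simp add: gL_def)
      also have "\<dots> \<le> ennreal e * sqn g" by (intro mult_left_mono gLg) simp
      finally have A: "sqn A \<le> ennreal e * sqn g" .
      have "sqn B \<le> ennreal e * sqn gL" unfolding B_def by (intro Gs gL) (simp add: gL_def supp)
      also have "\<dots> \<le> ennreal e * sqn g" by (intro mult_left_mono gLg) simp
      finally have B: "sqn B \<le> ennreal e * sqn g" .
      have "sqn (\<lambda>x. ?W x * h x) = sqn (\<lambda>x. ?W x * ?G x * S gL x + ?W x * ?G x * S gL' x)"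
        using bounded_opers_add[OF S gL gL'] unfolding split[symmetric] h_def
        by (intro sqn_cong_AE, eventually_elim) (simp add: algebra_simps)
      also have "\<dots> \<le> 2 * sqn (\<lambda>x. ?W x * ?G x * S gL x) + 2 * sqn (\<lambda>x. ?W x * ?G x * S gL' x)"
        by (intro sqn_add_le) measurable
      also have "\<dots> \<le> 2 * (2 * (ennreal e * sqn g) + 2 * (ennreal e * sqn g)) + 2 * (ennreal C * sqn gL')"
      proof (intro add_mono mult_left_mono)
        have "sqn (\<lambda>x. ?W x * ?G x * S gL x) = sqn (\<lambda>x. ?G x * A x + ?W x * B x)"
          by (intro sqn_cong_AE always_eventually) (auto simp: A_def B_def algebra_simps)
        also have "\<dots> \<le> 2 * sqn (\<lambda>x. ?G x * A x) + 2 * sqn (\<lambda>x. ?W x * B x)"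
          by (intro sqn_add_le) measurable
        also have "\<dots> \<le> 2 * sqn A + 2 * sqn B"
          by (intro add_mono mult_left_mono sqn_mult_le1) (auto simp: indicator_def)
        also have "\<dots> \<le> 2 * (ennreal e * sqn g) + 2 * (ennreal e * sqn g)"
          by (intro add_mono mult_left_mono A B) auto
        finally show "sqn (\<lambda>x. ?W x * ?G x * S gL x) \<le> 2 * (ennreal e * sqn g) + 2 * (ennreal e * sqn g)" .
        have "sqn (\<lambda>x. ?W x * ?G x * S gL' x) \<le> sqn (S gL')"
          by (intro sqn_mult_le1) (auto simp: indicator_def)
        also have "\<dots> \<le> ennreal C * sqn gL'" by (intro C gL')
        finally show "sqn (\<lambda>x. ?W x * ?G x * S gL' x) \<le> ennreal C * sqn gL'" .
      qed auto
      also have "\<dots> = 8 * ennreal e * sqn g + 2 * ennreal C * sqn gL'"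
        by (simp add: mult.assoc flip: distrib_right)
      also have "8 * ennreal e = ennreal \<epsilon>" 
      proof -
        have "ennreal (8 * e) = 8 * ennreal e" by (simp add: ennreal_mult')
        then show ?thesis by (simp add: e_def)
      qed
      also have "2 * ennreal C = ennreal (2 * C)" using C by (simp add: ennreal_mult')
      finally show ?thesis by (simp add: gL'_def[abs_def])
    qed
    have "(\<lambda>L. ennreal \<epsilon> * sqn g + ennreal (2 * C) * sqn (\<lambda>x. indicator (- big_box L) x * g x))
        \<longlonglongrightarrow> ennreal \<epsilon> * sqn g + ennreal (2 * C) * 0"
      using g by (intro tendsto_add tendsto_const tendsto_mult_ennreal sqn_big_box_tendsto(2)) (auto simp: L2_iff)
    with sqn_big_box_tendsto(1)[of h] have "sqn h \<le> ennreal \<epsilon> * sqn g + ennreal (2 * C) * 0"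
      using bound by (intro LIMSEQ_le[of _ "sqn h"]) auto
    then show ?thesis by (simp add: h_def[abs_def])
  qed
  then show ?thesis using G GN by auto
qed

section \<open>Approximation of S \<phi>(Q) by operators cut to an exceptional set\<close>

theorem theorem6p5:
  fixes \<nu> :: "real ^ 'n \<Rightarrow> real" and S :: "(real ^ 'n) oper" and p :: real
  assumes "\<And>a. 0 < \<nu> a"
    and "Liminf at_infinity (\<lambda>a. ereal (\<nu> a)) = 0"
    and "\<And>r::real. bdd_above {\<nu> b / \<nu> a | a b. norm (b - a) \<le> r}"
    and "S \<in> bounded_opers 2"
    and "class_Cu S"
    and "1 \<le> p" and "p < 2"
    and "induces_bounded p S"
  shows "left_decay_preserving (F_sets \<nu>) S"
  unfolding left_decay_preserving_def
proof (intro conjI ballI)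
  note S = assms(4)
  show "S \<in> bounded_opers 2" by fact
  fix \<phi> assume \<phi>: "\<phi> \<in> B_vanishing (F_sets \<nu>)"
  then have [measurable]: "\<phi> \<in> borel_measurable borel" by (simp add: B_vanishing_def)
  obtain c where c: "\<And>x. cmod (\<phi> x) \<le> c" "c > 0"
    using \<phi> by (auto simp: B_vanishing_def bounded_pos)
  obtain C where C: "\<And>f. f \<in> Lp 2 \<Longrightarrow> sqn (S f) \<le> ennreal C * sqn f" "C > 0"
    using bounded_opers_sqn_bound[OF S] by metis
  have \<phi>L2: "(\<lambda>y. \<phi> y * f y) \<in> Lp 2" if "f \<in> Lp 2" for f
    using that c by (intro L2_mult[where c = c]) auto
  define A where "A = S \<circ> mult_oper \<phi>"
  have A_eq: "A f = S (\<lambda>y. \<phi> y * f y)" for f by (simp add: A_def mult_oper_def)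
  have A_L2: "A f \<in> Lp 2" if "f \<in> Lp 2" for f
    unfolding A_eq by (intro bounded_opers_Lp[OF S] \<phi>L2 that)
  have "A \<in> bounded_opers 2"
    unfolding A_def by (rule bounded_opers_comp_mult_oper[OF S _ c(1)]) measurable
  have "\<exists>B\<in>oper_span {mult_oper \<psi> \<circ> T | \<psi> T. \<psi> \<in> B_vanishing (F_sets \<nu>) \<and> T \<in> bounded_opers 2}.
      oper_norm 2 (A - B) < \<epsilon>" if \<epsilon>: "\<epsilon> > 0" for \<epsilon>
  proof -
    \<comment> \<open>The parts of \<phi> on N and off N each cost 2 \<epsilon>', together
      (\<epsilon> / 2)^2; the half leaves room for the strict inequality.\<close>
    define \<epsilon>' where "\<epsilon>' = (\<epsilon> / 2)\<^sup>2 / 4"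
    have \<epsilon>': "\<epsilon>' > 0" using \<epsilon> by (simp add: \<epsilon>'_def)
    \<comment> \<open>Where |\<phi>| < t, boundedness of S alone gives the error C t^2 =
      \<epsilon>'.\<close>
    define t where "t = sqrt (\<epsilon>' / C)"
    have t: "t > 0" "C * t\<^sup>2 = \<epsilon>'" using \<epsilon>' C by (auto simp: t_def)
    define N where "N = {x. cmod (\<phi> x) \<ge> t}"
    have N[measurable]: "N \<in> sets borel" unfolding N_def by measurable
    have "{x. cmod (\<phi> x) < t} \<in> F_sets \<nu>" using \<phi> t by (simp add: B_vanishing_def)
    moreover have "- {x. cmod (\<phi> x) < t} = N" by (auto simp: N_def)
    ultimately have NN: "N \<in> N_sets \<nu>" by (simp add: F_sets_def)
    \<comment> \<open>Multiplication by \<phi> costs c^2 in \<open>sqn\<close>, which is divided out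
      in advance.\<close>
    have pos: "\<epsilon>' / c\<^sup>2 > 0" using \<epsilon>' c by simp
    obtain G where G[measurable]: "G \<in> sets borel" and GN: "G \<in> N_sets \<nu>"
      and GS: "\<forall>g\<in>Lp 2. (\<forall>x. x \<notin> N \<longrightarrow> g x = 0) \<longrightarrow>
        sqn (\<lambda>x. indicator (- G) x * S g x) \<le> ennreal (\<epsilon>' / c\<^sup>2) * sqn g"
      using exceptional_set_for_small_set[OF assms(1,3,5,8,6,7) N NN pos] by auto
    define \<psi> :: "real ^ 'n \<Rightarrow> complex" where "\<psi> = indicator G"
    have "{x. cmod (\<psi> x) < d} \<in> F_sets \<nu>" if "d > 0" for d
    proof -
      have "- {x. cmod (\<psi> x) < d} \<subseteq> G" using that by (auto simp: \<psi>_def indicator_def split: if_splits)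
      then have "- {x. cmod (\<psi> x) < d} \<in> N_sets \<nu>" using GN by (rule N_sets_mono)
      then show ?thesis by (simp add: F_sets_def)
    qed
    then have \<psi>: "\<psi> \<in> B_vanishing (F_sets \<nu>)"
    proof -
      have "bounded (range \<psi>)"
        by (rule boundedI[of _ 1]) (auto simp: \<psi>_def indicator_def)
      moreover have "\<psi> \<in> borel_measurable borel" unfolding \<psi>_def by measurable
      ultimately show ?thesis
        using \<open>\<And>d. d > 0 \<Longrightarrow> {x. cmod (\<psi> x) < d} \<in> F_sets \<nu>\<close> by (simp add: B_vanishing_def)
    qed
    \<comment> \<open>One summand suffices: T is S \<phi>(Q) itself and \<psi> the indicator of G,
      so that A - B is A followed by restriction to the complement of G.\<close>
    define B where "B = (\<lambda>f x. \<Sum>j<(1::nat). 1 * (mult_oper \<psi> \<circ> A) f x)"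
    have "B \<in> oper_span {mult_oper \<psi> \<circ> T | \<psi> T. \<psi> \<in> B_vanishing (F_sets \<nu>) \<and> T \<in> bounded_opers 2}"
    proof -
      have mem: "mult_oper \<psi> \<circ> A \<in> {mult_oper \<psi> \<circ> T | \<psi> T. \<psi> \<in> B_vanishing (F_sets \<nu>) \<and> T \<in> bounded_opers 2}"
        using \<psi> \<open>A \<in> bounded_opers 2\<close> by blast
      show ?thesis
        unfolding oper_span_def B_def
        by (rule CollectI, rule exI[of _ "1::nat"], rule exI[of _ "\<lambda>_. 1"], rule exI[of _ "\<lambda>_. mult_oper \<psi> \<circ> A"],
            intro conjI refl allI impI, rule mem)
    qed
    moreover have "oper_norm 2 (A - B) \<le> \<epsilon> / 2"
    proof (rule oper_norm_le)
      have AB: "(A - B) f = (\<lambda>x. indicator (- G) x * A f x)" for f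
        by (auto simp: B_def \<psi>_def mult_oper_def indicator_def fun_eq_iff)
      fix f :: "real ^ 'n \<Rightarrow> complex" assume f: "f \<in> Lp 2"
      show "(A - B) f \<in> Lp 2" unfolding AB by (intro L2_indicator A_L2 f) simp
      define g where "g x = indicator N x * (\<phi> x * f x)" for x
      define g' where "g' x = indicator (- N) x * (\<phi> x * f x)" for x
      have g: "g \<in> Lp 2" "g' \<in> Lp 2" unfolding g_def g'_def by (intro L2_indicator \<phi>L2 f; simp)+
      note [measurable] = bounded_opers_measurable[OF S g(1)] bounded_opers_measurable[OF S g(2)]
        L2_measurable[OF f]
      have split: "(\<lambda>y. \<phi> y * f y) = (\<lambda>y. g y + g' y)"
        by (auto simp: g_def g'_def indicator_def fun_eq_iff)
      have "sqn ((A - B) f) = sqn (\<lambda>x. indicator (- G) x * S g x + indicator (- G) x * S g' x)"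
        unfolding AB A_eq split using bounded_opers_add[OF S g]
        by (intro sqn_cong_AE, eventually_elim) (simp add: distrib_left)
      also have "\<dots> \<le> 2 * sqn (\<lambda>x. indicator (- G) x * S g x) + 2 * sqn (\<lambda>x. indicator (- G) x * S g' x)"
        by (intro sqn_add_le) measurable
      also have "\<dots> \<le> 2 * (ennreal \<epsilon>' * sqn f) + 2 * (ennreal \<epsilon>' * sqn f)"
      proof (intro add_mono mult_left_mono)
        have "sqn g \<le> sqn (\<lambda>x. \<phi> x * f x)" unfolding g_def by (intro sqn_mult_le1) (simp add: indicator_def)
        also have "\<dots> \<le> ennreal (c\<^sup>2) * sqn f" by (intro sqn_mult_le c) measurable
        finally have gf: "sqn g \<le> ennreal (c\<^sup>2) * sqn f" .
        have "sqn (\<lambda>x. indicator (- G) x * S g x) \<le> ennreal (\<epsilon>' / c\<^sup>2) * sqn g"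
          using g by (intro GS[rule_format]) (auto simp: g_def)
        also have "\<dots> \<le> ennreal (\<epsilon>' / c\<^sup>2) * (ennreal (c\<^sup>2) * sqn f)" by (intro mult_left_mono gf) simp
        also have "\<dots> = ennreal (\<epsilon>' / c\<^sup>2 * c\<^sup>2) * sqn f"
          using order_less_imp_le[OF pos] by (simp only: ennreal_mult zero_le_power2 mult.assoc)
        finally show "sqn (\<lambda>x. indicator (- G) x * S g x) \<le> ennreal \<epsilon>' * sqn f" using c by simp
        have "sqn (\<lambda>x. indicator (- G) x * S g' x) \<le> sqn (S g')"
          by (intro sqn_mult_le1) (simp add: indicator_def)
        also have "\<dots> \<le> ennreal C * sqn g'" by (intro C g)
        also have "sqn g' \<le> ennreal (t\<^sup>2) * sqn f"
        proof -
          have g'_eq: "g' = (\<lambda>x. (indicator (- N) x * \<phi> x) * f x)" by (simp add: g'_def fun_eq_iff)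
          have "cmod (indicator (- N) x * \<phi> x) \<le> t" for x
            using t(1) by (simp add: indicator_def N_def)
          then show ?thesis unfolding g'_eq by (rule sqn_mult_le) measurable
        qed
        then have "ennreal C * sqn g' \<le> ennreal C * (ennreal (t\<^sup>2) * sqn f)" by (intro mult_left_mono) auto
        also have "\<dots> = ennreal (C * t\<^sup>2) * sqn f" using C by (simp add: ennreal_mult mult.assoc)
        finally show "sqn (\<lambda>x. indicator (- G) x * S g' x) \<le> ennreal \<epsilon>' * sqn f" using t by simp
      qed auto
      also have "\<dots> = 4 * ennreal \<epsilon>' * sqn f" by (simp add: mult.assoc flip: distrib_right)
      also have "4 * ennreal \<epsilon>' = ennreal ((\<epsilon> / 2)\<^sup>2)"
      proof -
        have "ennreal (4 * \<epsilon>') = 4 * ennreal \<epsilon>'" by (simp add: ennreal_mult')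
        then show ?thesis by (simp add: \<epsilon>'_def)
      qed
      finally show "sqn ((A - B) f) \<le> ennreal ((\<epsilon> / 2)\<^sup>2) * sqn f" .
    qed (use \<epsilon> in simp)
    moreover have "\<epsilon> / 2 < \<epsilon>" using \<epsilon> by simp
    ultimately show ?thesis by (intro bexI[of _ B]) (rule le_less_trans)
  qed
  with \<open>A \<in> bounded_opers 2\<close> show "S \<circ> mult_oper \<phi> \<in> closed_oper_span 2
      {mult_oper \<psi> \<circ> T | \<psi> T. \<psi> \<in> B_vanishing (F_sets \<nu>) \<and> T \<in> bounded_opers 2}"
    unfolding closed_oper_span_def A_def[symmetric] by (intro CollectI conjI allI impI)
qed

end
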